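(* Let $1<p<\infty$, $q=p/(p-1)$, $p^*=\max\{p,q\}$. For every countable ordinal $\alpha<\omega_1$, the space $R^p_\alpha$ is $(p^*-1)^2(p^*/2)^{3/2}$-orthogonally complemented in its ambient $L_p$-space.
   Context: For a probability space $(\Omega,\mathcal A,\mu)$ and $C>0$, an orthogonal projection $P$ on $L_2(\Omega)$ is $p$-$C$-bounded if $\|Pf\|_p\le C\|f\|_p$ for all $f\in L_2\cap L_p$; a subspace $X\subseteq L_p(\Omega)$ is $C$-orthogonally complemented if it is the $\|\cdot\|_p$-closure of $P(L_2\cap L_p)$ for some such $P$. Disjoint sum: for a subspace $B\subseteq L_p(\Omega,\mathcal A,\mu)$, $(B\oplus B)_p$ is the subspace of $L_p(\Omega\times\{0,1\})$ ($\{0,1\}$ with the fair measure) of functions $b$ such that there are $b_0,b_1\in B$ with $b(\omega,\varepsilon)=b_\varepsilon(\omega)$ for all $\omega$, $\varepsilon\in\{0,1\}$. Independent sum: for subspaces $B_n\subseteq L_p(\Omega_n,\mathcal A_n,\mu_n)$ ($n$ in a countable index set), let $\overline B_n$ be the subspace of $L_p(\prod_n\Omega_n)$ of functions $b(\omega)=f(\omega_n)$ with $f\in B_n$; then $(\sum_nB_n)_{\mathrm{Ind},p}$ is the closed linear span of $\bigcup_n\overline B_n$ in $L_p(\prod_n\Omega_n)$. The spaces $R^p_\alpha$, $\alpha<\omega_1$, are defined recursively: $R^p_0$ is the space of constant functions in $L_p(\{0,1\})$; $R^p_{\alpha+1}=(R^p_\alpha\oplus R^p_\alpha)_p$; for a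 limit ordinal $\beta$, $R^p_\beta=(\sum_{\alpha<\beta}R^p_\alpha)_{\mathrm{Ind},p}$. *)

theory Defs
  imports "HOL-Probability.Probability"
begin

section \<open>L_p spaces (functions, modulo a.e. equality handled by the definitions)\<close>

definition Lp :: "'a measure \<Rightarrow> real \<Rightarrow> ('a \<Rightarrow> real) set" where
  "Lp M p = {f \<in> borel_measurable M. integrable M (\<lambda>w. \<bar>f w\<bar> powr p)}"

definition Lp_norm :: "'a measure \<Rightarrow> real \<Rightarrow> ('a \<Rightarrow> real) \<Rightarrow> real" where
  "Lp_norm M p f = (integral\<^sup>L M (\<lambda>w. \<bar>f w\<bar> powr p)) powr (1 / p)"

definition Lp_closure :: "'a measure \<Rightarrow> real \<Rightarrow> ('a \<Rightarrow> real) set \<Rightarrow> ('a \<Rightarrow> real) set" where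
  "Lp_closure M p S = {g \<in> Lp M p. \<forall>e>0. \<exists>f\<in>S. Lp_norm M p (\<lambda>w. g w - f w) < e}"

definition lin_span :: "('a \<Rightarrow> real) set \<Rightarrow> ('a \<Rightarrow> real) set" where
  "lin_span S = {(\<lambda>w. \<Sum>i<n. c i * g i w) | (n::nat) c g. \<forall>i<n. g i \<in> S}"

definition orth_proj :: "'a measure \<Rightarrow> (('a \<Rightarrow> real) \<Rightarrow> ('a \<Rightarrow> real)) \<Rightarrow> bool" where
  "orth_proj M P \<longleftrightarrow>
     (\<forall>f\<in>Lp M 2. P f \<in> Lp M 2) \<and>
     (\<forall>f\<in>Lp M 2. \<forall>g\<in>Lp M 2. (AE w in M. f w = g w) \<longrightarrow> (AE w in M. P f w = P g w)) \<and>
     (\<forall>f\<in>Lp M 2. \<forall>g\<in>Lp M 2. \<forall>a b::real.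
        AE w in M. P (\<lambda>v. a * f v + b * g v) w = a * P f w + b * P g w) \<and>
     (\<forall>f\<in>Lp M 2. AE w in M. P (P f) w = P f w) \<and>
     (\<forall>f\<in>Lp M 2. \<forall>g\<in>Lp M 2. (\<integral>w. P f w * g w \<partial>M) = (\<integral>w. f w * P g w \<partial>M))"

definition p_C_bounded :: "'a measure \<Rightarrow> real \<Rightarrow> real \<Rightarrow> (('a \<Rightarrow> real) \<Rightarrow> ('a \<Rightarrow> real)) \<Rightarrow> bool" where
  "p_C_bounded M p C P \<longleftrightarrow> (\<forall>f \<in> Lp M 2 \<inter> Lp M p. Lp_norm M p (P f) \<le> C * Lp_norm M p f)"

definition C_orth_complemented :: "'a measure \<Rightarrow> real \<Rightarrow> real \<Rightarrow> ('a \<Rightarrow> real) set \<Rightarrow> bool" where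
  "C_orth_complemented M p C X \<longleftrightarrow>
     (\<exists>P. orth_proj M P \<and> p_C_bounded M p C P \<and> X = Lp_closure M p (P ` (Lp M 2 \<inter> Lp M p)))"

text \<open>Omega_0 = {0,1} (Leaf), Omega_{a+1} = Omega_a x {0,1} (Node), and for limits
  the product over the (countably many, indexed by naturals) smaller ordinals (PT_Prod).\<close>
datatype pt = Leaf bool | Node pt bool | PT_Prod "nat \<Rightarrow> pt"

definition coord :: "nat \<Rightarrow> pt \<Rightarrow> pt" where
  "coord y z = (case z of PT_Prod w \<Rightarrow> w y | _ \<Rightarrow> undefined)"

text \<open>fair measure on {0,1} (False = 0, True = 1)\<close>
definition coin :: "bool measure" where
  "coin = measure_pmf (pmf_of_set UNIV)"

text \<open>Countable ordinals are represented by a well-order r on a set of naturals: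
  the ordinal attached to x \<in> Field r is the order type of {y. y <_r x}.
  Recursion along r computes the pair (ambient probability space, subspace R^p).\<close>

definition R_step :: "real \<Rightarrow> nat rel \<Rightarrow> (nat \<Rightarrow> pt measure \<times> (pt \<Rightarrow> real) set)
                       \<Rightarrow> nat \<Rightarrow> pt measure \<times> (pt \<Rightarrow> real) set" where
  "R_step p r F x =
     (let Pr = {y. (y, x) \<in> r - Id} in
      if Pr = {} then
        (let M = embed_measure coin Leaf in
          (M, {f \<in> Lp M p. \<exists>c. AE w in M. f w = c}))
      else if (\<exists>y\<in>Pr. \<forall>z\<in>Pr. (z, y) \<in> r) then
        (let y = (SOME y. y \<in> Pr \<and> (\<forall>z\<in>Pr. (z, y) \<in> r));
             My = fst (F y); B = snd (F y);
             M = embed_measure (My \<Otimes>\<^sub>M coin) (\<lambda>(w, e). Node w e) in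
          (M, {b \<in> Lp M p. \<exists>b0\<in>B. \<exists>b1\<in>B.
                 AE z in My \<Otimes>\<^sub>M coin. b (Node (fst z) (snd z)) = (if snd z then b1 (fst z) else b0 (fst z))}))
      else
        (let M = embed_measure (\<Pi>\<^sub>M y\<in>Pr. fst (F y)) PT_Prod;
             Bbar = (\<lambda>y. {b \<in> Lp M p. \<exists>g\<in>snd (F y). AE z in M. b z = g (coord y z)}) in
          (M, Lp_closure M p (lin_span (\<Union>y\<in>Pr. Bbar y)))))"

definition R_space :: "real \<Rightarrow> nat rel \<Rightarrow> nat \<Rightarrow> pt measure \<times> (pt \<Rightarrow> real) set" where
  "R_space p r = wfrec (r - Id) (R_step p r)"

end

theory Submission
  imports Defs
begin

text \<open>
  Every projection onto \<open>R\<^sup>p\<^sub>\<alpha>\<close> is a strong \<open>L\<^sub>2\<close>-limit of compressions to finite probability spaces built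
  from a point by disjoint and independent sums. On such a space write \<open>T F = \<Sum>\<^sub>k E[d\<^sub>k | G\<^sub>k]\<close>, where \<open>d\<^sub>k\<close> are
  the differences of \<open>F\<close> along the martingale that reveals the coordinates in a fixed order. Revealing
  the independent factors in the opposite order makes \<open>T F\<close> a martingale whose differences
  \<open>g\<^sub>k\<close> satisfy \<open>g\<^sub>k\<^sup>2 \<le> E[d\<^sub>k\<^sup>2 | H\<^sub>k]\<close> for the reversed filtration \<open>H\<^sub>k\<close>. For \<open>p > 2\<close>, a second order Taylor
  estimate and Doob's maximal inequality then give
  \<open>\<parallel>T F\<parallel>\<^sub>p\<^sup>2 \<le> p (p - 1) / 2 \<cdot> (p / (p - 1))\<^bsup>p - 2\<^esup> \<cdot> \<parallel>S(F)\<parallel>\<^sub>p\<^sup>2\<close>, and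
  \<open>\<parallel>S(F)\<parallel>\<^sub>p \<le> (p - 1) \<parallel>F\<parallel>\<^sub>p\<close> for the square function \<open>S\<close> is Burkholder's inequality. Both are proved by
  induction along the construction of the finite space, with two-point inequalities for explicit
  Bellman functions. The case \<open>p < 2\<close> follows by duality.
\<close>

text \<open>A bound with constant \<open>C\<close> for the summands gives no evident bound with the
  same \<open>C\<close> for their independent sum, so complementation with a fixed constant is no
  usable induction hypothesis along the ordinals. The hypothesis \<open>good\<close> therefore
  contains no constant: it asks only for approximability by finite trees, which both kinds of sum
  inherit. The constant enters once, in \<open>tproj_bound\<close>, uniformly over all trees. In a
  product the part of \<open>T F\<close> on the right factor forgets the left coordinates, so the
  sigma-algebras \<open>G_k\<close> are not nested, and \<open>T F\<close> is no martingale for the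
  order in which \<open>F\<close> is expanded. Reversing the order repairs this at a price: the
  square function of \<open>F\<close> appears against the weight (maximal function of
  \<open>T F\<close>) to the power \<open>p - 2\<close>, which depends on all coordinates. Doob's
  inequality turns this weight into a power of the norm of \<open>T F\<close>, which cancels. For
  \<open>p > 2\<close> the argument yields \<open>(p - 1)^2\<close> times the square root of
  \<open>p / 2\<close>, which lies below the stated constant.\<close>

section \<open>Scalar inequalities\<close>

text \<open>Burkholder's function, for a martingale at \<open>x\<close> whose square function has reached \<open>s\<close>.\<close>
definition bell :: "real \<Rightarrow> real \<Rightarrow> real \<Rightarrow> real" where
  "bell p x s = (\<bar>x\<bar> + s) powr p - p * \<bar>x\<bar> * (\<bar>x\<bar> + s) powr (p - 1)"

lemma continuous_on_powr_nonneg: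
  fixes f :: "'a::topological_space \<Rightarrow> real"
  assumes "continuous_on A f" "\<And>x. x \<in> A \<Longrightarrow> 0 \<le> f x" "0 < a"
  shows "continuous_on A (\<lambda>x. f x powr a)"
  using assms by (intro continuous_on_powr' continuous_on_const) auto

text \<open>\<open>c\<close> is the sign of \<open>x + a * t\<close> and \<open>a\<close> the
  direction of the step, so \<open>c * (x + a * t)\<close> stands for the absolute value away from
  its corner and one computation covers every branch of \<open>bell_two_point\<close>.\<close>

lemma bell_has_derivative:
  fixes a c t s p :: real
  assumes t: "0 < t" and p: "2 < p" and pos: "0 < c * (x + a * t)" and c: "c = 1 \<or> c = -1" and a: "a = 1 \<or> a = -1"
  shows "((\<lambda>t. (c * (x + a * t) + sqrt (s\<^sup>2 + t\<^sup>2)) powr p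
            - p * (c * (x + a * t)) * (c * (x + a * t) + sqrt (s\<^sup>2 + t\<^sup>2)) powr (p - 1))
     has_real_derivative
       - p * (c * (x + a * t) + sqrt (s\<^sup>2 + t\<^sup>2)) powr (p - 2) *
        ((p - 2) * t + (p - 1) * a * x + (p - 2) * (c * (x + a * t)) * t / sqrt (s\<^sup>2 + t\<^sup>2))) (at t)"
proof -
  define Y where "Y = sqrt (s\<^sup>2 + t\<^sup>2)"
  define X where "X = c * (x + a * t)"
  have st: "0 < s\<^sup>2 + t\<^sup>2" using t by (simp add: add_nonneg_pos)
  have Y: "Y > 0" using st by (simp add: Y_def)
  have Xp: "X > 0" using pos by (simp add: X_def)
  have dY: "((\<lambda>t. sqrt (s\<^sup>2 + t\<^sup>2)) has_real_derivative t / Y) (at t)"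
    using st by (auto intro!: derivative_eq_intros simp: Y_def field_simps)
  have dX: "((\<lambda>t. c * (x + a * t)) has_real_derivative c * a) (at t)"
    by (auto intro!: derivative_eq_intros)
  have dr: "((\<lambda>t. c * (x + a * t) + sqrt (s\<^sup>2 + t\<^sup>2)) has_real_derivative c * a + t / Y) (at t)"
    by (intro DERIV_add dX dY)
  have rpos: "c * (x + a * t) + sqrt (s\<^sup>2 + t\<^sup>2) > 0" using add_pos_pos[OF Xp Y] unfolding X_def Y_def .
  have d1: "((\<lambda>t. (c * (x + a * t) + sqrt (s\<^sup>2 + t\<^sup>2)) powr p) has_real_derivative
      p * (X + Y) powr (p - 1) * (c * a + t / Y)) (at t)"
    using DERIV_fun_powr[OF dr rpos, of p] by (simp add: X_def Y_def)
  have d2: "((\<lambda>t. (c * (x + a * t) + sqrt (s\<^sup>2 + t\<^sup>2)) powr (p-1)) has_real_derivative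
      (p-1) * (X + Y) powr (p - 2) * (c * a + t / Y)) (at t)"
    using DERIV_fun_powr[OF dr rpos, of "p-1"] by (simp add: X_def Y_def)
  have d3: "((\<lambda>t. p * (c * (x + a * t)) * (c * (x + a * t) + sqrt (s\<^sup>2 + t\<^sup>2)) powr (p - 1)) has_real_derivative
       p * (c * a) * (X + Y) powr (p - 1) + p * X * ((p-1) * (X + Y) powr (p - 2) * (c * a + t / Y))) (at t)"
    using DERIV_mult[OF DERIV_cmult[OF dX, of p] d2] by (simp add: X_def Y_def mult_ac)
  have e: "(X + Y) powr (p - 1) = (X + Y) * (X + Y) powr (p - 2)"
    using Xp Y powr_add[of "X+Y" 1 "p-2"] by simp
  have cc: "c * c = 1" "a * a = 1" using a c by auto
  have cX: "c * X = x + a * t" using cc by (simp add: X_def flip: mult.assoc)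
  have "p * (X + Y) powr (p - 1) * (c * a + k) - (p * (c * a) * (X + Y) powr (p - 1) + p * X * ((p-1) * (X + Y) powr (p - 2) * (c * a + k)))
    = p * (X + Y) powr (p - 2) * ((X + Y) * k - X * (p-1) * (c * a + k))" for k
    unfolding e by (simp add: algebra_simps)
  note this[of "t / Y"]
  also have "(X + Y) * (t/Y) - X * (p-1) * (c * a + t / Y) = t + X * (t/Y) - (p-1) * X * (t/Y) - (p-1) * (a * (c * X))"
    using Y by (simp add: field_simps)
  also have "\<dots> = - ((p - 2) * t + (p - 1) * a * x + (p - 2) * X * t / Y)"
  proof -
    have "t + X * k - (p-1) * X * k - (p-1) * (a * x + a * a * t) = - ((p - 2) * t + (p - 1) * a * x + (p - 2) * X * k)" for k
      unfolding cc by (simp add: algebra_simps)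
    from this[of "t / Y"] show ?thesis unfolding cX by (simp add: distrib_left mult.assoc)
  qed
  finally have *: "p * (X + Y) powr (p - 1) * (c * a + t / Y) - (p * (c * a) * (X + Y) powr (p - 1) + p * X * ((p-1) * (X + Y) powr (p - 2) * (c * a + t / Y))) =
     - p * (X + Y) powr (p - 2) * ((p - 2) * t + (p - 1) * a * x + (p - 2) * X * t / Y)" by (simp only: mult_minus_left mult_minus_right)
  show ?thesis using DERIV_diff[OF d1 d3] unfolding * by (simp add: X_def Y_def)
qed

text \<open>By evenness take \<open>x\<close> and \<open>d\<close> nonnegative and let the step grow
  from 0 to \<open>d\<close>: the sum \<open>g\<close> of the two values decreases. The corner of
  the absolute value at \<open>t = x\<close> forces the split at the end.\<close>

lemma bell_two_point:
  fixes p x d s :: real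
  assumes p: "2 < p" and s: "0 \<le> s"
  shows "(bell p (x + d) (sqrt (s\<^sup>2 + d\<^sup>2)) + bell p (x - d) (sqrt (s\<^sup>2 + d\<^sup>2))) / 2 \<le> bell p x s"
proof -
  have main: "(bell p (x + d) (sqrt (s\<^sup>2 + d\<^sup>2)) + bell p (x - d) (sqrt (s\<^sup>2 + d\<^sup>2))) \<le> 2 * bell p x s"
    if x: "0 \<le> x" and d: "0 \<le> d" for x d
  proof -
    define g where "g t = bell p (x + t) (sqrt (s\<^sup>2 + t\<^sup>2)) + bell p (x - t) (sqrt (s\<^sup>2 + t\<^sup>2))" for t
    have cont: "continuous_on A g" for A
      unfolding g_def bell_def using p s
      by (intro continuous_on_add continuous_on_diff continuous_on_mult continuous_on_powr_nonneg continuous_on_rabs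
          continuous_on_real_sqrt continuous_on_power continuous_on_id continuous_on_const) auto
    have der: "\<exists>y. DERIV g t :> y \<and> y \<le> 0" if t: "0 < t" "t \<noteq> x" for t
    proof -
      define c :: real where "c = sgn (x - t)"
      have c: "c = 1 \<or> c = -1" using t by (auto simp: c_def sgn_if)
      define Y where "Y = sqrt (s\<^sup>2 + t\<^sup>2)"
      have Y: "Y > 0" using t by (simp add: Y_def add_nonneg_pos)
      have cp: "0 < c * (x + (-1) * t)" using t by (auto simp: c_def sgn_if)
      have ca: "c * (x + (-1) * t) = \<bar>x - t\<bar>" using cp c by auto
      define Ap where "Ap = (p - 2) * t + (p - 1) * x + (p - 2) * (x + t) * t / Y"
      define Am where "Am = (p - 2) * t + (p - 1) * (-1) * x + (p - 2) * \<bar>x - t\<bar> * t / Y"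
      have D1: "((\<lambda>t. bell p (x + t) (sqrt (s\<^sup>2 + t\<^sup>2))) has_real_derivative
          - p * (x + t + Y) powr (p - 2) * Ap) (at t)"
      proof (rule has_field_derivative_transform_within_open[where S="{0<..}"])
        show "((\<lambda>t. (1 * (x + 1 * t) + sqrt (s\<^sup>2 + t\<^sup>2)) powr p
            - p * (1 * (x + 1 * t)) * (1 * (x + 1 * t) + sqrt (s\<^sup>2 + t\<^sup>2)) powr (p - 1)) has_real_derivative
          - p * (x + t + Y) powr (p - 2) * Ap) (at t)"
          using bell_has_derivative[of t p 1 x 1 s] t x p by (simp add: Ap_def Y_def)
      qed (use t x in \<open>auto simp: bell_def\<close>)
      have D2: "((\<lambda>t. bell p (x - t) (sqrt (s\<^sup>2 + t\<^sup>2))) has_real_derivative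
          - p * (\<bar>x - t\<bar> + Y) powr (p - 2) * Am) (at t)"
      proof (rule has_field_derivative_transform_within_open[where S="{u. 0 < c * (x - u)}"])
        show "((\<lambda>t. (c * (x + (-1) * t) + sqrt (s\<^sup>2 + t\<^sup>2)) powr p
            - p * (c * (x + (-1) * t)) * (c * (x + (-1) * t) + sqrt (s\<^sup>2 + t\<^sup>2)) powr (p - 1)) has_real_derivative
          - p * (\<bar>x - t\<bar> + Y) powr (p - 2) * Am) (at t)"
          using bell_has_derivative[OF t(1) p cp c, of s] unfolding ca by (simp add: Am_def Y_def)
        show "open {u. 0 < c * (x - u)}" by (intro open_Collect_less continuous_intros)
        show "t \<in> {u. 0 < c * (x - u)}" using cp by simp
        fix u assume "u \<in> {u. 0 < c * (x - u)}"
        then have "c * (x + (-1) * u) = \<bar>x - u\<bar>" using c by auto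
        then show "(c * (x + (-1) * u) + sqrt (s\<^sup>2 + u\<^sup>2)) powr p
            - p * (c * (x + (-1) * u)) * (c * (x + (-1) * u) + sqrt (s\<^sup>2 + u\<^sup>2)) powr (p - 1) = bell p (x - u) (sqrt (s\<^sup>2 + u\<^sup>2))"
          by (simp add: bell_def)
      qed
      \<comment> \<open>The terms with \<open>(p - 1) * x\<close> cancel in \<open>Ap + Am\<close>
        and the rest is nonnegative. So a possible increase of the lower branch is at most the
        decrease of the upper one, which also carries the larger weight.\<close>
      have Ap0: "0 \<le> Ap" using t p x Y by (simp add: Ap_def)
      have Ap1: "- Am \<le> Ap"
      proof -
        have "0 \<le> (p - 2) * t" "0 \<le> (p - 2) * (x + t) * t / Y" "0 \<le> (p - 2) * \<bar>x - t\<bar> * t / Y"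
          using t p x Y by auto
        then show ?thesis unfolding Ap_def Am_def by linarith
      qed
      have "(\<bar>x - t\<bar> + Y) powr (p - 2) \<le> (x + t + Y) powr (p - 2)"
        using t p x Y by (intro powr_mono2) auto
      then have "(\<bar>x - t\<bar> + Y) powr (p - 2) * (- Am) \<le> (x + t + Y) powr (p - 2) * Ap"
        by (smt (verit) Ap0 Ap1 mult_left_mono mult_right_mono powr_ge_zero)
      then have "p * ((\<bar>x - t\<bar> + Y) powr (p - 2) * (- Am)) \<le> p * ((x + t + Y) powr (p - 2) * Ap)"
        using p by (intro mult_left_mono) auto
      then have "- p * (x + t + Y) powr (p - 2) * Ap + - p * (\<bar>x - t\<bar> + Y) powr (p - 2) * Am \<le> 0"
        by (simp add: algebra_simps)
      then show ?thesis using DERIV_add[OF D1 D2] unfolding g_def by blast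
    qed
    have "g d \<le> g 0"
    proof (cases "d \<le> x")
      case True
      show ?thesis by (rule DERIV_nonpos_imp_decreasing_open[OF d _ cont]) (use der True in auto)
    next
      case False
      have "g d \<le> g x" by (rule DERIV_nonpos_imp_decreasing_open[OF _ _ cont]) (use der False x in auto)
      also have "g x \<le> g 0" by (rule DERIV_nonpos_imp_decreasing_open[OF x _ cont]) (use der False x in auto)
      finally show ?thesis .
    qed
    then show ?thesis using s by (simp add: g_def)
  qed
  have "\<bar>\<bar>x\<bar> + \<bar>d\<bar>\<bar> = \<bar>x + d\<bar> \<and> \<bar>\<bar>x\<bar> - \<bar>d\<bar>\<bar> = \<bar>x - d\<bar> \<or>
    \<bar>\<bar>x\<bar> + \<bar>d\<bar>\<bar> = \<bar>x - d\<bar> \<and> \<bar>\<bar>x\<bar> - \<bar>d\<bar>\<bar> = \<bar>x + d\<bar>" by linarith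
  then have "bell p (\<bar>x\<bar> + \<bar>d\<bar>) z + bell p (\<bar>x\<bar> - \<bar>d\<bar>) z = bell p (x + d) z + bell p (x - d) z" for z
    by (auto simp: bell_def simp del: abs_abs)
  moreover have "bell p \<bar>x\<bar> s = bell p x s" by (simp add: bell_def)
  ultimately show ?thesis using main[of "\<bar>x\<bar>" "\<bar>d\<bar>"] by simp
qed

text \<open>The difference of the two sides vanishes at \<open>z = 0\<close>, and its derivative has
  the sign of \<open>z\<close> because \<open>1 - z / p\<close> lies between \<open>1\<close> and
  \<open>1 - z\<close>.\<close>

lemma bell_majorant_aux:
  fixes p z :: real
  assumes p: "2 < p" and z: "z \<le> 1"
  shows "1 - (1 - z) powr p \<le> p * z * (1 - z / p) powr (p - 1)"
proof -
  define k where "k z = p * z * (1 - z / p) powr (p - 1) + (1 - z) powr p - 1" for z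
  have der: "(k has_real_derivative p * (1 - z) * ((1 - z / p) powr (p - 2) - (1 - z) powr (p - 2))) (at z)"
    if z: "z < 1" for z
  proof -
    have pos: "1 - z / p > 0" "1 - z > 0" using z p by (auto simp: field_simps)
    have e: "(1 - z / p) powr (p - 1) = (1 - z / p) * (1 - z/p) powr (p - 2)"
       "(1 - z) powr (p - 1) = (1 - z) * (1 - z) powr (p - 2)"
      using pos powr_add[of "1 - z/p" 1 "p-2"] powr_add[of "1 - z" 1 "p-2"] by simp_all
    have d1: "((\<lambda>z. (1 - z / p) powr (p - 1)) has_real_derivative (p - 1) * (1 - z / p) powr (p - 2) * (- (1 / p))) (at z)"
      using DERIV_fun_powr[of "\<lambda>z. 1 - z / p" "- (1 / p)" z "p - 1"] pos p
      by (auto intro!: derivative_eq_intros)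
    have d2: "((\<lambda>z. (1 - z) powr p) has_real_derivative p * (1 - z) powr (p - 1) * (- 1)) (at z)"
      using DERIV_fun_powr[of "\<lambda>z. 1 - z" "- 1" z "p"] pos
      by (auto intro!: derivative_eq_intros)
    have d0: "((\<lambda>z. p * z) has_real_derivative p) (at z)" by (auto intro!: derivative_eq_intros)
    have "(k has_real_derivative p * (1 - z / p) powr (p - 1) + (p - 1) * (1 - z / p) powr (p - 2) * (- (1 / p)) * (p * z) + p * (1 - z) powr (p - 1) * (- 1) - 0) (at z)"
      unfolding k_def using DERIV_diff[OF DERIV_add[OF DERIV_mult[OF d0 d1] d2] DERIV_const] by (simp add: mult_ac)
    also have "p * (1 - z / p) powr (p - 1) + (p - 1) * (1 - z / p) powr (p - 2) * (- (1 / p)) * (p * z) + p * (1 - z) powr (p - 1) * (- 1) - 0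
       = p * (1 - z) * ((1 - z / p) powr (p - 2) - (1 - z) powr (p - 2))"
      unfolding e using p by (simp add: field_simps)
    finally show ?thesis .
  qed
  have cont: "continuous_on {0..z} k" if "z \<le> 1" "0 \<le> z" for z
  proof -
    have "w \<le> p" if "w \<le> z" for w using that \<open>z \<le> 1\<close> p by linarith
    then show ?thesis
      unfolding k_def using p that
      by (intro continuous_intros continuous_on_powr') (auto simp: divide_le_eq)
  qed
  have "0 \<le> k z"
  proof (cases "0 \<le> z")
    case True
    have "k 0 \<le> k z"
    proof (rule DERIV_nonneg_imp_increasing_open[OF True _ cont[OF z True]])
      fix w assume w: "0 < w" "w < z"
      then have "(1 - w) powr (p - 2) \<le> (1 - w / p) powr (p - 2)"
        using p z by (intro powr_mono2) (auto simp: divide_le_eq mult_le_cancel_left1)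
      then show "\<exists>y. (k has_real_derivative y) (at w) \<and> 0 \<le> y"
        using der[of w] w z p by (intro exI conjI) auto
    qed
    then show ?thesis by (simp add: k_def)
  next
    case False
    have "k 0 \<le> k z"
    proof (rule DERIV_nonpos_imp_nonincreasing[of z 0 k])
      fix w assume w: "z \<le> w" "w \<le> 0"
      have "(1 - w/p) powr (p - 2) \<le> (1 - w) powr (p - 2)"
      proof (intro powr_mono2)
        have "w * p \<le> w * 1" using w p by (intro mult_left_mono_neg) auto
        then show "1 - w / p \<le> 1 - w" using p by (simp add: le_divide_eq)
        have "w / p \<le> 0" using w p by (simp add: divide_nonpos_pos)
        then show "0 \<le> 1 - w / p" by simp
      qed (use p in auto)
      then have "p * (1 - w) * ((1 - w / p) powr (p - 2) - (1 - w) powr (p - 2)) \<le> 0"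
        using w p by (intro mult_nonneg_nonpos) auto
      then show "\<exists>y. (k has_real_derivative y) (at w) \<and> y \<le> 0"
        using der[of w] w by (intro exI conjI) auto
    qed (use False in auto)
    then show ?thesis by (simp add: k_def)
  qed
  then show ?thesis by (simp add: k_def)
qed

text \<open>Both sides are homogeneous of degree \<open>p\<close>, which reduces the case
  \<open>s > 0\<close> to \<open>bell_majorant_aux\<close> with
  \<open>z = 1 - (p - 1) * |x| / s\<close>. The factor in front of \<open>bell\<close> makes the two
  sides touch to first order on its zero line \<open>s = (p - 1) * |x|\<close>.\<close>

lemma bell_majorant:
  fixes p x s :: real
  assumes p: "2 < p" and s: "0 \<le> s"
  shows "s powr p - (p - 1) powr p * \<bar>x\<bar> powr p \<le> p * ((p - 1) / p) powr (p - 1) * bell p x s"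
proof (cases "s = 0")
  case False
  with s have s: "s > 0" by simp
  define v where "v = (p - 1) * \<bar>x\<bar>"
  define z where "z = 1 - v / s"
  have v0: "v \<ge> 0" using p by (simp add: v_def)
  have z1: "z \<le> 1" using v0 s by (simp add: z_def)
  have "s powr p * (1 - (1 - z) powr p) \<le> s powr p * (p * z * (1 - z / p) powr (p - 1))"
    by (intro mult_left_mono bell_majorant_aux[OF p z1]) auto
  moreover have "s powr p * (1 - z) powr p = v powr p"
    using s v0 by (simp add: z_def powr_divide)
  moreover have "v powr p = (p - 1) powr p * \<bar>x\<bar> powr p"
    using p by (simp add: v_def powr_mult)
  moreover have "s powr p * (p * z * (1 - z / p) powr (p - 1)) = p * ((p - 1) / p) powr (p - 1) * bell p x s"
  proof -
    have r: "\<bar>x\<bar> + s > 0" using s by simp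
    have "1 - z / p = ((p - 1) / p) * ((\<bar>x\<bar> + s) / s)"
      using s p by (simp add: z_def v_def field_simps)
    then have 1: "(1 - z / p) powr (p - 1) = ((p - 1) / p) powr (p - 1) * ((\<bar>x\<bar> + s) powr (p - 1) / s powr (p - 1))"
      using p s r by (simp add: powr_mult powr_divide)
    have 2: "s powr p = s * s powr (p - 1)" using powr_add[of s 1 "p - 1"] s by simp
    have 3: "bell p x s = (s - v) * (\<bar>x\<bar> + s) powr (p - 1)"
      using powr_add[of "\<bar>x\<bar> + s" 1 "p - 1"] r by (simp add: bell_def v_def algebra_simps)
    have 4: "s * z = s - v" using s by (simp add: z_def field_simps)
    have "s powr p * (p * z * (1 - z / p) powr (p - 1)) = p * (s * z) * ((p - 1) / p) powr (p - 1) * (\<bar>x\<bar> + s) powr (p - 1)"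
      unfolding 1 2 using s by (simp add: field_simps)
    then show ?thesis unfolding 3 4 by (simp add: mult_ac)
  qed
  moreover have "s powr p * (1 - (1 - z) powr p) = s powr p - s powr p * (1 - z) powr p"
    by (simp add: algebra_simps)
  ultimately show ?thesis by linarith
next
  case True
  have "p * ((p - 1) / p) powr (p - 1) \<le> (p - 1) powr (p - 1)"
  proof -
    have "p powr 1 \<le> p powr (p - 1)" using p by (intro powr_mono) auto
    then show ?thesis using p by (simp add: powr_divide field_simps)
  qed
  then have "p * ((p - 1) / p) powr (p - 1) * ((p - 1) * \<bar>x\<bar> powr p) \<le> (p - 1) powr (p - 1) * ((p - 1) * \<bar>x\<bar> powr p)"
    using p by (intro mult_right_mono) auto
  also have "\<dots> = (p - 1) powr p * \<bar>x\<bar> powr p" using powr_add[of "p - 1" 1 "p - 1"] p by simp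
  finally have 1: "p * ((p - 1) / p) powr (p - 1) * ((p - 1) * \<bar>x\<bar> powr p) \<le> (p - 1) powr p * \<bar>x\<bar> powr p" .
  have "bell p x 0 = - ((p - 1) * \<bar>x\<bar> powr p)"
    using powr_add[of "\<bar>x\<bar>" 1 "p - 1"] by (cases "x = 0") (simp_all add: bell_def algebra_simps)
  with 1 True show ?thesis by simp
qed

section \<open>Doob's maximal inequality at a single step\<close>

text \<open>The Bellman function of Doob's inequality, for a martingale at \<open>y\<close> with running maximum \<open>m\<close>.\<close>
definition doob :: "real \<Rightarrow> real \<Rightarrow> real \<Rightarrow> real" where
  "doob p y m = m powr p - p / (p - 1) * \<bar>y\<bar> * m powr (p - 1)"

lemma doob_one_point:
  fixes p v m :: real
  assumes p: "2 < p" and m: "0 \<le> m"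
  shows "doob p v (max m \<bar>v\<bar>) \<le> m powr p - p / (p - 1) * \<bar>v\<bar> * m powr (p - 1)"
proof (cases "\<bar>v\<bar> \<le> m")
  case True
  then show ?thesis by (simp add: doob_def max_def)
next
  case False
  define b where "b = \<bar>v\<bar>"
  have b: "b > m" "b > 0" using False m by (auto simp: b_def)
  have e: "b powr p = b * b powr (p - 1)" using powr_add[of b 1 "p - 1"] b by simp
  have Y: "b * m powr (p - 1) \<le> b powr p / p + (m powr (p - 1)) powr (p / (p - 1)) / (p / (p - 1))"
    using p b by (intro Youngs_inequality) (auto simp: field_simps)
  also have "(m powr (p - 1)) powr (p / (p - 1)) = m powr p" using p by (simp add: powr_powr)
  finally have "p / (p - 1) * (b * m powr (p - 1)) \<le> p / (p - 1) * (b powr p / p + m powr p / (p / (p - 1)))"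
    using p by (intro mult_left_mono) auto
  also have "\<dots> = p / (p - 1) * b * b powr (p - 1) - b powr p + m powr p"
    using p unfolding e by (simp add: field_simps)
  finally show ?thesis using False by (simp add: doob_def max_def b_def algebra_simps)
qed

lemma doob_two_point:
  fixes p y d m :: real
  assumes p: "2 < p" and m: "\<bar>y\<bar> \<le> m"
  shows "(doob p (y + d) (max m \<bar>y + d\<bar>) + doob p (y - d) (max m \<bar>y - d\<bar>)) / 2 \<le> doob p y m"
proof -
  have m0: "0 \<le> m" using m by linarith
  define A where "A = p / (p - 1) * m powr (p - 1)"
  have A0: "0 \<le> A" using p by (simp add: A_def)
  have one: "doob p v (max m \<bar>v\<bar>) \<le> m powr p - A * \<bar>v\<bar>" for v
    using doob_one_point[OF p m0, of v] by (simp add: A_def mult_ac)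
  have "doob p (y + d) (max m \<bar>y + d\<bar>) + doob p (y - d) (max m \<bar>y - d\<bar>) \<le>
     2 * m powr p - A * (\<bar>y + d\<bar> + \<bar>y - d\<bar>)"
    using one[of "y + d"] one[of "y - d"] by (simp add: algebra_simps)
  also have "\<dots> \<le> 2 * m powr p - A * (2 * \<bar>y\<bar>)"
    using A0 by (intro diff_left_mono mult_left_mono) auto
  also have "\<dots> = 2 * doob p y m" by (simp add: doob_def A_def)
  finally show ?thesis by simp
qed

section \<open>Second order Taylor estimate for the power function\<close>

lemma powr_increment_le:
  fixes a b r :: real
  assumes "1 \<le> r" "0 \<le> b" "b \<le> a"
  shows "a powr r - b powr r \<le> r * a powr (r - 1) * (a - b)"
proof (cases "b = a \<or> b = 0")
  case True
  then show ?thesis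
  proof
    assume "b = 0"
    have "a * a powr (r - 1) = a powr r" using powr_add[of a 1 "r - 1"] assms by (cases "a = 0") auto
    then have "r * a powr (r - 1) * a = r * a powr r" by (metis mult.assoc mult.commute)
    moreover have "1 * a powr r \<le> r * a powr r" using assms by (intro mult_right_mono) auto
    ultimately have "a powr r \<le> r * a powr (r - 1) * a" by linarith
    then show ?thesis using \<open>b = 0\<close> assms by simp
  qed simp
next
  case False
  then have ab: "b < a" "0 < b" using assms by auto
  obtain z where z: "b < z" "z < a" "a powr r - b powr r = (a - b) * (r * z powr (r - 1))"
    using MVT2[OF ab(1), of "\<lambda>z. z powr r" "\<lambda>z. r * z powr (r - 1)"] has_real_derivative_powr ab by auto
  have "z powr (r - 1) \<le> a powr (r - 1)" using z ab assms by (intro powr_mono2) auto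
  then have "(a - b) * (r * z powr (r - 1)) \<le> (a - b) * (r * a powr (r - 1))"
    using assms ab by (intro mult_left_mono) auto
  then show ?thesis using z by (simp add: mult_ac)
qed

lemma DERIV_abs_powr:
  fixes p v :: real
  assumes p: "1 < p"
  shows "((\<lambda>v. \<bar>v\<bar> powr p) has_real_derivative p * sgn v * \<bar>v\<bar> powr (p - 1)) (at v)"
proof (cases "v = 0")
  case True
  have "((\<lambda>h. \<bar>h\<bar> powr (p - 1)) \<longlongrightarrow> \<bar>0\<bar> powr (p - 1)) (at (0::real))"
    using p by (intro tendsto_powr2 tendsto_intros) auto
  then have "((\<lambda>h. \<bar>h\<bar> powr (p - 1)) \<longlongrightarrow> 0) (at (0::real))" by simp
  then have "((\<lambda>h. \<bar>h\<bar> powr p / h) \<longlongrightarrow> 0) (at (0::real))"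
  proof (rule Lim_null_comparison[rotated])
    show "\<forall>\<^sub>F h in at (0::real). norm (\<bar>h\<bar> powr p / h) \<le> \<bar>h\<bar> powr (p - 1)"
      unfolding eventually_at
      by (rule exI[of _ 1]) (auto simp: powr_diff)
  qed
  then show ?thesis using True by (simp add: DERIV_def)
next
  case False
  have c: "\<bar>v\<bar> = sgn v * v" "sgn v * v > 0" using False by (auto simp: sgn_if)
  show ?thesis
  proof (rule has_field_derivative_transform_within_open[where S="{u. sgn v * u > 0}"])
    show "((\<lambda>u. (sgn v * u) powr p) has_real_derivative p * sgn v * \<bar>v\<bar> powr (p - 1)) (at v)"
      using DERIV_fun_powr[of "\<lambda>u. sgn v * u" "sgn v" v p] c
      by (auto intro!: derivative_eq_intros simp: mult_ac)
    show "open {u. sgn v * u > 0}" by (intro open_Collect_less continuous_intros)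
    show "v \<in> {u. sgn v * u > 0}" using c by simp
    fix u assume "u \<in> {u. sgn v * u > 0}"
    then have "sgn v * u = \<bar>u\<bar>" by (auto simp: sgn_if split: if_splits)
    then show "(sgn v * u) powr p = \<bar>u\<bar> powr p" by simp
  qed
qed

text \<open>Takes the place of a bound on the second derivative: up to the factor \<open>p\<close>,
  the left side is the increment of the derivative of \<open>|v| powr p\<close>.\<close>

lemma signed_powr_lipschitz:
  fixes u v M p :: real
  assumes p: "2 < p" and "\<bar>u\<bar> \<le> M" "\<bar>v\<bar> \<le> M" "u \<le> v"
  shows "sgn v * \<bar>v\<bar> powr (p - 1) - sgn u * \<bar>u\<bar> powr (p - 1) \<le> (p - 1) * M powr (p - 2) * (v - u)"
proof -
  have pos: "a powr (p - 1) - b powr (p - 1) \<le> (p - 1) * M powr (p - 2) * (a - b)"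
    if "0 \<le> b" "b \<le> a" "a \<le> M" for a b
  proof -
    have "a powr (p - 1) - b powr (p - 1) \<le> (p - 1) * a powr (p - 2) * (a - b)"
      using powr_increment_le[of "p - 1" b a] that p by simp
    also have "\<dots> \<le> (p - 1) * M powr (p - 2) * (a - b)"
      using that p by (intro mult_right_mono mult_left_mono powr_mono2) auto
    finally show ?thesis .
  qed
  consider "0 \<le> u" | "v \<le> 0" | "u < 0" "0 < v" by linarith
  then show ?thesis
  proof cases
    case 1
    with assms have "u = 0 \<or> 0 < u" "v = 0 \<or> 0 < v" by auto
    then show ?thesis using pos[of u v] assms 1 by (auto simp: sgn_if)
  next
    case 2
    then show ?thesis using pos[of "-v" "-u"] assms by (auto simp: sgn_if algebra_simps split: if_splits)
  next
    case 3
    then show ?thesis using pos[of 0 v] pos[of 0 "-u"] assms by (simp add: sgn_if algebra_simps)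
  qed
qed

lemma abs_powr_taylor:
  fixes y v M p :: real
  assumes p: "2 < p" and y: "\<bar>y\<bar> \<le> M" and v: "\<bar>v\<bar> \<le> M"
  shows "\<bar>v\<bar> powr p \<le> \<bar>y\<bar> powr p + p * sgn y * \<bar>y\<bar> powr (p - 1) * (v - y)
      + p * (p - 1) / 2 * M powr (p - 2) * (v - y)\<^sup>2"
proof -
  define w where "w u = \<bar>y\<bar> powr p + p * sgn y * \<bar>y\<bar> powr (p - 1) * (u - y)
      + p * (p - 1) / 2 * M powr (p - 2) * (u - y)\<^sup>2 - \<bar>u\<bar> powr p" for u
  have der: "(w has_real_derivative p * ((p - 1) * M powr (p - 2) * (u - y) - (sgn u * \<bar>u\<bar> powr (p - 1) - sgn y * \<bar>y\<bar> powr (p - 1)))) (at u)" for u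
  proof -
    have "((\<lambda>u. \<bar>y\<bar> powr p + p * sgn y * \<bar>y\<bar> powr (p - 1) * (u - y)
      + p * (p - 1) / 2 * M powr (p - 2) * (u - y)\<^sup>2) has_real_derivative
       p * sgn y * \<bar>y\<bar> powr (p - 1) + p * (p - 1) * M powr (p - 2) * (u - y)) (at u)"
      by (auto intro!: derivative_eq_intros)
    from DERIV_diff[OF this DERIV_abs_powr[of p u]] p show ?thesis
      unfolding w_def by (simp add: algebra_simps)
  qed
  have "w y \<le> w v"
  proof (cases "y \<le> v")
    case True
    show ?thesis
    proof (rule DERIV_nonneg_imp_nondecreasing[OF True])
      fix u assume "y \<le> u" "u \<le> v"
      then show "\<exists>d. (w has_real_derivative d) (at u) \<and> 0 \<le> d"
        using signed_powr_lipschitz[OF p y, of u] y v p der[of u]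
        by (intro exI[of _ "p * ((p - 1) * M powr (p - 2) * (u - y) - (sgn u * \<bar>u\<bar> powr (p - 1) - sgn y * \<bar>y\<bar> powr (p - 1)))"] conjI)
           auto
    qed
  next
    case False
    show ?thesis
    proof (rule DERIV_nonpos_imp_nonincreasing[of v y w])
      fix u assume u: "v \<le> u" "u \<le> y"
      then have "\<bar>u\<bar> \<le> M" using y v by linarith
      from signed_powr_lipschitz[OF p this y] u
      have "(p - 1) * M powr (p - 2) * (u - y) - (sgn u * \<bar>u\<bar> powr (p - 1) - sgn y * \<bar>y\<bar> powr (p - 1)) \<le> 0"
        by (simp add: algebra_simps)
      then have "p * ((p - 1) * M powr (p - 2) * (u - y) - (sgn u * \<bar>u\<bar> powr (p - 1) - sgn y * \<bar>y\<bar> powr (p - 1))) \<le> 0"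
        using p by (intro mult_nonneg_nonpos) auto
      then show "\<exists>d. (w has_real_derivative d) (at u) \<and> d \<le> 0"
        using der[of u] by blast
    qed (use False in auto)
  qed
  then show ?thesis by (simp add: w_def)
qed

text \<open>The two linear terms cancel. Each branch uses its own bound \<open>M\<close>, the
  running maximum after that step, so the quadratic remainder comes with the weight that
  \<open>tproj_reverse\<close> has to produce.\<close>

lemma abs_powr_two_point:
  fixes p y d m :: real
  assumes p: "2 < p" and m: "\<bar>y\<bar> \<le> m"
  shows "(\<bar>y + d\<bar> powr p + \<bar>y - d\<bar> powr p) / 2 \<le> \<bar>y\<bar> powr p
      + p * (p - 1) / 2 * d\<^sup>2 * ((max m \<bar>y + d\<bar> powr (p - 2) + max m \<bar>y - d\<bar> powr (p - 2)) / 2)"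
proof -
  define K where "K = p * (p - 1) / 2"
  have one: "\<bar>y + e\<bar> powr p \<le> \<bar>y\<bar> powr p + p * sgn y * \<bar>y\<bar> powr (p - 1) * e
      + K * d\<^sup>2 * max m \<bar>y + e\<bar> powr (p - 2)" if "e\<^sup>2 = d\<^sup>2" for e
  proof -
    have "\<bar>y\<bar> \<le> max m \<bar>y + e\<bar>" using m by linarith
    then show ?thesis using abs_powr_taylor[OF p, of y "max m \<bar>y + e\<bar>" "y + e"] that by (simp add: K_def mult_ac)
  qed
  show ?thesis
    using one[of d] one[of "-d"] unfolding K_def[symmetric] by (simp add: field_simps)
qed

section \<open>Finite trees\<close>

text \<open>\<open>TDisj\<close> joins two possibly different trees, since the halves of a disjoint
  sum are approximated separately.\<close>

datatype ftree = TPt | TDisj ftree ftree | TInd ftree ftree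

text \<open>One type for the points of all trees, so that functions on a product and on its factors
  have the same type. Values off \<open>tset t\<close> carry no information.\<close>

datatype fpoint = PUnit | PLeft fpoint | PRight fpoint | PPair fpoint fpoint

primrec tset :: "ftree \<Rightarrow> fpoint set" where
  "tset TPt = {PUnit}"
| "tset (TDisj a b) = PLeft ` tset a \<union> PRight ` tset b"
| "tset (TInd a b) = (\<lambda>(x, y). PPair x y) ` (tset a \<times> tset b)"

primrec texp :: "ftree \<Rightarrow> (fpoint \<Rightarrow> real) \<Rightarrow> real" where
  "texp TPt f = f PUnit"
| "texp (TDisj a b) f = (texp a (\<lambda>x. f (PLeft x)) + texp b (\<lambda>y. f (PRight y))) / 2"
| "texp (TInd a b) f = texp a (\<lambda>x. texp b (\<lambda>y. f (PPair x y)))"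

text \<open>The operator \<open>T\<close> of the overview: the orthogonal projection onto the tree
  version of disjoint and independent sums. In a product the mean is subtracted once because the
  constants lie in both summands.\<close>

primrec tproj :: "ftree \<Rightarrow> (fpoint \<Rightarrow> real) \<Rightarrow> fpoint \<Rightarrow> real" where
  "tproj TPt f = f"
| "tproj (TDisj a b) f = (\<lambda>z. case z of PLeft x \<Rightarrow> tproj a (\<lambda>x. f (PLeft x)) x
      | PRight y \<Rightarrow> tproj b (\<lambda>y. f (PRight y)) y | _ \<Rightarrow> 0)"
| "tproj (TInd a b) f = (\<lambda>z. case z of PPair x y \<Rightarrow>
        tproj a (\<lambda>x. texp b (\<lambda>y. f (PPair x y))) x + tproj b (\<lambda>y. texp a (\<lambda>x. f (PPair x y))) y
        - texp a (\<lambda>x. texp b (\<lambda>y. f (PPair x y)))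
      | _ \<Rightarrow> 0)"

text \<open>Square function of the martingale that reveals the choices of the tree, the left factor of an
  independent product before the right one; the square of the mean is left out.\<close>
primrec tsq :: "ftree \<Rightarrow> (fpoint \<Rightarrow> real) \<Rightarrow> fpoint \<Rightarrow> real" where
  "tsq TPt f = (\<lambda>z. 0)"
| "tsq (TDisj a b) f = (\<lambda>z. ((texp a (\<lambda>x. f (PLeft x)) - texp b (\<lambda>y. f (PRight y))) / 2)\<^sup>2
      + (case z of PLeft x \<Rightarrow> tsq a (\<lambda>x. f (PLeft x)) x
      | PRight y \<Rightarrow> tsq b (\<lambda>y. f (PRight y)) y | _ \<Rightarrow> 0))"
| "tsq (TInd a b) f = (\<lambda>z. case z of PPair x y \<Rightarrow>
        tsq a (\<lambda>x. texp b (\<lambda>y. f (PPair x y))) x + tsq b (\<lambda>y. f (PPair x y)) y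
      | _ \<Rightarrow> 0)"

text \<open>Running maximum, with offset \<open>\<theta>\<close> and initial value \<open>m\<close>, of the martingale with terminal value
  \<open>\<theta> + tproj t f\<close> that reveals the right factor of an independent product first.\<close>
primrec tmax :: "ftree \<Rightarrow> real \<Rightarrow> real \<Rightarrow> (fpoint \<Rightarrow> real) \<Rightarrow> fpoint \<Rightarrow> real" where
  "tmax TPt \<theta> m f = (\<lambda>z. m)"
| "tmax (TDisj a b) \<theta> m f = (\<lambda>z. case z of
        PLeft x \<Rightarrow> tmax a \<theta> (max m \<bar>\<theta> + texp a (\<lambda>x. f (PLeft x))\<bar>) (\<lambda>x. f (PLeft x)) x
      | PRight y \<Rightarrow> tmax b \<theta> (max m \<bar>\<theta> + texp b (\<lambda>y. f (PRight y))\<bar>) (\<lambda>y. f (PRight y)) y | _ \<Rightarrow> 0)"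
| "tmax (TInd a b) \<theta> m f = (\<lambda>z. case z of PPair x y \<Rightarrow>
        tmax a (\<theta> + tproj b (\<lambda>y. texp a (\<lambda>x. f (PPair x y))) y - texp a (\<lambda>x. texp b (\<lambda>y. f (PPair x y))))
          (tmax b \<theta> m (\<lambda>y. texp a (\<lambda>x. f (PPair x y))) y)
          (\<lambda>x. texp b (\<lambda>y. f (PPair x y))) x
      | _ \<Rightarrow> 0)"

lemma finite_tset [simp]: "finite (tset t)"
  by (induction t) auto

lemma texp_mono: "(\<And>x. x \<in> tset t \<Longrightarrow> f x \<le> g x) \<Longrightarrow> texp t f \<le> texp t g"
proof (induction t arbitrary: f g)
  case (TInd a b)
  show ?case unfolding texp.simps by (intro TInd.IH TInd.prems) auto
qed (auto intro!: add_mono)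

lemma texp_cong: "(\<And>x. x \<in> tset t \<Longrightarrow> f x = g x) \<Longrightarrow> texp t f = texp t g"
  by (intro antisym texp_mono) auto

lemma texp_const [simp]: "texp t (\<lambda>x. c) = c"
  by (induction t) auto

lemma texp_add: "texp t (\<lambda>x. f x + g x) = texp t f + texp t g"
  by (induction t arbitrary: f g) (auto simp: field_simps)

lemma texp_cmult: "texp t (\<lambda>x. c * f x) = c * texp t f"
  by (induction t arbitrary: f) (auto simp: field_simps)

lemma texp_diff: "texp t (\<lambda>x. f x - g x) = texp t f - texp t g"
  using texp_add[of t f "\<lambda>x. (-1) * g x"] texp_cmult[of t "-1" g] by simp

lemma texp_divide: "texp t (\<lambda>x. f x / c) = texp t f / c"
  using texp_cmult[of t "1 / c" f] by simp

lemma texp_nonneg: "(\<And>x. x \<in> tset t \<Longrightarrow> 0 \<le> f x) \<Longrightarrow> 0 \<le> texp t f"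
  using texp_mono[of t "\<lambda>_. 0" f] by simp

lemma texp_swap: "texp a (\<lambda>x. texp b (\<lambda>y. f x y)) = texp b (\<lambda>y. texp a (\<lambda>x. f x y))"
  by (induction a arbitrary: f) (auto simp: texp_add texp_divide)

lemma texp_square_le: "(texp t f)\<^sup>2 \<le> texp t (\<lambda>x. (f x)\<^sup>2)"
proof -
  have "0 \<le> texp t (\<lambda>x. (f x - texp t f)\<^sup>2)" by (rule texp_nonneg) auto
  also have "(\<lambda>x. (f x - texp t f)\<^sup>2) = (\<lambda>x. ((f x)\<^sup>2 + (texp t f)\<^sup>2) - (2 * texp t f) * f x)"
    by (simp add: power2_diff fun_eq_iff)
  also have "texp t \<dots> = texp t (\<lambda>x. (f x)\<^sup>2) - (texp t f)\<^sup>2"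
    unfolding texp_diff texp_add texp_cmult by (simp add: power2_eq_square)
  finally show ?thesis by simp
qed

lemma tsq_nonneg: "0 \<le> tsq t f x"
  by (induction t arbitrary: f x) (auto split: fpoint.splits)

text \<open>At a point no maximum is taken, so it is the hypothesis that \<open>m\<close> dominates
  the starting value which closes the recursion.\<close>

lemma tmax_ge:
  assumes "x \<in> tset t" "\<bar>\<theta> + texp t f\<bar> \<le> m"
  shows "m \<le> tmax t \<theta> m f x \<and> \<bar>\<theta> + tproj t f x\<bar> \<le> tmax t \<theta> m f x"
  using assms
proof (induction t arbitrary: x \<theta> m f)
  case (TDisj a b)
  from TDisj.prems(1) consider (l) u where "x = PLeft u" "u \<in> tset a" | (r) u where "x = PRight u" "u \<in> tset b"
    by auto
  then show ?case
  proof cases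
    case l
    show ?thesis
      using TDisj.IH(1)[OF l(2), of \<theta> "\<lambda>x. f (PLeft x)" "max m \<bar>\<theta> + texp a (\<lambda>x. f (PLeft x))\<bar>"] l by auto
  next
    case r
    show ?thesis
      using TDisj.IH(2)[OF r(2), of \<theta> "\<lambda>x. f (PRight x)" "max m \<bar>\<theta> + texp b (\<lambda>x. f (PRight x))\<bar>"] r by auto
  qed
next
  case (TInd a b)
  from TInd.prems(1) obtain u v where x: "x = PPair u v" "u \<in> tset a" "v \<in> tset b" by auto
  have "\<bar>\<theta> + texp b (\<lambda>y. texp a (\<lambda>x. f (PPair x y)))\<bar> \<le> m"
    using TInd.prems(2) by (simp add: texp_swap[of b a])
  note b = TInd.IH(2)[OF x(3) this]
  \<comment> \<open>The left martingale starts where the right one stopped: \<open>\<theta>'\<close>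
    plus the mean on the left factor is the terminal value reached on the right factor.\<close>
  define \<theta>' where "\<theta>' = \<theta> + tproj b (\<lambda>y. texp a (\<lambda>x. f (PPair x y))) v - texp a (\<lambda>x. texp b (\<lambda>y. f (PPair x y)))"
  define m' where "m' = tmax b \<theta> m (\<lambda>y. texp a (\<lambda>x. f (PPair x y))) v"
  have "\<bar>\<theta>' + texp a (\<lambda>x. texp b (\<lambda>y. f (PPair x y)))\<bar> \<le> m'"
    using b by (simp add: \<theta>'_def m'_def)
  note a = TInd.IH(1)[OF x(2) this]
  show ?case using a b x by (simp add: \<theta>'_def[symmetric] m'_def[symmetric]) (simp add: \<theta>'_def algebra_simps)
qed auto

text \<open>By \<open>bell_two_point\<close>, \<open>bell\<close> along the martingale and its
  square function is a supermartingale. The parameter \<open>s\<close> is the square function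
  collected before the tree \<open>t\<close> is entered.\<close>

lemma tsq_bell:
  fixes p s :: real
  assumes p: "2 < p" and s: "0 \<le> s"
  shows "texp t (\<lambda>x. bell p (f x) (sqrt (s\<^sup>2 + tsq t f x))) \<le> bell p (texp t f) s"
  using s
proof (induction t arbitrary: f s)
  case (TDisj a b)
  define e where "e = (texp a (\<lambda>x. f (PLeft x)) - texp b (\<lambda>y. f (PRight y))) / 2"
  define \<mu> where "\<mu> = texp (TDisj a b) f"
  define s' where "s' = sqrt (s\<^sup>2 + e\<^sup>2)"
  have s': "0 \<le> s'" "s'\<^sup>2 = s\<^sup>2 + e\<^sup>2" by (auto simp: s'_def)
  have L: "texp a (\<lambda>x. f (PLeft x)) = \<mu> + e" and R: "texp b (\<lambda>x. f (PRight x)) = \<mu> - e"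
    by (auto simp: \<mu>_def e_def field_simps)
  have "texp (TDisj a b) (\<lambda>x. bell p (f x) (sqrt (s\<^sup>2 + tsq (TDisj a b) f x)))
     = (texp a (\<lambda>x. bell p (f (PLeft x)) (sqrt (s'\<^sup>2 + tsq a (\<lambda>x. f (PLeft x)) x)))
       + texp b (\<lambda>x. bell p (f (PRight x)) (sqrt (s'\<^sup>2 + tsq b (\<lambda>x. f (PRight x)) x)))) / 2"
    unfolding s' by (simp add: e_def add.assoc)
  also have "\<dots> \<le> (bell p (\<mu> + e) s' + bell p (\<mu> - e) s') / 2"
    unfolding L[symmetric] R[symmetric] by (intro divide_right_mono add_mono TDisj.IH s') auto
  also have "\<dots> \<le> bell p \<mu> s" unfolding s'_def by (rule bell_two_point[OF p TDisj.prems])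
  finally show ?case unfolding \<mu>_def .
next
  case (TInd a b)
  define g where "g x = texp b (\<lambda>y. f (PPair x y))" for x
  have "texp (TInd a b) (\<lambda>x. bell p (f x) (sqrt (s\<^sup>2 + tsq (TInd a b) f x)))
     = texp a (\<lambda>x. texp b (\<lambda>y. bell p (f (PPair x y)) (sqrt ((sqrt (s\<^sup>2 + tsq a g x))\<^sup>2 + tsq b (\<lambda>y. f (PPair x y)) y))))"
    by (simp add: g_def[abs_def] tsq_nonneg add.assoc)
  also have "\<dots> \<le> texp a (\<lambda>x. bell p (g x) (sqrt (s\<^sup>2 + tsq a g x)))"
    unfolding g_def by (intro texp_mono TInd.IH(2)) (simp add: tsq_nonneg)
  also have "\<dots> \<le> bell p (texp a g) s" by (rule TInd.IH(1)[OF TInd.prems])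
  finally show ?case by (simp add: g_def[abs_def])
qed auto

text \<open>The counterpart of \<open>tsq_bell\<close> for \<open>doob\<close>, run in the reversed
  order: \<open>texp_swap\<close> brings the left factor inside, and the offset
  \<open>\<theta>\<close> transports the value reached on the right factor.\<close>

lemma tproj_doob:
  fixes p \<theta> m :: real
  assumes p: "2 < p" and m: "\<bar>\<theta> + texp t f\<bar> \<le> m"
  shows "texp t (\<lambda>x. doob p (\<theta> + tproj t f x) (tmax t \<theta> m f x)) \<le> doob p (\<theta> + texp t f) m"
  using m
proof (induction t arbitrary: f \<theta> m)
  case (TDisj a b)
  define e where "e = (texp a (\<lambda>x. f (PLeft x)) - texp b (\<lambda>y. f (PRight y))) / 2"
  define \<mu> where "\<mu> = \<theta> + texp (TDisj a b) f"
  have L: "\<theta> + texp a (\<lambda>x. f (PLeft x)) = \<mu> + e" and R: "\<theta> + texp b (\<lambda>x. f (PRight x)) = \<mu> - e"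
    by (auto simp: \<mu>_def e_def field_simps)
  have "texp (TDisj a b) (\<lambda>x. doob p (\<theta> + tproj (TDisj a b) f x) (tmax (TDisj a b) \<theta> m f x))
    \<le> (doob p (\<mu> + e) (max m \<bar>\<mu> + e\<bar>) + doob p (\<mu> - e) (max m \<bar>\<mu> - e\<bar>)) / 2"
    using TDisj.IH(1)[of \<theta> "\<lambda>x. f (PLeft x)" "max m \<bar>\<mu> + e\<bar>"] TDisj.IH(2)[of \<theta> "\<lambda>x. f (PRight x)" "max m \<bar>\<mu> - e\<bar>"]
    unfolding L R by (simp add: L R)
  also have "\<dots> \<le> doob p \<mu> m" using TDisj.prems by (intro doob_two_point[OF p]) (simp add: \<mu>_def)
  finally show ?case unfolding \<mu>_def .
next
  case (TInd a b)
  define ga where "ga x = texp b (\<lambda>y. f (PPair x y))" for x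
  define gb where "gb y = texp a (\<lambda>x. f (PPair x y))" for y
  define \<mu> where "\<mu> = texp a ga"
  have \<mu>: "texp (TInd a b) f = \<mu>" "texp b gb = \<mu>"
    unfolding \<mu>_def ga_def[abs_def] gb_def[abs_def] by (simp, rule texp_swap)
  define \<theta>' where "\<theta>' y = \<theta> + tproj b gb y - \<mu>" for y
  have mb: "\<bar>\<theta> + texp b gb\<bar> \<le> m" using TInd.prems unfolding \<mu> .
  have "texp (TInd a b) (\<lambda>x. doob p (\<theta> + tproj (TInd a b) f x) (tmax (TInd a b) \<theta> m f x))
     = texp a (\<lambda>x. texp b (\<lambda>y. doob p (\<theta>' y + tproj a ga x) (tmax a (\<theta>' y) (tmax b \<theta> m gb y) ga x)))"
    by (simp add: ga_def[abs_def] gb_def[abs_def] \<theta>'_def \<mu>_def algebra_simps)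
  also have "\<dots> = texp b (\<lambda>y. texp a (\<lambda>x. doob p (\<theta>' y + tproj a ga x) (tmax a (\<theta>' y) (tmax b \<theta> m gb y) ga x)))"
    by (rule texp_swap)
  also have "\<dots> \<le> texp b (\<lambda>y. doob p (\<theta>' y + texp a ga) (tmax b \<theta> m gb y))"
  proof (intro texp_mono TInd.IH(1))
    fix y assume "y \<in> tset b"
    from tmax_ge[OF this mb] show "\<bar>\<theta>' y + texp a ga\<bar> \<le> tmax b \<theta> m gb y"
      by (simp add: \<theta>'_def \<mu>_def)
  qed
  also have "\<dots> = texp b (\<lambda>y. doob p (\<theta> + tproj b gb y) (tmax b \<theta> m gb y))"
    by (simp add: \<theta>'_def \<mu>_def)
  also have "\<dots> \<le> doob p (\<theta> + texp b gb) m" by (rule TInd.IH(2)[OF mb])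
  finally show ?case using \<mu> by simp
qed auto

text \<open>The parameter \<open>z\<close>, averaged over the tree \<open>c\<close>, stands for the coordinates which the square
  function has already seen but the reversed martingale has not.\<close>
lemma tproj_reverse:
  fixes p \<theta> m :: real
  assumes p: "2 < p" and m: "\<bar>\<theta> + texp t (\<lambda>x. texp c (\<lambda>z. f z x))\<bar> \<le> m"
  shows "texp t (\<lambda>x. \<bar>\<theta> + tproj t (\<lambda>x. texp c (\<lambda>z. f z x)) x\<bar> powr p)
    \<le> \<bar>\<theta> + texp t (\<lambda>x. texp c (\<lambda>z. f z x))\<bar> powr p
      + p * (p - 1) / 2 * texp c (\<lambda>z. texp t (\<lambda>x. tsq t (f z) x * tmax t \<theta> m (\<lambda>x. texp c (\<lambda>z. f z x)) x powr (p - 2)))"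
  using m
proof (induction t arbitrary: c f \<theta> m)
  case (TDisj a b)
  define K where "K = p * (p - 1) / 2"
  have K0: "K \<ge> 0" using p by (simp add: K_def)
  define F where "F x = texp c (\<lambda>z. f z x)" for x
  define e where "e z = (texp a (\<lambda>x. f z (PLeft x)) - texp b (\<lambda>y. f z (PRight y))) / 2" for z
  define E where "E = texp c e"
  define \<mu> where "\<mu> = \<theta> + texp (TDisj a b) F"
  have EE: "E = (texp a (\<lambda>x. F (PLeft x)) - texp b (\<lambda>y. F (PRight y))) / 2"
    by (simp add: E_def e_def[abs_def] F_def texp_divide texp_diff texp_swap[of c])
  have L: "\<theta> + texp a (\<lambda>x. F (PLeft x)) = \<mu> + E" and R: "\<theta> + texp b (\<lambda>x. F (PRight x)) = \<mu> - E"
    by (auto simp: \<mu>_def EE field_simps)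
  define ma where "ma = max m \<bar>\<mu> + E\<bar>"
  define mb where "mb = max m \<bar>\<mu> - E\<bar>"
  define Wa where "Wa x = tmax a \<theta> ma (\<lambda>x. F (PLeft x)) x powr (p - 2)" for x
  define Wb where "Wb x = tmax b \<theta> mb (\<lambda>x. F (PRight x)) x powr (p - 2)" for x
  have m: "\<bar>\<mu>\<bar> \<le> m" using TDisj.prems by (simp add: \<mu>_def F_def)
  have mab: "0 \<le> ma" "0 \<le> mb" "\<bar>\<mu> + E\<bar> \<le> ma" "\<bar>\<mu> - E\<bar> \<le> mb" unfolding ma_def mb_def by linarith+
  \<comment> \<open>The running maximum only grows, so its value right after this choice may be
    replaced by the terminal one.\<close>
  have Wa: "ma powr (p - 2) \<le> Wa x" if "x \<in> tset a" for x
    using tmax_ge[OF that, of \<theta> "\<lambda>x. F (PLeft x)" ma] p mab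
    by (auto simp: Wa_def L intro!: powr_mono2)
  have Wb: "mb powr (p - 2) \<le> Wb x" if "x \<in> tset b" for x
    using tmax_ge[OF that, of \<theta> "\<lambda>x. F (PRight x)" mb] p mab
    by (auto simp: Wb_def R intro!: powr_mono2)
  have 1: "texp a (\<lambda>x. \<bar>\<theta> + tproj a (\<lambda>x. F (PLeft x)) x\<bar> powr p) \<le> \<bar>\<mu> + E\<bar> powr p
      + K * texp c (\<lambda>z. texp a (\<lambda>x. tsq a (\<lambda>x. f z (PLeft x)) x * Wa x))"
    using TDisj.IH(1)[of \<theta> c "\<lambda>z x. f z (PLeft x)" ma] L unfolding F_def Wa_def K_def by (auto simp: ma_def)
  have 2: "texp b (\<lambda>x. \<bar>\<theta> + tproj b (\<lambda>x. F (PRight x)) x\<bar> powr p) \<le> \<bar>\<mu> - E\<bar> powr p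
      + K * texp c (\<lambda>z. texp b (\<lambda>x. tsq b (\<lambda>x. f z (PRight x)) x * Wb x))"
    using TDisj.IH(2)[of \<theta> c "\<lambda>z x. f z (PRight x)" mb] R unfolding F_def Wb_def K_def by (auto simp: mb_def)
  \<comment> \<open>\<open>E\<close> is the increment of the reversed martingale and
    \<open>e z\<close> the one seen by the square function. Jensen's inequality over the parameter
    \<open>z\<close> is the comparison of \<open>g_k\<close> with \<open>d_k\<close> from the
    overview.\<close>
  have "E\<^sup>2 * ((ma powr (p - 2) + mb powr (p - 2)) / 2)
     \<le> texp c (\<lambda>z. (e z)\<^sup>2) * ((ma powr (p - 2) + mb powr (p - 2)) / 2)"
    unfolding E_def by (intro mult_right_mono texp_square_le) auto
  also have "\<dots> = texp c (\<lambda>z. (texp a (\<lambda>x. (e z)\<^sup>2 * ma powr (p - 2)) + texp b (\<lambda>x. (e z)\<^sup>2 * mb powr (p - 2))) / 2)"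
    using texp_cmult[of c "(ma powr (p - 2) + mb powr (p - 2)) / 2" "\<lambda>z. (e z)\<^sup>2"] by (simp add: algebra_simps)
  also have "\<dots> \<le> texp c (\<lambda>z. (texp a (\<lambda>x. (e z)\<^sup>2 * Wa x) + texp b (\<lambda>x. (e z)\<^sup>2 * Wb x)) / 2)"
    by (intro texp_mono divide_right_mono add_mono mult_left_mono Wa Wb) auto
  finally have 3: "K * (E\<^sup>2 * ((ma powr (p - 2) + mb powr (p - 2)) / 2)) \<le> K * texp c (\<lambda>z. (texp a (\<lambda>x. (e z)\<^sup>2 * Wa x) + texp b (\<lambda>x. (e z)\<^sup>2 * Wb x)) / 2)"
    using K0 by (intro mult_left_mono) auto
  have 4: "(\<bar>\<mu> + E\<bar> powr p + \<bar>\<mu> - E\<bar> powr p) / 2 \<le> \<bar>\<mu>\<bar> powr p + K * (E\<^sup>2 * ((ma powr (p - 2) + mb powr (p - 2)) / 2))"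
    using abs_powr_two_point[OF p m, of E] unfolding K_def ma_def mb_def by (simp only: mult.assoc)
  have 5: "texp c (\<lambda>z. texp (TDisj a b) (\<lambda>x. tsq (TDisj a b) (f z) x * tmax (TDisj a b) \<theta> m F x powr (p - 2)))
    = texp c (\<lambda>z. (texp a (\<lambda>x. (e z)\<^sup>2 * Wa x) + texp b (\<lambda>x. (e z)\<^sup>2 * Wb x)) / 2)
      + (texp c (\<lambda>z. texp a (\<lambda>x. tsq a (\<lambda>x. f z (PLeft x)) x * Wa x)) + texp c (\<lambda>z. texp b (\<lambda>x. tsq b (\<lambda>x. f z (PRight x)) x * Wb x))) / 2"
    by (simp add: L R ma_def[symmetric] mb_def[symmetric] Wa_def[symmetric] Wb_def[symmetric] e_def[symmetric]
        distrib_right texp_add texp_divide add_divide_distrib)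
  have "texp (TDisj a b) (\<lambda>x. \<bar>\<theta> + tproj (TDisj a b) F x\<bar> powr p)
     = (texp a (\<lambda>x. \<bar>\<theta> + tproj a (\<lambda>x. F (PLeft x)) x\<bar> powr p) + texp b (\<lambda>x. \<bar>\<theta> + tproj b (\<lambda>x. F (PRight x)) x\<bar> powr p)) / 2"
    by simp
  also have "\<dots> \<le> \<bar>\<mu>\<bar> powr p + K * texp c (\<lambda>z. texp (TDisj a b) (\<lambda>x. tsq (TDisj a b) (f z) x * tmax (TDisj a b) \<theta> m F x powr (p - 2)))"
  proof -
    have "(A + B) / 2 \<le> N + K * (Q + (T1 + T2) / 2)"
      if "A \<le> M1 + K * T1" "B \<le> M2 + K * T2" "Z \<le> K * Q" "(M1 + M2) / 2 \<le> N + Z" for A B N Q T1 T2 M1 M2 Z :: real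
      using that by (simp add: field_simps)
    from this[OF 1 2 3 4] show ?thesis unfolding 5 .
  qed
  finally show ?case unfolding \<mu>_def F_def K_def .
next
  case (TInd a b)
  define K where "K = p * (p - 1) / 2"
  have K0: "K \<ge> 0" using p by (simp add: K_def)
  define F where "F x = texp c (\<lambda>z. f z x)" for x
  define fa where "fa z x = texp b (\<lambda>y. f z (PPair x y))" for z x
  \<comment> \<open>The reversed martingale passes through the right factor before the left
    coordinate is known. So that coordinate joins the averaged parameters, and the induction
    hypothesis for \<open>b\<close> is applied with \<open>TInd c a\<close> in place of
    \<open>c\<close>.\<close>
  define fb where "fb w y = (case w of PPair z x \<Rightarrow> f z (PPair x y) | _ \<Rightarrow> 0)" for w y
  define ga where "ga x = texp b (\<lambda>y. F (PPair x y))" for x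
  define gb where "gb y = texp a (\<lambda>x. F (PPair x y))" for y
  have ga: "ga = (\<lambda>x. texp c (\<lambda>z. fa z x))"
    by (simp add: ga_def fun_eq_iff F_def fa_def texp_swap[of b c])
  have gb: "gb = (\<lambda>y. texp (TInd c a) (\<lambda>w. fb w y))"
    by (simp add: gb_def fun_eq_iff F_def fb_def texp_swap[of a c])
  define \<mu> where "\<mu> = texp a ga"
  have \<mu>: "texp (TInd a b) F = \<mu>" "texp b gb = \<mu>"
    unfolding \<mu>_def ga_def[abs_def] gb_def[abs_def] by (simp, rule texp_swap)
  define \<theta>' where "\<theta>' y = \<theta> + tproj b gb y - \<mu>" for y
  define W where "W x y = tmax a (\<theta>' y) (tmax b \<theta> m gb y) ga x powr (p - 2)" for x y
  have mb: "\<bar>\<theta> + texp b gb\<bar> \<le> m" using TInd.prems unfolding F_def[symmetric] \<mu> .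
  have ma: "\<bar>\<theta>' y + texp a ga\<bar> \<le> tmax b \<theta> m gb y" if "y \<in> tset b" for y
    using tmax_ge[OF that mb] by (simp add: \<theta>'_def \<mu>_def)
  have mb0: "0 \<le> tmax b \<theta> m gb y" if "y \<in> tset b" for y using ma[OF that] by linarith
  have W: "tmax b \<theta> m gb y powr (p - 2) \<le> W x y" if "x \<in> tset a" "y \<in> tset b" for x y
    using tmax_ge[OF that(1) ma[OF that(2)]] mb0[OF that(2)] p by (auto simp: W_def intro!: powr_mono2)
  have "texp (TInd a b) (\<lambda>x. \<bar>\<theta> + tproj (TInd a b) F x\<bar> powr p)
     = texp a (\<lambda>x. texp b (\<lambda>y. \<bar>\<theta>' y + tproj a ga x\<bar> powr p))"
    by (simp add: ga_def[abs_def] gb_def[abs_def] \<theta>'_def \<mu>_def algebra_simps)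
  also have "\<dots> = texp b (\<lambda>y. texp a (\<lambda>x. \<bar>\<theta>' y + tproj a ga x\<bar> powr p))"
    by (rule texp_swap)
  \<comment> \<open>For fixed \<open>y\<close> the left martingale starts from the offset
    \<open>\<theta>' y\<close>. Its increments do not involve \<open>y\<close>; only the weight
    \<open>W\<close> remembers it.\<close>
  also have "\<dots> \<le> texp b (\<lambda>y. \<bar>\<theta>' y + texp a ga\<bar> powr p + K * texp c (\<lambda>z. texp a (\<lambda>x. tsq a (fa z) x * W x y)))"
    unfolding W_def K_def ga
    by (intro texp_mono TInd.IH(1)) (use ma in \<open>simp add: ga\<close>)
  also have "\<dots> = texp b (\<lambda>y. \<bar>\<theta> + tproj b gb y\<bar> powr p) + K * texp b (\<lambda>y. texp c (\<lambda>z. texp a (\<lambda>x. tsq a (fa z) x * W x y)))"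
    by (simp add: texp_add texp_cmult \<theta>'_def \<mu>_def)
  finally have A: "texp (TInd a b) (\<lambda>x. \<bar>\<theta> + tproj (TInd a b) F x\<bar> powr p)
     \<le> texp b (\<lambda>y. \<bar>\<theta> + tproj b gb y\<bar> powr p) + K * texp b (\<lambda>y. texp c (\<lambda>z. texp a (\<lambda>x. tsq a (fa z) x * W x y)))" .
  have B: "texp b (\<lambda>y. \<bar>\<theta> + tproj b gb y\<bar> powr p) \<le> \<bar>\<theta> + \<mu>\<bar> powr p
      + K * texp (TInd c a) (\<lambda>w. texp b (\<lambda>y. tsq b (fb w) y * tmax b \<theta> m gb y powr (p - 2)))"
    using TInd.IH(2)[of \<theta> "TInd c a" fb m] mb unfolding gb[symmetric] \<mu> K_def by blast
  have "texp (TInd c a) (\<lambda>w. texp b (\<lambda>y. tsq b (fb w) y * tmax b \<theta> m gb y powr (p - 2)))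
     \<le> texp c (\<lambda>z. texp a (\<lambda>x. texp b (\<lambda>y. tsq b (\<lambda>y. f z (PPair x y)) y * W x y)))"
    by (simp add: fb_def[abs_def]) (intro texp_mono mult_left_mono W tsq_nonneg)
  then have C: "K * texp (TInd c a) (\<lambda>w. texp b (\<lambda>y. tsq b (fb w) y * tmax b \<theta> m gb y powr (p - 2)))
     \<le> K * texp c (\<lambda>z. texp a (\<lambda>x. texp b (\<lambda>y. tsq b (\<lambda>y. f z (PPair x y)) y * W x y)))"
    using K0 by (rule mult_left_mono)
  have D: "\<bar>\<theta> + \<mu>\<bar> powr p + K * texp c (\<lambda>z. texp a (\<lambda>x. texp b (\<lambda>y. tsq b (\<lambda>y. f z (PPair x y)) y * W x y)))
      + K * texp b (\<lambda>y. texp c (\<lambda>z. texp a (\<lambda>x. tsq a (fa z) x * W x y)))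
      = \<bar>\<theta> + \<mu>\<bar> powr p + K * texp c (\<lambda>z. texp (TInd a b) (\<lambda>x. tsq (TInd a b) (f z) x * tmax (TInd a b) \<theta> m F x powr (p - 2)))"
  proof -
    have "texp (TInd a b) (\<lambda>x. tsq (TInd a b) (f z) x * tmax (TInd a b) \<theta> m F x powr (p - 2))
      = texp a (\<lambda>x. texp b (\<lambda>y. tsq a (fa z) x * W x y)) + texp a (\<lambda>x. texp b (\<lambda>y. tsq b (\<lambda>y. f z (PPair x y)) y * W x y))" for z
      by (simp add: W_def \<theta>'_def \<mu>_def ga_def[abs_def] gb_def[abs_def] fa_def[abs_def] distrib_right texp_add)
    then show ?thesis
      by (simp add: texp_add texp_swap[of b c] texp_swap[of b a] distrib_left)
  qed
  have "texp (TInd a b) (\<lambda>x. \<bar>\<theta> + tproj (TInd a b) F x\<bar> powr p) \<le>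
     \<bar>\<theta> + \<mu>\<bar> powr p + K * texp c (\<lambda>z. texp (TInd a b) (\<lambda>x. tsq (TInd a b) (f z) x * tmax (TInd a b) \<theta> m F x powr (p - 2)))"
    using A B C unfolding D[symmetric] by argo
  then show ?case unfolding \<mu>[symmetric] F_def K_def .
qed auto

section \<open>Hoelder's inequality and the norm bound on a finite tree\<close>

lemma holder_of_young:
  fixes X I J p q :: real
  assumes pq: "1 < p" "1 < q" and IJ: "0 \<le> I" "0 \<le> J"
    and *: "\<And>A B. 0 < A \<Longrightarrow> 0 < B \<Longrightarrow> X \<le> A * B * (I / A powr p / p + J / B powr q / q)"
    and c: "1 / p + 1 / q = 1"
  shows "X \<le> I powr (1 / p) * J powr (1 / q)"
proof (rule tendsto_lowerbound)
  show "((\<lambda>e. (I + e) powr (1 / p) * (J + e) powr (1 / q)) \<longlongrightarrow> I powr (1 / p) * J powr (1 / q)) (at_right 0)"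
  proof -
    have "((\<lambda>e. (I + e) powr (1 / p) * (J + e) powr (1 / q)) \<longlongrightarrow> (I + 0) powr (1 / p) * (J + 0) powr (1 / q)) (at_right 0)"
      using pq IJ by (intro tendsto_intros tendsto_powr2) (auto simp: eventually_at intro!: exI[of _ 1])
    then show ?thesis by simp
  qed
  show "\<forall>\<^sub>F e in at_right 0. X \<le> (I + e) powr (1 / p) * (J + e) powr (1 / q)"
    unfolding eventually_at_right_field
  proof (intro exI[of _ 1] conjI allI impI)
    fix e :: real assume e: "0 < e"
    \<comment> \<open>The optimal scalings are the two norms; adding \<open>e\<close> keeps them
      positive, and \<open>e\<close> tends to 0 afterwards.\<close>
    define A where "A = (I + e) powr (1 / p)"
    define B where "B = (J + e) powr (1 / q)"
    have AB: "0 < A" "0 < B" "A powr p = I + e" "B powr q = J + e"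
      using e IJ pq by (auto simp: A_def B_def powr_powr)
    have "I / (I + e) \<le> 1" "J / (J + e) \<le> 1" using e IJ by auto
    then have "I / (I + e) / p \<le> 1 / p" "J / (J + e) / q \<le> 1 / q"
      using pq by (auto intro!: divide_right_mono simp del: divide_divide_eq_left)
    then have "I / (I + e) / p + J / (J + e) / q \<le> 1" using c by linarith
    then have "A * B * (I / A powr p / p + J / B powr q / q) \<le> A * B"
      using AB by (simp add: mult_left_le)
    with *[OF AB(1,2)] show "X \<le> (I + e) powr (1 / p) * (J + e) powr (1 / q)" by (simp add: A_def B_def)
  qed auto
qed auto

lemma young_scaled:
  fixes a b A B p q :: real
  assumes "1 < p" "1 < q" "1 / p + 1 / q = 1" "0 < A" "0 < B"
  shows "\<bar>a * b\<bar> \<le> A * B / (A powr p * p) * \<bar>a\<bar> powr p + A * B / (B powr q * q) * \<bar>b\<bar> powr q"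
proof -
  have "(\<bar>a\<bar> / A) * (\<bar>b\<bar> / B) \<le> (\<bar>a\<bar> / A) powr p / p + (\<bar>b\<bar> / B) powr q / q"
    using assms by (intro Youngs_inequality) auto
  then have "A * B * ((\<bar>a\<bar> / A) * (\<bar>b\<bar> / B)) \<le> A * B * ((\<bar>a\<bar> / A) powr p / p + (\<bar>b\<bar> / B) powr q / q)"
    using assms by (intro mult_left_mono) auto
  then show ?thesis using assms by (simp add: powr_divide abs_mult distrib_left)
qed

lemma texp_holder:
  fixes p q :: real
  assumes "1 < p" "1 < q" "1 / p + 1 / q = 1"
  shows "texp t (\<lambda>x. \<bar>f x * g x\<bar>) \<le> (texp t (\<lambda>x. \<bar>f x\<bar> powr p)) powr (1 / p) * (texp t (\<lambda>x. \<bar>g x\<bar> powr q)) powr (1 / q)"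
proof (rule holder_of_young)
  fix A B :: real assume "0 < A" "0 < B"
  then have "texp t (\<lambda>x. \<bar>f x * g x\<bar>) \<le> texp t (\<lambda>x. A * B / (A powr p * p) * \<bar>f x\<bar> powr p + A * B / (B powr q * q) * \<bar>g x\<bar> powr q)"
    using assms by (intro texp_mono young_scaled)
  also have "\<dots> = A * B / (A powr p * p) * texp t (\<lambda>x. \<bar>f x\<bar> powr p) + A * B / (B powr q * q) * texp t (\<lambda>x. \<bar>g x\<bar> powr q)"
    by (simp only: texp_add texp_cmult)
  finally show "texp t (\<lambda>x. \<bar>f x * g x\<bar>) \<le> A * B * (texp t (\<lambda>x. \<bar>f x\<bar> powr p) / A powr p / p + texp t (\<lambda>x. \<bar>g x\<bar> powr q) / B powr q / q)"
    by (simp add: distrib_left)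
qed (use assms in \<open>auto intro!: texp_nonneg\<close>)

text \<open>For estimates in which the quantity to be bounded reappears on the right with a smaller
  power, as it does after Hoelder's inequality.\<close>

lemma powr_le_cancel:
  fixes X c s :: real
  assumes "X \<le> c * X powr s" "0 \<le> X" "0 \<le> c" "s < 1"
  shows "X powr (1 - s) \<le> c"
proof (cases "X = 0")
  case False
  then have X: "X > 0" using assms by simp
  have "X = X powr (1 - s) * X powr s" using X by (simp flip: powr_add)
  then have "X powr (1 - s) * X powr s \<le> c * X powr s" using assms(1) by simp
  then show ?thesis using X by simp
qed (use assms in auto)

text \<open>The constant of the theorem, to be taken at the larger of \<open>p\<close> and its
  conjugate exponent; \<open>Cp 2 = 1\<close>.\<close>

definition Cp :: "real \<Rightarrow> real" where
  "Cp p = (p - 1)^2 * (p / 2) powr (3 / 2)"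

text \<open>Two uses of \<open>ln (1 + u) <= u\<close>, with \<open>1 - 1 / (p - 1)\<close> as the
  intermediate value. This disposes of the power of the Doob constant
  \<open>p / (p - 1)\<close>.\<close>

lemma conjugate_powr_le:
  fixes p :: real
  assumes "2 < p"
  shows "(p / (p - 1)) powr (p - 2) \<le> p - 1"
proof -
  have "p / (p - 1) = 1 + 1 / (p - 1)" using assms by (simp add: field_simps)
  then have "(p - 2) * ln (p / (p - 1)) \<le> (p - 2) * (1 / (p - 1))"
    using assms ln_add_one_self_le_self[of "1 / (p - 1)"] by (intro mult_left_mono) auto
  also have "\<dots> = 1 - 1 / (p - 1)" using assms by (simp add: field_simps)
  also have "\<dots> \<le> ln (p - 1)" using assms ln_add_one_self_le_self2[of "1 / (p - 1) - 1"] by (simp add: ln_div)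
  finally show ?thesis using assms by (simp add: powr_def ln_ge_iff)
qed

text \<open>The reversed martingale bounds \<open>tproj t F\<close> by the square function of \<open>F\<close> with the help of Doob's
  inequality, and Burkholder's function bounds the square function by \<open>F\<close>.\<close>
lemma tproj_bound:
  fixes p :: real
  assumes p: "2 < p"
  shows "texp t (\<lambda>x. \<bar>tproj t F x\<bar> powr p) \<le> Cp p powr p * texp t (\<lambda>x. \<bar>F x\<bar> powr p)"
proof -
  define \<mu> where "\<mu> = texp t F"
  \<comment> \<open>The square of the mean, which \<open>tsq\<close> leaves out, is put back
    here.\<close>
  define S where "S x = sqrt (\<bar>\<mu>\<bar>\<^sup>2 + tsq t F x)" for x
  define G where "G = tproj t F"
  define Mx where "Mx = tmax t 0 \<bar>\<mu>\<bar> F"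
  define X where "X = texp t (\<lambda>x. \<bar>G x\<bar> powr p)"
  define Y where "Y = texp t (\<lambda>x. S x powr p)"
  define Z where "Z = texp t (\<lambda>x. \<bar>F x\<bar> powr p)"
  define N where "N = texp t (\<lambda>x. Mx x powr p)"
  define K where "K = p * (p - 1) / 2"
  define q where "q = p / (p - 1)"
  have q: "1 < q" "1 / p + 1 / q = 1" using p by (auto simp: q_def field_simps)
  have nn: "0 \<le> X" "0 \<le> Y" "0 \<le> Z" "0 \<le> N" by (auto simp: X_def Y_def Z_def N_def intro!: texp_nonneg)
  have S0: "0 \<le> S x" "(S x)\<^sup>2 = \<mu>\<^sup>2 + tsq t F x" for x by (auto simp: S_def tsq_nonneg)
  have mx: "\<bar>\<mu>\<bar> \<le> Mx x" "\<bar>G x\<bar> \<le> Mx x" if "x \<in> tset t" for x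
    using tmax_ge[OF that, of 0 F "\<bar>\<mu>\<bar>"] by (auto simp: Mx_def \<mu>_def G_def)
  have mx0: "0 \<le> Mx x" if "x \<in> tset t" for x using mx(1)[OF that] by linarith
  have YZ: "Y \<le> (p - 1) powr p * Z"
  proof -
    have c: "0 \<le> p * ((p - 1) / p) powr (p - 1)" using p by simp
    \<comment> \<open>The supermartingale starts at a nonpositive value: with the square function
      equal to the absolute value of the mean, \<open>bell\<close> has the sign of
      \<open>2 - p\<close>.\<close>
    have "bell p \<mu> \<bar>\<mu>\<bar> = (2 - p) * \<bar>\<mu>\<bar> * (2 * \<bar>\<mu>\<bar>) powr (p - 1)"
      using powr_add[of "2 * \<bar>\<mu>\<bar>" 1 "p - 1"] by (cases "\<mu> = 0") (auto simp: bell_def algebra_simps)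
    also have "\<dots> \<le> 0" using p by (intro mult_nonpos_nonneg) auto
    finally have "texp t (\<lambda>x. bell p (F x) (S x)) \<le> 0"
      using tsq_bell[OF p, of "\<bar>\<mu>\<bar>" t F] unfolding S_def \<mu>_def by simp
    then have "p * ((p - 1) / p) powr (p - 1) * texp t (\<lambda>x. bell p (F x) (S x)) \<le> 0"
      using c by (rule mult_nonneg_nonpos[rotated])
    moreover have "Y - (p - 1) powr p * Z \<le> p * ((p - 1) / p) powr (p - 1) * texp t (\<lambda>x. bell p (F x) (S x))"
      unfolding Y_def Z_def texp_cmult[symmetric] texp_diff[symmetric]
      by (intro texp_mono bell_majorant p S0)
    ultimately show ?thesis by linarith
  qed
  have NX: "N powr (1 / p) \<le> q * X powr (1 / p)"
  proof -
    have "doob p \<mu> \<bar>\<mu>\<bar> = (1 - q) * \<bar>\<mu>\<bar> powr p"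
      using powr_add[of "\<bar>\<mu>\<bar>" 1 "p - 1"] by (cases "\<mu> = 0") (auto simp: doob_def q_def algebra_simps)
    also have "\<dots> \<le> 0" using q by (intro mult_nonpos_nonneg) auto
    finally have "texp t (\<lambda>x. doob p (G x) (Mx x)) \<le> 0"
      using tproj_doob[OF p, of 0 t F "\<bar>\<mu>\<bar>"] unfolding G_def Mx_def \<mu>_def by simp
    moreover have "texp t (\<lambda>x. doob p (G x) (Mx x)) = N - q * texp t (\<lambda>x. \<bar>G x\<bar> * Mx x powr (p - 1))"
      unfolding N_def texp_cmult[symmetric] texp_diff[symmetric] by (simp add: doob_def q_def mult.assoc)
    moreover have "texp t (\<lambda>x. \<bar>G x\<bar> * Mx x powr (p - 1)) \<le> X powr (1 / p) * N powr (1 / q)"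
    proof -
      have "texp t (\<lambda>x. \<bar>G x * (Mx x powr (p - 1))\<bar>) \<le>
         texp t (\<lambda>x. \<bar>G x\<bar> powr p) powr (1 / p) * texp t (\<lambda>x. \<bar>Mx x powr (p - 1)\<bar> powr q) powr (1 / q)"
        using p q by (intro texp_holder) auto
      then show ?thesis using p by (simp add: X_def N_def abs_mult powr_powr q_def)
    qed
    ultimately have "N \<le> q * (X powr (1 / p) * N powr (1 / q))"
      using q by (smt (verit) mult_left_mono)
    then have "N \<le> (q * X powr (1 / p)) * N powr (1 / q)" by (simp add: mult.assoc)
    from powr_le_cancel[OF this nn(4)] have "N powr (1 - 1 / q) \<le> q * X powr (1 / p)" using q by auto
    moreover have "1 - 1 / q = 1 / p" using q by linarith
    ultimately show ?thesis by simp
  qed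
  have K1: "1 \<le> K" 
  proof -
    have "2 * 1 \<le> p * (p - 1)" using p by (intro mult_mono) auto
    then show ?thesis by (simp add: K_def)
  qed
  have XY: "X \<le> K * (Y powr (2 / p) * N powr ((p - 2) / p))"
  proof -
    \<comment> \<open>At the root no coordinate has been seen yet, so the parameter tree is the
      single point \<open>TPt\<close>.\<close>
    have "X \<le> \<bar>\<mu>\<bar> powr p + K * texp t (\<lambda>x. tsq t F x * Mx x powr (p - 2))"
      using tproj_reverse[OF p, of 0 t TPt "\<lambda>z. F" "\<bar>\<mu>\<bar>"] by (simp add: X_def K_def \<mu>_def G_def Mx_def)
    also have "\<bar>\<mu>\<bar> powr p \<le> K * texp t (\<lambda>x. \<mu>\<^sup>2 * Mx x powr (p - 2))"
    proof -
      have "\<bar>\<mu>\<bar> powr p = \<mu>\<^sup>2 * \<bar>\<mu>\<bar> powr (p - 2)"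
        using powr_add[of "\<bar>\<mu>\<bar>" 2 "p - 2"] by (cases "\<mu> = 0") auto
      also have "\<dots> = texp t (\<lambda>x. \<mu>\<^sup>2 * \<bar>\<mu>\<bar> powr (p - 2))" by simp
      also have "\<dots> \<le> texp t (\<lambda>x. \<mu>\<^sup>2 * Mx x powr (p - 2))"
        using p mx by (intro texp_mono mult_left_mono powr_mono2) auto
      also have "\<dots> \<le> K * \<dots>"
        using K1 mult_right_mono[OF K1, of "texp t (\<lambda>x. \<mu>\<^sup>2 * Mx x powr (p - 2))"] by (simp add: texp_nonneg)
      finally show ?thesis .
    qed
    also have "K * texp t (\<lambda>x. \<mu>\<^sup>2 * Mx x powr (p - 2)) + K * texp t (\<lambda>x. tsq t F x * Mx x powr (p - 2))
       = K * texp t (\<lambda>x. \<bar>(S x)\<^sup>2 * Mx x powr (p - 2)\<bar>)"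
      by (simp add: S0 distrib_right texp_add distrib_left tsq_nonneg abs_mult)
    also have "\<dots> \<le> K * (texp t (\<lambda>x. \<bar>(S x)\<^sup>2\<bar> powr (p / 2)) powr (1 / (p / 2))
        * texp t (\<lambda>x. \<bar>Mx x powr (p - 2)\<bar> powr (p / (p - 2))) powr (1 / (p / (p - 2))))"
      using K1 p by (intro mult_left_mono texp_holder) (auto simp: field_simps)
    also have "(\<lambda>x. \<bar>(S x)\<^sup>2\<bar> powr (p / 2)) = (\<lambda>x. S x powr p)"
    proof
      fix x
      have "(S x)\<^sup>2 = S x powr 2" using S0(1)[of x] by simp
      then show "\<bar>(S x)\<^sup>2\<bar> powr (p / 2) = S x powr p" by (simp add: powr_powr)
    qed
    also have "(\<lambda>x. \<bar>Mx x powr (p - 2)\<bar> powr (p / (p - 2))) = (\<lambda>x. Mx x powr p)"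
      using p by (simp add: powr_powr)
    finally show ?thesis by (simp add: Y_def N_def)
  qed
  \<comment> \<open>The bound \<open>YZ\<close> removes the square function, and \<open>NX\<close>
    turns the maximal function into a power of \<open>X\<close>, which can then be
    cancelled.\<close>
  have "X \<le> (K * q powr (p - 2) * (p - 1)\<^sup>2 * Z powr (2 / p)) * X powr ((p - 2) / p)"
  proof -
    have "Y powr (2 / p) \<le> ((p - 1) powr p * Z) powr (2 / p)" using YZ nn p by (intro powr_mono2) auto
    also have "\<dots> = (p - 1)\<^sup>2 * Z powr (2 / p)" using nn p by (simp add: powr_mult powr_powr)
    finally have 1: "Y powr (2 / p) \<le> (p - 1)\<^sup>2 * Z powr (2 / p)" .
    have "(N powr (1 / p)) powr (p - 2) \<le> (q * X powr (1 / p)) powr (p - 2)" using NX p by (intro powr_mono2) auto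
    then have 2: "N powr ((p - 2) / p) \<le> q powr (p - 2) * X powr ((p - 2) / p)"
      using q nn by (simp add: powr_mult powr_powr)
    have "Y powr (2 / p) * N powr ((p - 2) / p) \<le> ((p - 1)\<^sup>2 * Z powr (2 / p)) * (q powr (p - 2) * X powr ((p - 2) / p))"
      by (intro mult_mono 1 2) auto
    then have "K * (Y powr (2 / p) * N powr ((p - 2) / p)) \<le> K * (((p - 1)\<^sup>2 * Z powr (2 / p)) * (q powr (p - 2) * X powr ((p - 2) / p)))"
      using K1 by (intro mult_left_mono) auto
    with XY show ?thesis by (simp add: mult_ac)
  qed
  from powr_le_cancel[OF this nn(1)] have "X powr (1 - (p - 2) / p) \<le> K * q powr (p - 2) * (p - 1)\<^sup>2 * Z powr (2 / p)"
    using K1 p by simp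
  moreover have "1 - (p - 2) / p = 2 / p" using p by (simp add: field_simps)
  ultimately have "X powr (2 / p) \<le> K * q powr (p - 2) * (p - 1)\<^sup>2 * Z powr (2 / p)" by simp
  also have "\<dots> \<le> (Cp p)\<^sup>2 * Z powr (2 / p)"
  proof (intro mult_right_mono)
    \<comment> \<open>The estimates give the factor \<open>p / 2\<close>; it is enlarged to
      \<open>(p / 2) powr 3\<close>, the factor in the square of \<open>Cp p\<close>.\<close>
    have "K * q powr (p - 2) * (p - 1)\<^sup>2 \<le> K * (p - 1) * (p - 1)\<^sup>2"
      using conjugate_powr_le[OF p] K1 by (intro mult_right_mono mult_left_mono) (auto simp: q_def)
    also have "\<dots> = ((p - 1)\<^sup>2)\<^sup>2 * (p / 2) powr 1"
      using p by (simp add: K_def power2_eq_square)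
    also have "\<dots> \<le> ((p - 1)\<^sup>2)\<^sup>2 * (p / 2) powr 3" using p by (intro mult_left_mono powr_mono) auto
    also have "\<dots> = (Cp p)\<^sup>2" by (simp add: Cp_def power_mult_distrib powr_powr flip: powr_numeral powr_add)
    finally show "K * q powr (p - 2) * (p - 1)\<^sup>2 \<le> (Cp p)\<^sup>2" .
  qed auto
  finally have "(X powr (2 / p)) powr (p / 2) \<le> ((Cp p)\<^sup>2 * Z powr (2 / p)) powr (p / 2)"
    using p by (intro powr_mono2) auto
  moreover have "((Cp p)\<^sup>2) powr (p / 2) = Cp p powr p"
  proof -
    have "0 \<le> Cp p" by (simp add: Cp_def)
    then have "(Cp p)\<^sup>2 = Cp p powr 2" by simp
    then show ?thesis by (simp add: powr_powr)
  qed
  ultimately show ?thesis using nn p by (simp add: powr_mult powr_powr X_def Z_def G_def)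
qed

section \<open>Facts about \<open>L\<^sub>p\<close>\<close>

text \<open>The \<open>p\<close>-th power of the norm. Approximation arguments only need a crude
  triangle inequality for it, with the factor \<open>2 powr p\<close> of \<open>Lp_add\<close>; the
  sharp constant always comes from \<open>tproj_bound\<close> or duality.\<close>

abbreviation Ip :: "'a measure \<Rightarrow> real \<Rightarrow> ('a \<Rightarrow> real) \<Rightarrow> real" where
  "Ip M p f \<equiv> (\<integral>w. \<bar>f w\<bar> powr p \<partial>M)"

lemma LpD: "f \<in> Lp M p \<Longrightarrow> f \<in> borel_measurable M" "f \<in> Lp M p \<Longrightarrow> integrable M (\<lambda>w. \<bar>f w\<bar> powr p)"
  by (auto simp: Lp_def)

lemma LpI: "f \<in> borel_measurable M \<Longrightarrow> integrable M (\<lambda>w. \<bar>f w\<bar> powr p) \<Longrightarrow> f \<in> Lp M p"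
  by (auto simp: Lp_def)

lemma Lp_2_iff: "f \<in> Lp M 2 \<longleftrightarrow> f \<in> borel_measurable M \<and> integrable M (\<lambda>w. (f w)\<^sup>2)"
  by (simp add: Lp_def)

lemma Ip_nonneg: "0 \<le> Ip M p f"
  by (intro Bochner_Integration.integral_nonneg) auto

lemma Lp_norm_less_iff: "0 < p \<Longrightarrow> 0 < e \<Longrightarrow> Lp_norm M p f < e \<longleftrightarrow> Ip M p f < e powr p"
proof -
  assume p: "0 < p" and e: "0 < e"
  have "Lp_norm M p f < e \<longleftrightarrow> Lp_norm M p f powr p < e powr p"
  proof
    assume "Lp_norm M p f powr p < e powr p"
    then show "Lp_norm M p f < e" using powr_mono2[of p e "Lp_norm M p f"] p e by (meson less_imp_le not_le)
  qed (use p in \<open>auto simp: Lp_norm_def intro!: powr_less_mono2\<close>)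
  also have "Lp_norm M p f powr p = Ip M p f" using p Ip_nonneg[of M f p] by (simp add: Lp_norm_def powr_powr)
  finally show ?thesis .
qed

lemma Lp_norm_leI: "0 < p \<Longrightarrow> 0 \<le> C \<Longrightarrow> Ip M p f \<le> C powr p * Ip M p g \<Longrightarrow> Lp_norm M p f \<le> C * Lp_norm M p g"
proof -
  assume p: "0 < p" "0 \<le> C" and le: "Ip M p f \<le> C powr p * Ip M p g"
  have "Lp_norm M p f \<le> (C powr p * Ip M p g) powr (1 / p)"
    unfolding Lp_norm_def using p le Ip_nonneg[of M f p] by (intro powr_mono2) auto
  also have "\<dots> = C * Lp_norm M p g" using p Ip_nonneg[of M g p] by (simp add: Lp_norm_def powr_mult powr_powr)
  finally show ?thesis .
qed

lemma Lp_closure_iff: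
  assumes p: "0 < p"
  shows "g \<in> Lp_closure M p S \<longleftrightarrow> g \<in> Lp M p \<and> (\<forall>e>0. \<exists>f\<in>S. Ip M p (\<lambda>w. g w - f w) < e)"
proof (safe)
  fix e :: real assume g: "g \<in> Lp_closure M p S" and e: "0 < e"
  then obtain f where f: "f \<in> S" "Lp_norm M p (\<lambda>w. g w - f w) < e powr (1 / p)"
    unfolding Lp_closure_def by (auto dest: spec[of _ "e powr (1 / p)"])
  then have "Ip M p (\<lambda>w. g w - f w) < (e powr (1 / p)) powr p"
    using Lp_norm_less_iff[of p "e powr (1 / p)" M "\<lambda>w. g w - f w"] p e by auto
  then show "\<exists>f\<in>S. Ip M p (\<lambda>w. g w - f w) < e" using f p e by (auto simp: powr_powr)
next
  assume *: "g \<in> Lp M p" "\<forall>e>0. \<exists>f\<in>S. Ip M p (\<lambda>w. g w - f w) < e"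
  have "\<exists>f\<in>S. Lp_norm M p (\<lambda>w. g w - f w) < e" if "0 < e" for e
    using *(2)[rule_format, of "e powr p"] that Lp_norm_less_iff[OF p that, of M] by auto
  then show "g \<in> Lp_closure M p S" using *(1) by (simp add: Lp_closure_def)
qed (simp add: Lp_closure_def)

lemma abs_add_powr_le:
  fixes a b p :: real
  assumes "0 < p"
  shows "\<bar>a + b\<bar> powr p \<le> 2 powr p * (\<bar>a\<bar> powr p + \<bar>b\<bar> powr p)"
proof -
  have "\<bar>a + b\<bar> powr p \<le> (2 * max \<bar>a\<bar> \<bar>b\<bar>) powr p"
    using assms by (intro powr_mono2) auto
  also have "\<dots> = 2 powr p * max \<bar>a\<bar> \<bar>b\<bar> powr p" by (simp add: powr_mult)
  also have "\<dots> \<le> 2 powr p * (\<bar>a\<bar> powr p + \<bar>b\<bar> powr p)" by (intro mult_left_mono) (auto simp: max_def)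
  finally show ?thesis .
qed

lemma Lp_add:
  assumes p: "0 < p" and f: "f \<in> Lp M p" and g: "g \<in> Lp M p"
  shows "(\<lambda>w. f w + g w) \<in> Lp M p"
    and "Ip M p (\<lambda>w. f w + g w) \<le> 2 powr p * (Ip M p f + Ip M p g)"
proof -
  note [measurable] = LpD(1)[OF f] LpD(1)[OF g]
  have int: "integrable M (\<lambda>w. 2 powr p * (\<bar>f w\<bar> powr p + \<bar>g w\<bar> powr p))"
    using LpD(2)[OF f] LpD(2)[OF g] by auto
  have int2: "integrable M (\<lambda>w. \<bar>f w + g w\<bar> powr p)"
    by (rule Bochner_Integration.integrable_bound[OF int]) (use abs_add_powr_le[OF p] in \<open>auto intro!: AE_I2\<close>)
  then show "(\<lambda>w. f w + g w) \<in> Lp M p" by (intro LpI) auto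
  have "Ip M p (\<lambda>w. f w + g w) \<le> (\<integral>w. 2 powr p * (\<bar>f w\<bar> powr p + \<bar>g w\<bar> powr p) \<partial>M)"
    by (intro integral_mono int int2 abs_add_powr_le p)
  then show "Ip M p (\<lambda>w. f w + g w) \<le> 2 powr p * (Ip M p f + Ip M p g)"
    using LpD(2)[OF f] LpD(2)[OF g] by simp
qed

lemma Lp_cmult:
  assumes f: "f \<in> Lp M p"
  shows "(\<lambda>w. c * f w) \<in> Lp M p" and "Ip M p (\<lambda>w. c * f w) = \<bar>c\<bar> powr p * Ip M p f"
  using LpD[OF f] by (auto intro!: LpI simp: abs_mult powr_mult)

lemma Lp_lincomb: "0 < p \<Longrightarrow> f \<in> Lp M p \<Longrightarrow> g \<in> Lp M p \<Longrightarrow> (\<lambda>w. a * f w + b * g w) \<in> Lp M p"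
  by (intro Lp_add Lp_cmult)

lemma Lp_diff:
  assumes p: "0 < p" and f: "f \<in> Lp M p" and g: "g \<in> Lp M p"
  shows "(\<lambda>w. f w - g w) \<in> Lp M p"
    and "Ip M p (\<lambda>w. f w - g w) \<le> 2 powr p * (Ip M p f + Ip M p g)"
  using Lp_add[OF p f Lp_cmult(1)[OF g, of "-1"]] by simp_all

lemma Lp_triangle:
  assumes p: "0 < p" and f: "f \<in> Lp M p" and g: "g \<in> Lp M p" and h: "h \<in> Lp M p"
  shows "Ip M p (\<lambda>w. f w - h w) \<le> 2 powr p * (Ip M p (\<lambda>w. f w - g w) + Ip M p (\<lambda>w. g w - h w))"
  using Lp_add(2)[OF p Lp_diff(1)[OF p f g] Lp_diff(1)[OF p g h]] by simp

lemma Ip_cong_AE: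
  assumes "AE w in M. f w = g w" "f \<in> borel_measurable M" "g \<in> borel_measurable M"
  shows "Ip M p f = Ip M p g"
  using assms by (intro integral_cong_AE) auto

lemma Lp_holder:
  fixes p q :: real
  assumes pq: "1 < p" "1 < q" "1 / p + 1 / q = 1" and f: "f \<in> Lp M p" and g: "g \<in> Lp M q"
  shows "integrable M (\<lambda>w. f w * g w)"
    and "(\<integral>w. \<bar>f w * g w\<bar> \<partial>M) \<le> Ip M p f powr (1 / p) * Ip M q g powr (1 / q)"
    and "\<bar>\<integral>w. f w * g w \<partial>M\<bar> \<le> Ip M p f powr (1 / p) * Ip M q g powr (1 / q)"
proof -
  note [measurable] = LpD(1)[OF f] LpD(1)[OF g]
  have int: "integrable M (\<lambda>w. a * \<bar>f w\<bar> powr p + b * \<bar>g w\<bar> powr q)" for a b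
    using LpD(2)[OF f] LpD(2)[OF g] by auto
  show int2: "integrable M (\<lambda>w. f w * g w)"
  proof (rule Bochner_Integration.integrable_bound[OF int])
    show "AE w in M. norm (f w * g w) \<le> norm (1 * 1 / (1 powr p * p) * \<bar>f w\<bar> powr p + 1 * 1 / (1 powr q * q) * \<bar>g w\<bar> powr q)"
      using young_scaled[OF pq, of 1 1] by (auto intro!: AE_I2 order_trans[OF _ abs_ge_self])
  qed auto
  show *: "(\<integral>w. \<bar>f w * g w\<bar> \<partial>M) \<le> Ip M p f powr (1 / p) * Ip M q g powr (1 / q)"
  proof (rule holder_of_young)
    fix A B :: real assume AB: "0 < A" "0 < B"
    have "(\<integral>w. \<bar>f w * g w\<bar> \<partial>M) \<le> (\<integral>w. A * B / (A powr p * p) * \<bar>f w\<bar> powr p + A * B / (B powr q * q) * \<bar>g w\<bar> powr q \<partial>M)"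
      using pq AB int2 by (intro integral_mono int young_scaled) auto
    also have "\<dots> = A * B * (Ip M p f / A powr p / p + Ip M q g / B powr q / q)"
      using LpD(2)[OF f] LpD(2)[OF g] by (simp add: distrib_left)
    finally show "(\<integral>w. \<bar>f w * g w\<bar> \<partial>M) \<le> A * B * (Ip M p f / A powr p / p + Ip M q g / B powr q / q)" .
  qed (use pq Ip_nonneg in auto)
  show "\<bar>\<integral>w. f w * g w \<partial>M\<bar> \<le> Ip M p f powr (1 / p) * Ip M q g powr (1 / q)"
    using integral_abs_bound[of M "\<lambda>w. f w * g w"] * by linarith
qed

lemma L2_mult:
  assumes f: "f \<in> Lp M 2" and g: "g \<in> Lp M 2"
  shows "integrable M (\<lambda>w. f w * g w)"
    and "\<bar>\<integral>w. f w * g w \<partial>M\<bar> \<le> sqrt (\<integral>w. (f w)\<^sup>2 \<partial>M) * sqrt (\<integral>w. (g w)\<^sup>2 \<partial>M)"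
  using Lp_holder[of 2 2 f M g] f g by (auto simp: powr_half_sqrt)

lemma L2_add_sq:
  assumes f: "f \<in> Lp M 2" and g: "g \<in> Lp M 2"
  shows "(\<integral>w. (f w + g w)\<^sup>2 \<partial>M) \<le> 2 * ((\<integral>w. (f w)\<^sup>2 \<partial>M) + (\<integral>w. (g w)\<^sup>2 \<partial>M))"
proof -
  have s: "integrable M (\<lambda>w. (f w + g w)\<^sup>2)" using Lp_add(1)[of 2 f M g] f g by (simp add: Lp_2_iff)
  have "(\<integral>w. (f w + g w)\<^sup>2 \<partial>M) \<le> (\<integral>w. 2 * ((f w)\<^sup>2 + (g w)\<^sup>2) \<partial>M)"
  proof (intro integral_mono s)
    fix w
    show "(f w + g w)\<^sup>2 \<le> 2 * ((f w)\<^sup>2 + (g w)\<^sup>2)" using zero_le_power2[of "f w - g w"] by (simp add: power2_eq_square algebra_simps)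
  qed (use f g in \<open>auto simp: Lp_2_iff\<close>)
  then show ?thesis using f g by (simp add: Lp_2_iff)
qed

lemma L2_diff_triangle:
  assumes f: "f \<in> Lp M 2" and g: "g \<in> Lp M 2" and h: "h \<in> Lp M 2"
  shows "(\<integral>w. (f w - h w)\<^sup>2 \<partial>M) \<le> 2 * ((\<integral>w. (f w - g w)\<^sup>2 \<partial>M) + (\<integral>w. (g w - h w)\<^sup>2 \<partial>M))"
  using L2_add_sq[OF Lp_diff(1)[of 2 f M g] Lp_diff(1)[of 2 g M h]] assms by simp

section \<open>Duality and completeness on probability spaces\<close>

context prob_space
begin

lemma Lp_bounded:
  assumes "f \<in> borel_measurable M" "\<And>w. w \<in> space M \<Longrightarrow> \<bar>f w\<bar> \<le> K" "0 \<le> p"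
  shows "f \<in> Lp M p"
proof (rule LpI)
  show "integrable M (\<lambda>w. \<bar>f w\<bar> powr p)"
    by (rule integrable_const_bound[where B="K powr p"]) (use assms in \<open>auto intro!: AE_I2 powr_mono2\<close>)
qed (use assms in auto)

lemma Lp_const [simp]: "0 \<le> p \<Longrightarrow> (\<lambda>_. c) \<in> Lp M p"
  by (rule Lp_bounded[of _ "\<bar>c\<bar>"]) auto

lemma Lp_mono:
  assumes "0 < r" "r \<le> s" "f \<in> Lp M s"
  shows "f \<in> Lp M r"
proof (rule LpI)
  have int: "integrable M (\<lambda>w. 1 + \<bar>f w\<bar> powr s)" using LpD(2)[OF assms(3)] by auto
  show "integrable M (\<lambda>w. \<bar>f w\<bar> powr r)"
  proof (rule Bochner_Integration.integrable_bound[OF int])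
    have "\<bar>f w\<bar> powr r \<le> 1 + \<bar>f w\<bar> powr s" for w
    proof (cases "\<bar>f w\<bar> \<le> 1")
      case True
      then have "\<bar>f w\<bar> powr r \<le> 1 powr r" using assms by (intro powr_mono2) auto
      then show ?thesis by (simp add: add_increasing2)
    next
      case False
      then have "\<bar>f w\<bar> powr r \<le> \<bar>f w\<bar> powr s" using assms by (intro powr_mono) auto
      then show ?thesis by simp
    qed
    then show "AE w in M. norm (\<bar>f w\<bar> powr r) \<le> norm (1 + \<bar>f w\<bar> powr s)" by (auto intro!: AE_I2)
  qed (use LpD(1)[OF assms(3)] in auto)
qed (use LpD(1)[OF assms(3)] in auto)

lemma L2_integrable: "f \<in> Lp M 2 \<Longrightarrow> integrable M f"
  using L2_mult(1)[of f M "\<lambda>_. 1"] by simp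

text \<open>Membership of \<open>h\<close> in \<open>L_p\<close> is part of the conclusion, so its
  norm cannot be divided out at once. Testing against \<open>sgn h\<close> times a power of the
  truncation of \<open>|h|\<close> at height \<open>k\<close> involves only finite integrals, where
  cancellation is legitimate; monotone convergence in \<open>k\<close> finishes.\<close>

lemma Lp_duality:
  assumes p: "1 < p" and h: "h \<in> Lp M 2" and K: "0 \<le> K"
    and *: "\<And>g B. g \<in> borel_measurable M \<Longrightarrow> (\<And>w. \<bar>g w\<bar> \<le> B) \<Longrightarrow>
        (\<integral>w. h w * g w \<partial>M) \<le> K * Ip M (p / (p - 1)) g powr (1 - 1 / p)"
  shows "h \<in> Lp M p" "Ip M p h \<le> K powr p"
proof -
  note [measurable] = LpD(1)[OF h]
  define m where "m k w = min \<bar>h w\<bar> (real k)" for k w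
  have m0: "0 \<le> m k w" for k w by (simp add: m_def)
  have [measurable]: "m k \<in> borel_measurable M" for k unfolding m_def by measurable
  have mint: "integrable M (\<lambda>w. m k w powr p)" for k
    using LpD(2)[OF Lp_bounded[of "m k" "real k" p]] p by (simp add: m_def)
  have bound: "(\<integral>w. m k w powr p \<partial>M) \<le> K powr p" for k
  proof -
    define I where "I = (\<integral>w. m k w powr p \<partial>M)"
    have I0: "0 \<le> I" by (auto simp: I_def)
    define g where "g w = sgn (h w) * m k w powr (p - 1)" for w
    have [measurable]: "g \<in> borel_measurable M" unfolding g_def by measurable
    have gb: "\<bar>g w\<bar> \<le> real k powr (p - 1)" for w
      using p by (auto simp: g_def abs_mult sgn_if m_def intro!: powr_mono2)
    have g2: "g \<in> Lp M 2" by (rule Lp_bounded[OF _ gb]) auto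
    have "I \<le> (\<integral>w. h w * g w \<partial>M)"
      unfolding I_def
    proof (intro integral_mono mint L2_mult(1)[OF h g2])
      fix w
      have "m k w powr p = m k w * m k w powr (p - 1)"
        using powr_add[of "m k w" 1 "p - 1"] m0[of k w] by (cases "m k w = 0") auto
      also have "\<dots> \<le> \<bar>h w\<bar> * m k w powr (p - 1)" by (intro mult_right_mono) (auto simp: m_def)
      also have "\<dots> = h w * g w" by (simp add: g_def abs_sgn)
      finally show "m k w powr p \<le> h w * g w" .
    qed
    also have "\<dots> \<le> K * Ip M (p / (p - 1)) g powr (1 - 1 / p)" by (rule *[OF _ gb]) auto
    also have "Ip M (p / (p - 1)) g = I"
      unfolding I_def
    proof (intro Bochner_Integration.integral_cong refl)
      fix w
      show "\<bar>g w\<bar> powr (p / (p - 1)) = m k w powr p"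
      proof (cases "h w = 0")
        case True then show ?thesis using p by (simp add: g_def m_def)
      next
        case False
        then show ?thesis using p by (simp add: g_def abs_mult sgn_if powr_powr)
      qed
    qed
    finally have "I powr (1 - (1 - 1 / p)) \<le> K" using I0 K p by (intro powr_le_cancel) auto
    then have "(I powr (1 / p)) powr p \<le> K powr p" using p by (intro powr_mono2) auto
    then show ?thesis using p I0 by (simp add: powr_powr flip: I_def)
  qed
  have lim: "(\<lambda>k. m k w powr p) \<longlonglongrightarrow> \<bar>h w\<bar> powr p" for w
  proof (rule tendsto_eventually)
    obtain n where "\<bar>h w\<bar> \<le> real n" using real_arch_simple by blast
    then show "\<forall>\<^sub>F k in sequentially. m k w powr p = \<bar>h w\<bar> powr p"
      unfolding eventually_sequentially by (intro exI[of _ n]) (auto simp: m_def min_def)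
  qed
  have inc: "mono (\<lambda>k. m k w powr p)" for w
    using p by (intro monoI powr_mono2) (auto simp: m_def)
  have cv: "convergent (\<lambda>k. \<integral>w. m k w powr p \<partial>M)"
  proof (intro Bseq_mono_convergent BseqI'[of _ "K powr p"] )
    show "norm (\<integral>w. m k w powr p \<partial>M) \<le> K powr p" for k using bound[of k] by simp
    show "\<forall>i n. i \<le> n \<longrightarrow> (\<integral>w. m i w powr p \<partial>M) \<le> (\<integral>w. m n w powr p \<partial>M)"
      using inc by (auto intro!: integral_mono mint simp: mono_def)
  qed
  then obtain x where x: "(\<lambda>k. \<integral>w. m k w powr p \<partial>M) \<longlonglongrightarrow> x" by (auto simp: convergent_def)
  have "integrable M (\<lambda>w. \<bar>h w\<bar> powr p)" "integral\<^sup>L M (\<lambda>w. \<bar>h w\<bar> powr p) = x"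
    by (rule integrable_monotone_convergence[OF mint _ _ x] integral_monotone_convergence[OF mint _ _ x];
        use inc lim in \<open>auto intro!: AE_I2\<close>)+
  then show "h \<in> Lp M p" "Ip M p h \<le> K powr p"
    using LIMSEQ_le_const2[OF x, of "K powr p"] bound by (auto intro!: LpI)
qed

text \<open>The Riesz-Fischer argument: increments along a fast subsequence are summable in
  \<open>L_1\<close>, hence almost surely, and Fatou's lemma upgrades the pointwise limit to an
  \<open>L_2\<close> limit of the whole sequence.\<close>

lemma L2_complete:
  fixes f :: "nat \<Rightarrow> 'a \<Rightarrow> real"
  assumes f: "\<And>n. f n \<in> Lp M 2"
    and C: "\<And>e. 0 < e \<Longrightarrow> \<exists>N. \<forall>m\<ge>N. \<forall>n\<ge>N. (\<integral>w. (f m w - f n w)\<^sup>2 \<partial>M) < e"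
  shows "\<exists>h\<in>Lp M 2. (\<lambda>n. \<integral>w. (h w - f n w)\<^sup>2 \<partial>M) \<longlonglongrightarrow> 0"
proof -
  note [measurable] = LpD(1)[OF f]
  have "\<exists>N. \<forall>m\<ge>N. \<forall>n\<ge>N. (\<integral>w. (f m w - f n w)\<^sup>2 \<partial>M) < (1/4)^k" for k by (rule C) auto
  then obtain N where N: "\<And>k m n. m \<ge> N k \<Longrightarrow> n \<ge> N k \<Longrightarrow> (\<integral>w. (f m w - f n w)\<^sup>2 \<partial>M) < (1/4)^k"
    by metis
  \<comment> \<open>The maximum makes the subsequence monotone and places it beyond
    \<open>N k\<close>; adding \<open>k\<close> gives \<open>k <= r k\<close>, which the Fatou step
    uses.\<close>
  define r where "r k = Max (N ` {..k}) + k" for k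
  have rN: "N k \<le> r k" for k unfolding r_def by (rule trans_le_add1) (auto intro!: Max_ge)
  have rS: "r k \<le> r (Suc k)" for k
    unfolding r_def by (intro add_mono Max_mono) auto
  have rk: "k \<le> r k" for k by (simp add: r_def)
  define d where "d k w = f (r (Suc k)) w - f (r k) w" for k w
  have d2: "d k \<in> Lp M 2" for k unfolding d_def by (rule Lp_diff) (use f in auto)
  note [measurable] = LpD(1)[OF d2]
  have dint: "(\<integral>w. \<bar>d k w\<bar> \<partial>M) \<le> (1/2)^k" for k
  proof -
    have "\<bar>\<integral>w. \<bar>d k w\<bar> * 1 \<partial>M\<bar> \<le> sqrt (\<integral>w. (\<bar>d k w\<bar>)\<^sup>2 \<partial>M) * sqrt (\<integral>w. 1\<^sup>2 \<partial>M)"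
      using d2[of k] by (intro L2_mult) (auto simp: Lp_2_iff)
    also have "\<dots> \<le> sqrt ((1/4)^k)"
      using N[of k "r (Suc k)" "r k"] rN[of k] rS[of k] by (simp add: prob_space d_def)
    also have "\<dots> = (1/2)^k" by (simp add: real_sqrt_power real_sqrt_divide)
    finally show ?thesis by simp
  qed
  have "AE w in M. summable (\<lambda>k. \<bar>d k w\<bar>)"
  proof -
    have "(\<integral>\<^sup>+w. (\<Sum>k. ennreal \<bar>d k w\<bar>) \<partial>M) = (\<Sum>k. \<integral>\<^sup>+w. ennreal \<bar>d k w\<bar> \<partial>M)"
      by (rule nn_integral_suminf) measurable
    also have "\<dots> = (\<Sum>k. ennreal (\<integral>w. \<bar>d k w\<bar> \<partial>M))"
      using L2_integrable[OF d2] by (intro arg_cong[where f=suminf] ext nn_integral_eq_integral) auto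
    also have "\<dots> \<le> (\<Sum>k. ennreal ((1/2)^k))"
      using dint by (intro suminf_le) (auto intro!: ennreal_leI)
    also have "\<dots> < \<infinity>"
      by (subst suminf_ennreal2) (auto intro: summable_geometric simp: top.not_eq_extremum)
    finally have "AE w in M. (\<Sum>k. ennreal \<bar>d k w\<bar>) \<noteq> \<infinity>"
      by (intro nn_integral_PInf_AE) (auto simp: top.not_eq_extremum)
    then show ?thesis by eventually_elim (intro summable_suminf_not_top, auto)
  qed
  then have conv: "AE w in M. convergent (\<lambda>k. f (r k) w)"
  proof eventually_elim
    fix w assume "summable (\<lambda>k. \<bar>d k w\<bar>)"
    then have "summable (\<lambda>k. d k w)" by (rule summable_rabs_cancel)
    then have "(\<lambda>n. \<Sum>k<n. d k w) \<longlonglongrightarrow> (\<Sum>k. d k w)" by (rule summable_LIMSEQ)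
    moreover have "(\<Sum>k<n. d k w) = f (r n) w - f (r 0) w" for n
      by (induction n) (auto simp: d_def)
    ultimately have "(\<lambda>n. f (r n) w - f (r 0) w + f (r 0) w) \<longlonglongrightarrow> (\<Sum>k. d k w) + f (r 0) w"
      by (intro tendsto_add) auto
    then show "convergent (\<lambda>k. f (r k) w)" by (auto simp: convergent_def)
  qed
  define h where "h w = lim (\<lambda>k. f (r k) w)" for w
  have [measurable]: "h \<in> borel_measurable M" unfolding h_def by measurable
  have hlim: "AE w in M. (\<lambda>k. f (r k) w) \<longlonglongrightarrow> h w"
    using conv by eventually_elim (auto simp: h_def convergent_LIMSEQ_iff)
  have fatou: "integrable M (\<lambda>w. (h w - f n w)\<^sup>2) \<and> (\<integral>w. (h w - f n w)\<^sup>2 \<partial>M) \<le> e"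
    if e: "0 < e" "\<And>m. m \<ge> M0 \<Longrightarrow> (\<integral>w. (f m w - f n w)\<^sup>2 \<partial>M) < e" for n e M0
  proof -
    have fi: "integrable M (\<lambda>w. (f m w - f n w)\<^sup>2)" for m n
      using Lp_diff(1)[of 2 "f m" M "f n"] f by (simp add: Lp_2_iff)
    have "(\<integral>\<^sup>+w. ennreal ((h w - f n w)\<^sup>2) \<partial>M) = (\<integral>\<^sup>+w. liminf (\<lambda>k. ennreal ((f (r k) w - f n w)\<^sup>2)) \<partial>M)"
    proof (rule nn_integral_cong_AE)
      show "AE w in M. ennreal ((h w - f n w)\<^sup>2) = liminf (\<lambda>k. ennreal ((f (r k) w - f n w)\<^sup>2))"
        using hlim
      proof eventually_elim
        fix w assume "(\<lambda>k. f (r k) w) \<longlonglongrightarrow> h w"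
        then have "(\<lambda>k. ennreal ((f (r k) w - f n w)\<^sup>2)) \<longlonglongrightarrow> ennreal ((h w - f n w)\<^sup>2)"
          by (intro tendsto_ennrealI tendsto_intros)
        then show "ennreal ((h w - f n w)\<^sup>2) = liminf (\<lambda>k. ennreal ((f (r k) w - f n w)\<^sup>2))"
          by (intro lim_imp_Liminf[symmetric]) auto
      qed
    qed
    also have "\<dots> \<le> liminf (\<lambda>k. \<integral>\<^sup>+w. ennreal ((f (r k) w - f n w)\<^sup>2) \<partial>M)"
      by (rule nn_integral_liminf) measurable
    also have "\<dots> \<le> ennreal e"
    proof (rule Liminf_le)
      show "\<forall>\<^sub>F k in sequentially. (\<integral>\<^sup>+w. ennreal ((f (r k) w - f n w)\<^sup>2) \<partial>M) \<le> ennreal e"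
        unfolding eventually_sequentially
      proof (intro exI[of _ M0] allI impI)
        fix k assume "M0 \<le> k"
        then have "M0 \<le> r k" using rk[of k] by linarith
        then show "(\<integral>\<^sup>+w. ennreal ((f (r k) w - f n w)\<^sup>2) \<partial>M) \<le> ennreal e"
          using less_imp_le[OF e(2)] by (subst nn_integral_eq_integral[OF fi]) (auto intro!: ennreal_leI)
      qed
    qed auto
    finally have le: "(\<integral>\<^sup>+w. ennreal ((h w - f n w)\<^sup>2) \<partial>M) \<le> ennreal e" .
    then have i: "integrable M (\<lambda>w. (h w - f n w)\<^sup>2)"
      by (intro integrableI_bounded) (auto simp: top.not_eq_extremum intro: le_less_trans)
    moreover have "(\<integral>w. (h w - f n w)\<^sup>2 \<partial>M) \<le> e"
      using le e by (subst (asm) nn_integral_eq_integral[OF i]) auto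
    ultimately show ?thesis by simp
  qed
  have "integrable M (\<lambda>w. (h w - f (N 0) w)\<^sup>2)"
    using fatou[of "1" "N 0" "N 0"] N[of 0] by auto
  then have "(\<lambda>w. h w - f (N 0) w) \<in> Lp M 2" by (simp add: Lp_2_iff)
  from Lp_add(1)[OF _ this f[of "N 0"]] have h2: "h \<in> Lp M 2" by simp
  have "(\<lambda>n. \<integral>w. (h w - f n w)\<^sup>2 \<partial>M) \<longlonglongrightarrow> 0"
  proof (rule LIMSEQ_I)
    fix e :: real assume e: "0 < e"
    then obtain N0 where N0: "\<And>m n. m \<ge> N0 \<Longrightarrow> n \<ge> N0 \<Longrightarrow> (\<integral>w. (f m w - f n w)\<^sup>2 \<partial>M) < e / 2"
      using C[of "e / 2"] by auto
    show "\<exists>no. \<forall>n\<ge>no. norm ((\<integral>w. (h w - f n w)\<^sup>2 \<partial>M) - 0) < e"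
    proof (intro exI[of _ N0] allI impI)
      fix n assume "N0 \<le> n"
      then have "(\<integral>w. (h w - f n w)\<^sup>2 \<partial>M) \<le> e / 2" using fatou[of "e / 2" N0 n] N0 e by auto
      also have "\<dots> < e" using e by simp
      finally show "norm ((\<integral>w. (h w - f n w)\<^sup>2 \<partial>M) - 0) < e" by simp
    qed
  qed
  with h2 show ?thesis by blast
qed

lemma L2_AE_eqI:
  assumes f: "f \<in> Lp M 2" and g: "g \<in> Lp M 2" and "(\<integral>w. (f w - g w)\<^sup>2 \<partial>M) = 0"
  shows "AE w in M. f w = g w"
proof -
  have "integrable M (\<lambda>w. (f w - g w)\<^sup>2)" using Lp_diff(1)[of 2 f M g] f g by (simp add: Lp_2_iff)
  from integral_nonneg_eq_0_iff_AE[OF this] assms(3) have "AE w in M. (f w - g w)\<^sup>2 = 0" by simp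
  then show ?thesis by eventually_elim auto
qed

end

section \<open>Projections approximable by finite trees\<close>

text \<open>Serves \<open>texp_eq_0D\<close>: as there are no null points in a tree, conditional
  expectations onto it are determined at every point of \<open>tset t\<close>.\<close>

lemma texp_indicator_pos: "x \<in> tset t \<Longrightarrow> 0 < texp t (\<lambda>y. if y = x then 1 else 0)"
proof (induction t arbitrary: x)
  case (TDisj a b)
  then show ?case by auto
next
  case (TInd a b)
  then obtain u v where x: "x = PPair u v" "u \<in> tset a" "v \<in> tset b" by auto
  have "(\<lambda>u'. texp b (\<lambda>v'. if PPair u' v' = x then 1 else 0))
    = (\<lambda>u'. texp b (\<lambda>v'. if v' = v then 1 else 0) * (if u' = u then 1 else 0))"
    by (auto simp: x fun_eq_iff)
  then have "texp (TInd a b) (\<lambda>y. if y = x then 1 else 0)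
    = texp b (\<lambda>v'. if v' = v then 1 else 0) * texp a (\<lambda>u'. if u' = u then 1 else 0)"
    by (simp add: texp_cmult)
  then show ?case using TInd.IH(1)[OF x(2)] TInd.IH(2)[OF x(3)] by simp
qed auto

lemma texp_eq_0D:
  assumes "texp t f = 0" "\<And>x. x \<in> tset t \<Longrightarrow> 0 \<le> f x" "x \<in> tset t"
  shows "f x = 0"
proof -
  have "texp t (\<lambda>y. f x * (if y = x then 1 else 0)) \<le> texp t f" using assms(2,3) by (intro texp_mono) auto
  then have "f x * texp t (\<lambda>y. if y = x then 1 else 0) \<le> 0" using assms(1) by (simp only: texp_cmult)
  then show ?thesis using texp_indicator_pos[OF assms(3)] assms(2)[OF assms(3)]
    by (metis antisym mult_le_0_iff not_le)
qed

lemma tproj_cong: "(\<And>x. x \<in> tset t \<Longrightarrow> f x = g x) \<Longrightarrow> x \<in> tset t \<Longrightarrow> tproj t f x = tproj t g x"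
proof (induction t arbitrary: f g x)
  case (TDisj a b)
  from TDisj.prems(2) consider (l) u where "x = PLeft u" "u \<in> tset a" | (r) u where "x = PRight u" "u \<in> tset b"
    by auto
  then show ?case
  proof cases
    case l
    then show ?thesis using TDisj.IH(1)[of "\<lambda>x. f (PLeft x)" "\<lambda>x. g (PLeft x)" u] TDisj.prems(1) by simp
  next
    case r
    then show ?thesis using TDisj.IH(2)[of "\<lambda>x. f (PRight x)" "\<lambda>x. g (PRight x)" u] TDisj.prems(1) by simp
  qed
next
  case (TInd a b)
  then obtain u v where x: "x = PPair u v" "u \<in> tset a" "v \<in> tset b" by auto
  have fg: "f (PPair u v) = g (PPair u v)" if "u \<in> tset a" "v \<in> tset b" for u v
    using TInd.prems(1) that by auto
  show ?case unfolding x tproj.simps fpoint.case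
    by (intro arg_cong2[where f="(-)"] arg_cong2[where f="(+)"] TInd.IH x texp_cong fg)
qed auto

text \<open>A measure preserving map onto the finite probability space of \<open>t\<close>: since
  \<open>h\<close> is arbitrary, the integral identity fixes the distribution of
  \<open>\<pi>\<close>.\<close>

definition tree_map :: "'a measure \<Rightarrow> ftree \<Rightarrow> ('a \<Rightarrow> fpoint) \<Rightarrow> bool" where
  "tree_map M t \<pi> \<longleftrightarrow> \<pi> \<in> measurable M (count_space (tset t)) \<and> (\<forall>h. (\<integral>w. h (\<pi> w) \<partial>M) = texp t h)"

text \<open>\<open>F\<close> is the conditional expectation of \<open>f\<close> with respect to \<open>\<pi>\<close>.\<close>
definition tree_cond :: "'a measure \<Rightarrow> ftree \<Rightarrow> ('a \<Rightarrow> fpoint) \<Rightarrow> ('a \<Rightarrow> real) \<Rightarrow> (fpoint \<Rightarrow> real) \<Rightarrow> bool" where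
  "tree_cond M t \<pi> f F \<longleftrightarrow> (\<forall>h. (\<integral>w. f w * h (\<pi> w) \<partial>M) = texp t (\<lambda>x. F x * h x))"

text \<open>The tree may depend on \<open>f\<close> and \<open>e\<close>. No norm bound is included,
  because every approximant obeys \<open>tproj_bound\<close>. The error is measured in
  \<open>L_2\<close>, where the centered components of an independent sum are orthogonal.\<close>

definition appr :: "'a measure \<Rightarrow> (('a \<Rightarrow> real) \<Rightarrow> 'a \<Rightarrow> real) \<Rightarrow> bool" where
  "appr M P \<longleftrightarrow> (\<forall>f\<in>Lp M 2. \<forall>e>0. \<exists>t \<pi> F. tree_map M t \<pi> \<and> tree_cond M t \<pi> f F \<and>
     (\<integral>w. (P f w - tproj t F (\<pi> w))\<^sup>2 \<partial>M) < e)"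

lemma tree_cond_unique:
  assumes "tree_cond M t \<pi> f F" "tree_cond M t \<pi> f G" "x \<in> tset t"
  shows "F x = G x"
proof -
  define h where "h x = F x - G x" for x
  have "texp t (\<lambda>x. F x * h x) = texp t (\<lambda>x. G x * h x)"
    using assms(1,2) unfolding tree_cond_def by metis
  then have "texp t (\<lambda>x. (h x)\<^sup>2) = 0"
    by (simp add: h_def power2_eq_square left_diff_distrib texp_diff)
  from texp_eq_0D[OF this _ assms(3)] show ?thesis by (simp add: h_def)
qed

lemma tree_mapD:
  assumes "tree_map M t \<pi>"
  shows "\<pi> \<in> measurable M (count_space (tset t))" "(\<integral>w. h (\<pi> w) \<partial>M) = texp t h"
    "(\<lambda>w. h (\<pi> w)) \<in> borel_measurable M" "w \<in> space M \<Longrightarrow> \<pi> w \<in> tset t"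
proof -
  show m: "\<pi> \<in> measurable M (count_space (tset t))" using assms by (simp add: tree_map_def)
  show "(\<lambda>w. h (\<pi> w)) \<in> borel_measurable M" by (rule measurable_compose[OF m]) simp
  show "w \<in> space M \<Longrightarrow> \<pi> w \<in> tset t" using measurable_space[OF m] by simp
qed (use assms in \<open>simp add: tree_map_def\<close>)

context prob_space
begin

lemma tree_map_Lp:
  assumes "tree_map M t \<pi>" "0 \<le> p"
  shows "(\<lambda>w. h (\<pi> w)) \<in> Lp M p"
proof (rule Lp_bounded)
  show "\<bar>h (\<pi> w)\<bar> \<le> (\<Sum>x\<in>tset t. \<bar>h x\<bar>)" if "w \<in> space M" for w
    using tree_mapD(4)[OF assms(1) that] by (intro member_le_sum) auto
qed (use assms tree_mapD in auto)

lemma tree_cond_exists: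
  assumes t: "tree_map M t \<pi>" and f: "f \<in> Lp M 2"
  shows "\<exists>F. tree_cond M t \<pi> f F"
proof -
  define i :: "fpoint \<Rightarrow> fpoint \<Rightarrow> real" where "i x y = (if y = x then 1 else 0)" for x y
  have ip: "texp t (i x) > 0" if "x \<in> tset t" for x using texp_indicator_pos[OF that] by (simp add: i_def[abs_def])
  have exp: "h y = (\<Sum>x\<in>tset t. h x * i x y)" if "y \<in> tset t" for h y
    using that by (simp add: i_def if_distrib cong: if_cong)
  define F where "F x = (\<integral>w. f w * i x (\<pi> w) \<partial>M) / texp t (i x)" for x
  have int: "integrable M (\<lambda>w. f w * g (\<pi> w))" for g by (rule L2_mult(1)[OF f tree_map_Lp[OF t]]) auto
  have int1: "integrable M (\<lambda>w. g (\<pi> w))" for g :: "fpoint \<Rightarrow> real" using L2_integrable[OF tree_map_Lp[OF t, of 2 g]] by simp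
  have "(\<integral>w. f w * h (\<pi> w) \<partial>M) = texp t (\<lambda>x. F x * h x)" for h
  proof -
    have "(\<integral>w. f w * h (\<pi> w) \<partial>M) = (\<integral>w. (\<Sum>x\<in>tset t. h x * (f w * i x (\<pi> w))) \<partial>M)"
    proof (intro Bochner_Integration.integral_cong refl)
      fix w assume "w \<in> space M"
      then show "f w * h (\<pi> w) = (\<Sum>x\<in>tset t. h x * (f w * i x (\<pi> w)))"
        using exp[OF tree_mapD(4)[OF t], of w h] by (simp add: sum_distrib_left mult_ac)
    qed
    also have "\<dots> = (\<Sum>x\<in>tset t. h x * (\<integral>w. f w * i x (\<pi> w) \<partial>M))"
      using int by (subst Bochner_Integration.integral_sum) auto
    also have "\<dots> = (\<Sum>x\<in>tset t. F x * h x * texp t (i x))"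
      using ip by (intro sum.cong) (auto simp: F_def less_imp_neq[THEN not_sym])
    also have "\<dots> = (\<integral>w. (\<Sum>x\<in>tset t. F x * h x * i x (\<pi> w)) \<partial>M)"
      using int1 by (subst Bochner_Integration.integral_sum) (auto simp: tree_mapD(2)[OF t])
    also have "\<dots> = (\<integral>w. F (\<pi> w) * h (\<pi> w) \<partial>M)"
    proof (intro Bochner_Integration.integral_cong refl)
      fix w assume "w \<in> space M"
      then show "(\<Sum>x\<in>tset t. F x * h x * i x (\<pi> w)) = F (\<pi> w) * h (\<pi> w)"
        using exp[OF tree_mapD(4)[OF t], of w "\<lambda>x. F x * h x"] by simp
    qed
    also have "\<dots> = texp t (\<lambda>x. F x * h x)" by (rule tree_mapD(2)[OF t])
    finally show ?thesis .
  qed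
  then show ?thesis unfolding tree_cond_def by blast
qed

text \<open>Conditional expectation contracts \<open>L_p\<close>: the defining identity is tested
  against \<open>sgn F\<close> times the power \<open>p - 1\<close> of \<open>|F|\<close>, and the
  resulting power of the left side is cancelled.\<close>

lemma tree_cond_Lp_le:
  assumes p: "1 < p" and t: "tree_map M t \<pi>" and c: "tree_cond M t \<pi> f F" and f: "f \<in> Lp M p"
  shows "texp t (\<lambda>x. \<bar>F x\<bar> powr p) \<le> Ip M p f"
proof -
  define I where "I = texp t (\<lambda>x. \<bar>F x\<bar> powr p)"
  define h where "h x = sgn (F x) * \<bar>F x\<bar> powr (p - 1)" for x
  define q where "q = p / (p - 1)"
  have q: "1 < q" "1 / p + 1 / q = 1" using p by (auto simp: q_def field_simps)
  have I0: "0 \<le> I" unfolding I_def by (rule texp_nonneg) auto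
  have Fh: "F x * h x = \<bar>F x\<bar> powr p" for x
    using powr_add[of "\<bar>F x\<bar>" 1 "p - 1"] by (cases "F x = 0") (auto simp: h_def sgn_if)
  have hq: "\<bar>h x\<bar> powr q = \<bar>F x\<bar> powr p" for x
    using p by (cases "F x = 0") (auto simp: h_def sgn_if powr_powr q_def abs_mult)
  have "I = (\<integral>w. f w * h (\<pi> w) \<partial>M)" using c by (simp add: tree_cond_def I_def Fh)
  also have "\<dots> \<le> Ip M p f powr (1 / p) * Ip M q (\<lambda>w. h (\<pi> w)) powr (1 / q)"
    using Lp_holder(3)[OF p q f tree_map_Lp[OF t, of q h]] q by linarith
  also have "Ip M q (\<lambda>w. h (\<pi> w)) = I"
    unfolding hq I_def by (rule tree_mapD(2)[OF t])
  finally have "I powr (1 - 1 / q) \<le> Ip M p f powr (1 / p)" using I0 q by (intro powr_le_cancel) auto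
  moreover have "1 - 1 / q = 1 / p" using q by linarith
  ultimately have "(I powr (1 / p)) powr p \<le> (Ip M p f powr (1 / p)) powr p"
    using powr_mono2[of p "I powr (1 / p)" "Ip M p f powr (1 / p)"] p by simp
  then show ?thesis using p I0 Ip_nonneg[of M f p] by (simp add: powr_powr I_def)
qed

lemma Cp_ge_0 [simp]: "0 \<le> Cp p"
  by (simp add: Cp_def)

text \<open>The approximants converge only in \<open>L_2\<close>, which is weaker than
  \<open>L_p\<close> for \<open>p > 2\<close>. Pairings with bounded functions do converge, so the
  bound passes to the limit through \<open>Lp_duality\<close>.\<close>

lemma appr_bound:
  assumes p: "2 < p" and P: "appr M P" and f: "f \<in> Lp M p" and Pf: "P f \<in> Lp M 2"
  shows "P f \<in> Lp M p" "Ip M p (P f) \<le> Cp p powr p * Ip M p f"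
proof -
  define q where "q = p / (p - 1)"
  have q: "1 < q" "1 / p + 1 / q = 1" using p by (auto simp: q_def field_simps)
  have f2: "f \<in> Lp M 2" using Lp_mono[of 2 p] f p by auto
  define K where "K = Cp p * Ip M p f powr (1 / p)"
  have K: "0 \<le> K" by (simp add: K_def)
  have dual: "(\<integral>w. P f w * g w \<partial>M) \<le> K * Ip M q g powr (1 / q)"
    if g: "g \<in> borel_measurable M" "\<And>w. \<bar>g w\<bar> \<le> B" for g B
  proof (rule field_le_epsilon)
    fix e :: real assume e: "0 < e"
    have g2: "g \<in> Lp M 2" "g \<in> Lp M q" using Lp_bounded[OF g] q by auto
    \<comment> \<open>\<open>G\<close> is positive and dominates the \<open>L_2\<close> norm of
      \<open>g\<close>, so an \<open>L_2\<close> error below \<open>e / G\<close> costs at most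
      \<open>e\<close> in the pairing.\<close>
    define G where "G = sqrt (\<integral>w. (g w)\<^sup>2 \<partial>M) + 1"
    have G: "0 < G" "sqrt (\<integral>w. (g w)\<^sup>2 \<partial>M) \<le> G" by (auto simp: G_def add_nonneg_pos)
    obtain t \<pi> F where t: "tree_map M t \<pi>" and c: "tree_cond M t \<pi> f F" 
      and d: "(\<integral>w. (P f w - tproj t F (\<pi> w))\<^sup>2 \<partial>M) < (e / G)\<^sup>2"
      using P f2 e G unfolding appr_def by (metis divide_pos_pos zero_less_power)
    define T where "T w = tproj t F (\<pi> w)" for w
    have T: "T \<in> Lp M r" if "0 \<le> r" for r unfolding T_def by (rule tree_map_Lp[OF t that])
    have D: "(\<lambda>w. P f w - T w) \<in> Lp M 2" using Lp_diff(1)[of 2 "P f" M T] Pf T by auto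
    have "(\<integral>w. (P f w - T w) * g w \<partial>M) \<le> sqrt (\<integral>w. (P f w - T w)\<^sup>2 \<partial>M) * sqrt (\<integral>w. (g w)\<^sup>2 \<partial>M)"
      using L2_mult(2)[OF D g2(1)] by linarith
    also have "\<dots> \<le> (e / G) * G"
    proof (intro mult_mono G)
      show "sqrt (\<integral>w. (P f w - T w)\<^sup>2 \<partial>M) \<le> e / G"
        using real_sqrt_le_mono[OF less_imp_le[OF d]] e G by (simp add: T_def)
    qed (use e G in auto)
    finally have 1: "(\<integral>w. (P f w - T w) * g w \<partial>M) \<le> e" using G by simp
    have "(\<integral>w. T w * g w \<partial>M) \<le> Ip M p T powr (1 / p) * Ip M q g powr (1 / q)"
      using Lp_holder(3)[of p q T M g] p q g2 T by auto
    also have "\<dots> \<le> K * Ip M q g powr (1 / q)"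
    proof (intro mult_right_mono)
      have "Ip M p T = texp t (\<lambda>x. \<bar>tproj t F x\<bar> powr p)" unfolding T_def by (rule tree_mapD(2)[OF t])
      also have "\<dots> \<le> Cp p powr p * texp t (\<lambda>x. \<bar>F x\<bar> powr p)" by (rule tproj_bound[OF p])
      also have "\<dots> \<le> Cp p powr p * Ip M p f"
        using tree_cond_Lp_le[OF _ t c f] p by (intro mult_left_mono) auto
      finally have "Ip M p T powr (1 / p) \<le> (Cp p powr p * Ip M p f) powr (1 / p)"
        using p Ip_nonneg[of M T p] by (intro powr_mono2) auto
      then show "Ip M p T powr (1 / p) \<le> K" using p Ip_nonneg[of M f p] by (simp add: K_def powr_mult powr_powr)
    qed auto
    finally have 2: "(\<integral>w. T w * g w \<partial>M) \<le> K * Ip M q g powr (1 / q)" .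
    have "(\<integral>w. P f w * g w \<partial>M) = (\<integral>w. (P f w - T w) * g w + T w * g w \<partial>M)" by (simp add: algebra_simps)
    also have "\<dots> = (\<integral>w. (P f w - T w) * g w \<partial>M) + (\<integral>w. T w * g w \<partial>M)"
      using L2_mult(1)[OF D g2(1)] L2_mult(1)[OF T[of 2] g2(1)] by simp
    finally show "(\<integral>w. P f w * g w \<partial>M) \<le> K * Ip M q g powr (1 / q) + e" using 1 2 by linarith
  qed
  have pq: "1 / q = 1 - 1 / p" using q by linarith
  have *: "P f \<in> Lp M p" "Ip M p (P f) \<le> K powr p"
    using Lp_duality[OF _ Pf K, of p] dual p unfolding pq unfolding q_def by auto
  show "P f \<in> Lp M p" by fact
  show "Ip M p (P f) \<le> Cp p powr p * Ip M p f"
    using *(2) p Ip_nonneg[of M f p] by (simp add: K_def powr_mult powr_powr)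
qed

end

lemma orth_projD:
  assumes "orth_proj M P"
  shows "f \<in> Lp M 2 \<Longrightarrow> P f \<in> Lp M 2"
    and "f \<in> Lp M 2 \<Longrightarrow> g \<in> Lp M 2 \<Longrightarrow> AE w in M. f w = g w \<Longrightarrow> AE w in M. P f w = P g w"
    and "f \<in> Lp M 2 \<Longrightarrow> g \<in> Lp M 2 \<Longrightarrow> AE w in M. P (\<lambda>v. a * f v + b * g v) w = a * P f w + b * P g w"
    and "f \<in> Lp M 2 \<Longrightarrow> AE w in M. P (P f) w = P f w"
    and "f \<in> Lp M 2 \<Longrightarrow> g \<in> Lp M 2 \<Longrightarrow> (\<integral>w. P f w * g w \<partial>M) = (\<integral>w. f w * P g w \<partial>M)"
proof -
  note D = assms[unfolded orth_proj_def]
  note D1 = D[THEN conjunct1, rule_format]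
  note D2 = D[THEN conjunct2, THEN conjunct1, rule_format]
  note D3 = D[THEN conjunct2, THEN conjunct2, THEN conjunct1, rule_format]
  note D4 = D[THEN conjunct2, THEN conjunct2, THEN conjunct2, THEN conjunct1, rule_format]
  note D5 = D[THEN conjunct2, THEN conjunct2, THEN conjunct2, THEN conjunct2, rule_format]
  show "f \<in> Lp M 2 \<Longrightarrow> P f \<in> Lp M 2" by (rule D1)
  show "f \<in> Lp M 2 \<Longrightarrow> g \<in> Lp M 2 \<Longrightarrow> AE w in M. f w = g w \<Longrightarrow> AE w in M. P f w = P g w" by (rule D2)
  show "f \<in> Lp M 2 \<Longrightarrow> g \<in> Lp M 2 \<Longrightarrow> AE w in M. P (\<lambda>v. a * f v + b * g v) w = a * P f w + b * P g w" by (rule D3)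
  show "f \<in> Lp M 2 \<Longrightarrow> AE w in M. P (P f) w = P f w" by (rule D4)
  show "f \<in> Lp M 2 \<Longrightarrow> g \<in> Lp M 2 \<Longrightarrow> (\<integral>w. P f w * g w \<partial>M) = (\<integral>w. f w * P g w \<partial>M)" by (rule D5)
qed

lemma orth_proj_sq:
  assumes P: "orth_proj M P" and f: "f \<in> Lp M 2"
  shows "(\<integral>w. (P f w)\<^sup>2 \<partial>M) = (\<integral>w. P f w * f w \<partial>M)" "(\<integral>w. (P f w)\<^sup>2 \<partial>M) \<le> (\<integral>w. (f w)\<^sup>2 \<partial>M)"
proof -
  note Pf = orth_projD(1)[OF P f]
  note PPf = orth_projD(1)[OF P Pf]
  note [measurable] = LpD(1)[OF Pf] LpD(1)[OF f] LpD(1)[OF PPf]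
  have "(\<integral>w. P f w * f w \<partial>M) = (\<integral>w. P (P f) w * f w \<partial>M)"
    using orth_projD(4)[OF P f] by (intro integral_cong_AE) auto
  also have "\<dots> = (\<integral>w. P f w * P f w \<partial>M)" by (rule orth_projD(5)[OF P Pf f])
  finally show 1: "(\<integral>w. (P f w)\<^sup>2 \<partial>M) = (\<integral>w. P f w * f w \<partial>M)" by (simp add: power2_eq_square)
  have "0 \<le> (\<integral>w. (f w - P f w)\<^sup>2 \<partial>M)" by auto
  also have "\<dots> = (\<integral>w. ((f w)\<^sup>2 + (P f w)\<^sup>2) - 2 * (P f w * f w) \<partial>M)"
    by (simp add: power2_diff algebra_simps)
  also have "\<dots> = (\<integral>w. (f w)\<^sup>2 \<partial>M) + (\<integral>w. (P f w)\<^sup>2 \<partial>M) - 2 * (\<integral>w. P f w * f w \<partial>M)"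
    using Pf f L2_mult(1)[OF Pf f] by (simp add: Lp_2_iff)
  finally show "(\<integral>w. (P f w)\<^sup>2 \<partial>M) \<le> (\<integral>w. (f w)\<^sup>2 \<partial>M)" using 1 by linarith
qed

lemma orth_proj_appr_bound:
  assumes "prob_space M" and p: "1 < p" and P: "orth_proj M P" "appr M P" and f: "f \<in> Lp M 2" "f \<in> Lp M p"
  shows "P f \<in> Lp M p \<and> Ip M p (P f) \<le> Cp (max p (p / (p - 1))) powr p * Ip M p f"
proof -
  interpret prob_space M by fact
  note Pf = orth_projD(1)[OF P(1) f(1)]
  consider "p > 2" | "p = 2" | "p < 2" by linarith
  then show ?thesis
  proof cases
    case 1
    then have "p * 1 \<le> p * (p - 1)" by (intro mult_left_mono) auto
    then have "max p (p / (p - 1)) = p" using 1 by (intro max_absorb1) (simp add: pos_divide_le_eq)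
    then show ?thesis using appr_bound[OF 1 P(2) f(2) Pf] by simp
  next
    case 2
    \<comment> \<open>At exponent 2 the constant is 1, and an orthogonal projection is a
      contraction.\<close>
    then show ?thesis using orth_proj_sq(2)[OF P(1) f(1)] Pf by (simp add: Cp_def)
  next
    case 3
    define q where "q = p / (p - 1)"
    have q: "2 < q" "1 / p + 1 / q = 1" "p = q / (q - 1)" using p 3 by (auto simp: q_def field_simps)
    have pq: "1 / q = 1 - 1 / p" using q by linarith
    have mx: "max p (p / (p - 1)) = q" unfolding q_def[symmetric] using 3 q(1) by (intro max_absorb2) simp
    define K where "K = Cp q * Ip M p f powr (1 / p)"
    have K: "0 \<le> K" by (simp add: K_def)
    have dual: "(\<integral>w. P f w * g w \<partial>M) \<le> K * Ip M q g powr (1 / q)"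
      if g: "g \<in> borel_measurable M" "\<And>w. \<bar>g w\<bar> \<le> B" for g B
    proof -
      have g2: "g \<in> Lp M 2" "g \<in> Lp M q" using Lp_bounded[OF g] q by auto
      \<comment> \<open>Bounded test functions lie in \<open>L_q\<close> with \<open>q > 2\<close>,
        so the bound above 2 applies to \<open>P g\<close>; self-adjointness transfers it to
        \<open>P f\<close>.\<close>
      note Pg = appr_bound[OF q(1) P(2) g2(2) orth_projD(1)[OF P(1) g2(1)]]
      have "(\<integral>w. P f w * g w \<partial>M) = (\<integral>w. f w * P g w \<partial>M)" by (rule orth_projD(5)[OF P(1) f(1) g2(1)])
      also have "\<dots> \<le> Ip M p f powr (1 / p) * Ip M q (P g) powr (1 / q)"
        using Lp_holder(3)[of p q f M "P g"] p q f Pg by auto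
      also have "\<dots> \<le> Ip M p f powr (1 / p) * (Cp q powr q * Ip M q g) powr (1 / q)"
        using Pg(2) q Ip_nonneg[of M "P g" q] by (intro mult_left_mono powr_mono2) auto
      also have "\<dots> = K * Ip M q g powr (1 / q)"
        using q Ip_nonneg[of M g q] by (simp add: K_def powr_mult powr_powr)
      finally show ?thesis .
    qed
    have *: "P f \<in> Lp M p" "Ip M p (P f) \<le> K powr p"
      using Lp_duality[OF p Pf K] dual unfolding pq unfolding q_def by auto
    then show ?thesis using p Ip_nonneg[of M f p] unfolding mx by (simp add: K_def powr_mult powr_powr)
  qed
qed

text \<open>The invariant of the transfinite recursion. The normalisation of \<open>P\<close> at the
  constant 1 is there for independent sums, where it makes each \<open>P\<close> preserve
  means.\<close>

definition good :: "real \<Rightarrow> 'a measure \<Rightarrow> ('a \<Rightarrow> real) set \<Rightarrow> bool" where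
  "good p M B \<longleftrightarrow> prob_space M \<and> (\<exists>P. orth_proj M P \<and> (AE w in M. P (\<lambda>_. 1) w = 1) \<and> appr M P \<and>
     B = Lp_closure M p (P ` (Lp M 2 \<inter> Lp M p)))"

lemma good_imp_complemented:
  assumes p: "1 < p" and g: "good p M B"
  shows "C_orth_complemented M p (Cp (max p (p / (p - 1)))) B"
proof -
  obtain P where P: "prob_space M" "orth_proj M P" "appr M P" "B = Lp_closure M p (P ` (Lp M 2 \<inter> Lp M p))"
    using g by (auto simp: good_def)
  have "p_C_bounded M p (Cp (max p (p / (p - 1)))) P"
    unfolding p_C_bounded_def using orth_proj_appr_bound[OF P(1) p P(2,3)] p
    by (auto intro!: Lp_norm_leI simp: Cp_def)
  then show ?thesis unfolding C_orth_complemented_def using P by blast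
qed

section \<open>Transport along an embedding\<close>

lemma borel_measurable_embed_iff:
  assumes "inj \<iota>"
  shows "f \<in> borel_measurable (embed_measure M \<iota>) \<longleftrightarrow> (\<lambda>w. f (\<iota> w)) \<in> borel_measurable M"
  by (rule iffI, erule measurable_compose[OF measurable_embed_measure2[OF assms]], erule measurable_embed_measure1)

lemma integral_embed:
  fixes f :: "'b \<Rightarrow> real"
  assumes i: "inj \<iota>"
  shows "(\<integral>z. f z \<partial>embed_measure M \<iota>) = (\<integral>w. f (\<iota> w) \<partial>M)"
    "integrable (embed_measure M \<iota>) f \<longleftrightarrow> integrable M (\<lambda>w. f (\<iota> w))"
proof -
  have *: "f \<in> borel_measurable (embed_measure M \<iota>) \<Longrightarrow> integrable (embed_measure M \<iota>) f \<longleftrightarrow> integrable M (\<lambda>w. f (\<iota> w))"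
    by (subst embed_measure_eq_distr[OF i]) (simp add: integrable_distr_eq measurable_embed_measure2[OF i])
  have **: "f \<in> borel_measurable (embed_measure M \<iota>) \<Longrightarrow> (\<integral>z. f z \<partial>embed_measure M \<iota>) = (\<integral>w. f (\<iota> w) \<partial>M)"
    by (subst embed_measure_eq_distr[OF i]) (simp add: integral_distr measurable_embed_measure2[OF i])
  show 1: "integrable (embed_measure M \<iota>) f \<longleftrightarrow> integrable M (\<lambda>w. f (\<iota> w))"
    using * borel_measurable_embed_iff[OF i, of f M] by (meson borel_measurable_integrable)
  show "(\<integral>z. f z \<partial>embed_measure M \<iota>) = (\<integral>w. f (\<iota> w) \<partial>M)"
  proof (cases "integrable (embed_measure M \<iota>) f")
    case True
    then show ?thesis using ** by auto
  next
    case False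
    then show ?thesis using 1 by (simp add: not_integrable_integral_eq)
  qed
qed

lemma Lp_embed: "inj \<iota> \<Longrightarrow> f \<in> Lp (embed_measure M \<iota>) p \<longleftrightarrow> (\<lambda>w. f (\<iota> w)) \<in> Lp M p"
  by (simp add: Lp_def borel_measurable_embed_iff integral_embed)

lemma prob_space_embed: "inj \<iota> \<Longrightarrow> prob_space M \<Longrightarrow> prob_space (embed_measure M \<iota>)"
  by (metis embed_measure_eq_distr prob_space.prob_space_distr measurable_embed_measure2)

text \<open>Sums are studied on ordinary product spaces and then moved into \<open>pt\<close> by a
  constructor, which conjugates the projection. \<open>inv \<iota>\<close> is arbitrary off the
  range of \<open>\<iota>\<close>, but the image space has no points there.\<close>

lemma good_embed:
  fixes \<iota> :: "'a \<Rightarrow> 'b"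
  assumes i: "inj \<iota>" and p: "1 < p" and g: "good p M B"
  shows "good p (embed_measure M \<iota>) {b. (\<lambda>w. b (\<iota> w)) \<in> B}"
proof -
  let ?N = "embed_measure M \<iota>"
  obtain P where P: "prob_space M" "orth_proj M P" "AE w in M. P (\<lambda>_. 1) w = 1" "appr M P" "B = Lp_closure M p (P ` (Lp M 2 \<inter> Lp M p))"
    using g by (auto simp: good_def)
  have ii: "inv \<iota> (\<iota> w) = w" for w using i by simp
  define Q where "Q f z = P (\<lambda>w. f (\<iota> w)) (inv \<iota> z)" for f :: "'b \<Rightarrow> real" and z
  have Q: "Q f (\<iota> w) = P (\<lambda>w. f (\<iota> w)) w" for f w by (simp add: Q_def ii)
  note E = Lp_embed[OF i] AE_embed_measure[OF i] integral_embed[OF i] Q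
  have o: "orth_proj ?N Q"
    unfolding orth_proj_def E using P(2) unfolding orth_proj_def by (auto simp: E)
  have a: "appr ?N Q"
    unfolding appr_def
  proof (intro ballI allI impI)
    fix f :: "'b \<Rightarrow> real" and e :: real
    assume f: "f \<in> Lp ?N 2" and e: "0 < e"
    then obtain t \<pi> F where t: "tree_map M t \<pi>" "tree_cond M t \<pi> (\<lambda>w. f (\<iota> w)) F"
      "(\<integral>w. (P (\<lambda>w. f (\<iota> w)) w - tproj t F (\<pi> w))\<^sup>2 \<partial>M) < e"
      using P(4) unfolding appr_def E by meson
    show "\<exists>t \<pi> F. tree_map ?N t \<pi> \<and> tree_cond ?N t \<pi> f F \<and> (\<integral>w. (Q f w - tproj t F (\<pi> w))\<^sup>2 \<partial>?N) < e"
    proof (intro exI[of _ t] exI[of _ "\<lambda>z. \<pi> (inv \<iota> z)"] exI[of _ F] conjI)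
      show "tree_map ?N t (\<lambda>z. \<pi> (inv \<iota> z))"
        using t(1) unfolding tree_map_def E by (auto intro!: measurable_embed_measure1 simp: ii)
    qed (use t in \<open>auto simp: tree_cond_def E ii\<close>)
  qed
  have one: "AE z in ?N. Q (\<lambda>_. 1) z = 1" unfolding E by (rule P(3))
  have pos: "0 < p" using p by simp
  have c: "{b. (\<lambda>w. b (\<iota> w)) \<in> B} = Lp_closure ?N p (Q ` (Lp ?N 2 \<inter> Lp ?N p))"
  proof -
    have "(\<exists>f\<in>P ` (Lp M 2 \<inter> Lp M p). Ip M p (\<lambda>w. b (\<iota> w) - f w) < e) \<longleftrightarrow>
       (\<exists>f\<in>Q ` (Lp ?N 2 \<inter> Lp ?N p). Ip ?N p (\<lambda>w. b w - f w) < e)" for b e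
    proof safe
      fix f assume f: "f \<in> Lp M 2" "f \<in> Lp M p" and le: "Ip M p (\<lambda>w. b (\<iota> w) - P f w) < e"
      show "\<exists>f\<in>Q ` (Lp ?N 2 \<inter> Lp ?N p). Ip ?N p (\<lambda>w. b w - f w) < e"
        using f le by (intro bexI[of _ "Q (\<lambda>z. f (inv \<iota> z))"] imageI) (auto simp: E ii)
    next
      fix f assume f: "f \<in> Lp ?N 2" "f \<in> Lp ?N p" and le: "Ip ?N p (\<lambda>w. b w - Q f w) < e"
      show "\<exists>f\<in>P ` (Lp M 2 \<inter> Lp M p). Ip M p (\<lambda>w. b (\<iota> w) - f w) < e"
        using f le by (intro bexI[of _ "P (\<lambda>w. f (\<iota> w))"] imageI) (auto simp: E)
    qed
    then show ?thesis unfolding P(5) set_eq_iff Lp_closure_iff[OF pos] mem_Collect_eq E by blast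
  qed
  show ?thesis unfolding good_def using prob_space_embed[OF i P(1)] o a one c by blast
qed

section \<open>Constants and disjoint sums\<close>

lemma (in prob_space) integral_abs_le_Ip:
  assumes p: "1 < p" and f: "f \<in> Lp M p"
  shows "(\<integral>w. \<bar>f w\<bar> \<partial>M) \<le> Ip M p f powr (1 / p)" "integrable M f"
proof -
  define q where "q = p / (p - 1)"
  have q: "1 < q" "1 / p + 1 / q = 1" using p by (auto simp: q_def field_simps)
  show "(\<integral>w. \<bar>f w\<bar> \<partial>M) \<le> Ip M p f powr (1 / p)" "integrable M f"
    using Lp_holder(1,2)[OF p q f Lp_const[of q 1]] q by (simp_all add: prob_space)
qed

text \<open>The projection is the mean, which the one-point tree reproduces without error. What
  remains is that an \<open>L_p\<close> limit of constants is almost surely constant.\<close>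

lemma good_constants:
  assumes M: "prob_space M" and p: "1 < p"
  shows "good p M {f \<in> Lp M p. \<exists>c. AE w in M. f w = c}"
proof -
  interpret prob_space M by fact
  define P :: "('a \<Rightarrow> real) \<Rightarrow> 'a \<Rightarrow> real" where "P f w = (\<integral>v. f v \<partial>M)" for f w
  have o: "orth_proj M P"
    unfolding orth_proj_def P_def
  proof (intro conjI ballI allI impI)
    fix f g :: "'a \<Rightarrow> real" assume f: "f \<in> Lp M 2" and g: "g \<in> Lp M 2" and e: "AE w in M. f w = g w"
    then have "(\<integral>v. f v \<partial>M) = (\<integral>v. g v \<partial>M)" using LpD(1)[OF f] LpD(1)[OF g] by (intro integral_cong_AE) auto
    then show "AE w in M. (\<integral>v. f v \<partial>M) = (\<integral>v. g v \<partial>M)" by simp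
  next
    fix f g :: "'a \<Rightarrow> real" and a b :: real assume f: "f \<in> Lp M 2" and g: "g \<in> Lp M 2"
    then show "AE w in M. (\<integral>v. a * f v + b * g v \<partial>M) = a * (\<integral>v. f v \<partial>M) + b * (\<integral>v. g v \<partial>M)"
      using L2_integrable[OF f] L2_integrable[OF g] by simp
  qed (auto simp: prob_space)
  have a: "appr M P"
    unfolding appr_def
  proof (intro ballI allI impI)
    fix f :: "'a \<Rightarrow> real" and e :: real assume "f \<in> Lp M 2" "0 < e"
    then show "\<exists>t \<pi> F. tree_map M t \<pi> \<and> tree_cond M t \<pi> f F \<and> (\<integral>w. (P f w - tproj t F (\<pi> w))\<^sup>2 \<partial>M) < e"
      by (intro exI[of _ TPt] exI[of _ "\<lambda>_. PUnit"] exI[of _ "\<lambda>_. \<integral>v. f v \<partial>M"])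
         (auto simp: tree_map_def tree_cond_def P_def prob_space)
  qed
  have c: "{f \<in> Lp M p. \<exists>c. AE w in M. f w = c} = Lp_closure M p (P ` (Lp M 2 \<inter> Lp M p))"
  proof (intro set_eqI iffI)
    fix f assume "f \<in> {f \<in> Lp M p. \<exists>c. AE w in M. f w = c}"
    then obtain c where f: "f \<in> Lp M p" "AE w in M. f w = c" by auto
    note [measurable] = LpD(1)[OF f(1)]
    have "AE w in M. f w - c = 0" using f(2) by eventually_elim simp
    from Ip_cong_AE[OF this, of p] have "Ip M p (\<lambda>w. f w - c) = 0" using p by simp
    moreover have "(\<lambda>w. c) \<in> P ` (Lp M 2 \<inter> Lp M p)"
      using p by (intro image_eqI[of _ _ "\<lambda>w. c"]) (auto simp: P_def prob_space)
    ultimately have "\<exists>g\<in>P ` (Lp M 2 \<inter> Lp M p). Ip M p (\<lambda>w. f w - g w) < e" if "0 < e" for e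
      using that by (intro bexI[of _ "\<lambda>w. c"]) auto
    then show "f \<in> Lp_closure M p (P ` (Lp M 2 \<inter> Lp M p))"
      using p f(1) by (subst Lp_closure_iff) simp_all
  next
    fix f assume "f \<in> Lp_closure M p (P ` (Lp M 2 \<inter> Lp M p))"
    then have f: "f \<in> Lp M p" and ap: "\<And>e. e > 0 \<Longrightarrow> \<exists>g\<in>P ` (Lp M 2 \<inter> Lp M p). Ip M p (\<lambda>w. f w - g w) < e"
      using p by (auto simp: Lp_closure_iff)
    \<comment> \<open>The natural candidate: by Hoelder's inequality, the mean of \<open>f\<close>
      is as close to an approximating constant as \<open>f\<close> itself is.\<close>
    define c where "c = (\<integral>v. f v \<partial>M)"
    have K: "(\<lambda>_. c) \<in> Lp M p" using p by simp
    have le: "Ip M p (\<lambda>w. f w - c) \<le> 2 powr p * (2 * e)" if e: "e > 0" for e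
    proof -
      obtain b where b: "Ip M p (\<lambda>w. f w - b) < e" using ap[OF e] by (auto simp: P_def)
      have bL: "(\<lambda>_. b) \<in> Lp M p" using p by simp
      have fb: "(\<lambda>w. f w - b) \<in> Lp M p" by (rule Lp_diff(1)[OF _ f bL]) (use p in auto)
      have "\<bar>c - b\<bar> = \<bar>\<integral>w. f w - b \<partial>M\<bar>" using integral_abs_le_Ip(2)[OF p f] by (simp add: c_def prob_space)
      also have "\<dots> \<le> (\<integral>w. \<bar>f w - b\<bar> \<partial>M)" by (rule integral_abs_bound)
      also have "\<dots> \<le> Ip M p (\<lambda>w. f w - b) powr (1 / p)" by (rule integral_abs_le_Ip[OF p fb])
      finally have "\<bar>c - b\<bar> powr p \<le> (Ip M p (\<lambda>w. f w - b) powr (1 / p)) powr p" using p by (intro powr_mono2[of p]) auto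
      also have "\<dots> = Ip M p (\<lambda>w. f w - b)" using p Ip_nonneg[of M "\<lambda>w. f w - b" p] by (simp add: powr_powr)
      finally have cb: "\<bar>b - c\<bar> powr p \<le> e" using b by (simp add: abs_minus_commute)
      have "Ip M p (\<lambda>w. f w - c) \<le> 2 powr p * (Ip M p (\<lambda>w. f w - b) + Ip M p (\<lambda>w. b - c))"
        using Lp_triangle[OF _ f bL K] p by simp
      also have "\<dots> \<le> 2 powr p * (e + e)" using b cb by (intro mult_left_mono add_mono) (auto simp: prob_space)
      finally show ?thesis by simp
    qed
    have "Ip M p (\<lambda>w. f w - c) \<le> 0"
    proof (rule field_le_epsilon)
      fix e :: real assume "0 < e"
      then show "Ip M p (\<lambda>w. f w - c) \<le> 0 + e" using le[of "e / (2 powr p * 2)"] by simp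
    qed
    then have 0: "Ip M p (\<lambda>w. f w - c) = 0" using Ip_nonneg[of M "\<lambda>w. f w - c" p] by linarith
    have "integrable M (\<lambda>w. \<bar>f w - c\<bar> powr p)" using LpD(2)[OF Lp_diff(1)[OF _ f K]] p by simp
    from integral_nonneg_eq_0_iff_AE[OF this] 0 have "AE w in M. \<bar>f w - c\<bar> powr p = 0" by simp
    then have "AE w in M. f w = c" by eventually_elim simp
    then show "f \<in> {f \<in> Lp M p. \<exists>c. AE w in M. f w = c}" using f by auto
  qed
  show ?thesis unfolding good_def using M o a c by (auto simp: P_def[abs_def] prob_space)
qed

section \<open>Products with a fair coin\<close>

lemma sets_coin [simp]: "sets coin = UNIV" and space_coin [simp]: "space coin = UNIV"
  by (auto simp: coin_def)

lemma prob_space_coin: "prob_space coin"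
  unfolding coin_def by (rule prob_space_measure_pmf)

text \<open>The product with a coin is two copies of \<open>M\<close> of half mass. This lemma and
  the next ones translate measurability, integrals and almost sure statements to the two
  sections.\<close>

lemma measurable_pair_coin_iff:
  "f \<in> measurable (M \<Otimes>\<^sub>M coin) K \<longleftrightarrow> (\<forall>b. (\<lambda>w. f (w, b)) \<in> measurable M K)"
proof safe
  fix b assume "f \<in> measurable (M \<Otimes>\<^sub>M coin) K"
  then show "(\<lambda>w. f (w, b)) \<in> measurable M K"
    by (rule measurable_compose[rotated]) (intro measurable_Pair measurable_ident_sets measurable_const; simp)
next
  assume *: "\<forall>b. (\<lambda>w. f (w, b)) \<in> measurable M K"
  have "{z \<in> space (M \<Otimes>\<^sub>M coin). snd z} = snd -` {True} \<inter> space (M \<Otimes>\<^sub>M coin)" by auto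
  also have "\<dots> \<in> sets (M \<Otimes>\<^sub>M coin)" by (rule measurable_sets[OF measurable_snd]) simp
  finally have "(\<lambda>z. if snd z then f (fst z, True) else f (fst z, False)) \<in> measurable (M \<Otimes>\<^sub>M coin) K"
    using * by (intro measurable_If measurable_compose[OF measurable_fst, of "\<lambda>w. f (w, True)"]
        measurable_compose[OF measurable_fst, of "\<lambda>w. f (w, False)"]) auto
  also have "(\<lambda>z. if snd z then f (fst z, True) else f (fst z, False)) = f"
  proof
    fix z show "(if snd z then f (fst z, True) else f (fst z, False)) = f z" by (cases z) auto
  qed
  finally show "f \<in> measurable (M \<Otimes>\<^sub>M coin) K" .
qed

context prob_space
begin

lemma nn_integral_pair_coin:
  assumes "f \<in> borel_measurable (M \<Otimes>\<^sub>M coin)"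
  shows "(\<integral>\<^sup>+z. f z \<partial>(M \<Otimes>\<^sub>M coin)) = ((\<integral>\<^sup>+w. f (w, False) \<partial>M) + (\<integral>\<^sup>+w. f (w, True) \<partial>M)) / 2"
proof -
  interpret C: prob_space coin by (rule prob_space_coin)
  interpret pair_sigma_finite M coin ..
  have "(\<integral>\<^sup>+z. f z \<partial>(M \<Otimes>\<^sub>M coin)) = (\<integral>\<^sup>+b. (\<integral>\<^sup>+w. f (w, b) \<partial>M) \<partial>coin)"
    using nn_integral_snd[OF assms] by simp
  also have "\<dots> = ((\<integral>\<^sup>+w. f (w, False) \<partial>M) + (\<integral>\<^sup>+w. f (w, True) \<partial>M)) / 2"
    unfolding coin_def by (subst nn_integral_pmf_of_set) (auto simp: UNIV_bool)
  finally show ?thesis .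
qed

lemma integrable_pair_coin_iff:
  fixes f :: "'a \<times> bool \<Rightarrow> real"
  shows "integrable (M \<Otimes>\<^sub>M coin) f \<longleftrightarrow> (\<forall>b. integrable M (\<lambda>w. f (w, b)))"
proof (cases "f \<in> borel_measurable (M \<Otimes>\<^sub>M coin)")
  case True
  have "(\<integral>\<^sup>+z. ennreal (norm (f z)) \<partial>(M \<Otimes>\<^sub>M coin)) < \<infinity> \<longleftrightarrow>
      (\<integral>\<^sup>+w. ennreal (norm (f (w, False))) \<partial>M) < \<infinity> \<and> (\<integral>\<^sup>+w. ennreal (norm (f (w, True))) \<partial>M) < \<infinity>"
    using True by (subst nn_integral_pair_coin) (auto simp: ennreal_divide_eq_top_iff top.not_eq_extremum[symmetric])
  then show ?thesis using True measurable_pair_coin_iff[of f M borel]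
    by (auto simp: integrable_iff_bounded all_bool_eq)
next
  case False
  then show ?thesis using measurable_pair_coin_iff[of f M borel] by (metis borel_measurable_integrable)
qed

lemma integral_pair_coin:
  fixes f :: "'a \<times> bool \<Rightarrow> real"
  assumes "\<And>b. integrable M (\<lambda>w. f (w, b))"
  shows "(\<integral>z. f z \<partial>(M \<Otimes>\<^sub>M coin)) = ((\<integral>w. f (w, False) \<partial>M) + (\<integral>w. f (w, True) \<partial>M)) / 2"
proof -
  interpret C: prob_space coin by (rule prob_space_coin)
  interpret pair_sigma_finite M coin ..
  have "integrable (M \<Otimes>\<^sub>M coin) f" using assms integrable_pair_coin_iff by blast
  then have "(\<integral>z. f z \<partial>(M \<Otimes>\<^sub>M coin)) = (\<integral>b. (\<integral>w. f (w, b) \<partial>M) \<partial>coin)"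
    using integral_snd[of "\<lambda>w b. f (w, b)"] by simp
  also have "\<dots> = ((\<integral>w. f (w, False) \<partial>M) + (\<integral>w. f (w, True) \<partial>M)) / 2"
    unfolding coin_def by (subst integral_pmf_of_set) (auto simp: UNIV_bool)
  finally show ?thesis .
qed

text \<open>\<open>Q\<close> is an arbitrary predicate, so the argument moves measurable null sets
  that cover its failures, not the failure set itself.\<close>

lemma AE_pair_coin_iff: "(AE z in M \<Otimes>\<^sub>M coin. Q z) \<longleftrightarrow> (\<forall>b. AE w in M. Q (w, b))"
proof
  assume "AE z in M \<Otimes>\<^sub>M coin. Q z"
  then obtain A where A: "{z \<in> space (M \<Otimes>\<^sub>M coin). \<not> Q z} \<subseteq> A" "A \<in> sets (M \<Otimes>\<^sub>M coin)" "emeasure (M \<Otimes>\<^sub>M coin) A = 0"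
    by (elim AE_E) auto
  have im: "(indicator A :: _ \<Rightarrow> ennreal) \<in> borel_measurable (M \<Otimes>\<^sub>M coin)" using A(2) by simp
  have "0 = (\<integral>\<^sup>+z. indicator A z \<partial>(M \<Otimes>\<^sub>M coin))" using A by simp
  also have "\<dots> = ((\<integral>\<^sup>+w. indicator A (w, False) \<partial>M) + (\<integral>\<^sup>+w. indicator A (w, True) \<partial>M)) / 2"
    by (rule nn_integral_pair_coin[OF im])
  finally have "(\<integral>\<^sup>+w. indicator A (w, b) \<partial>M) = 0" for b
    by (cases b) (auto simp: ennreal_divide_eq_0_iff)
  moreover have "(\<lambda>w. indicator A (w, b) :: ennreal) \<in> borel_measurable M" for b
    using im unfolding measurable_pair_coin_iff by auto
  ultimately have "AE w in M. (indicator A (w, b) :: ennreal) = 0" for b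
    by (subst (asm) nn_integral_0_iff_AE) auto
  then have ae: "AE w in M. (w, b) \<notin> A" for b by (auto simp: indicator_eq_0_iff)
  show "\<forall>b. AE w in M. Q (w, b)"
  proof
    fix b show "AE w in M. Q (w, b)" using ae[of b] AE_space
    proof eventually_elim
      fix w assume "(w, b) \<notin> A" "w \<in> space M"
      then show "Q (w, b)" using A(1) by (auto simp: space_pair_measure)
    qed
  qed
next
  assume *: "\<forall>b. AE w in M. Q (w, b)"
  then have "\<exists>A. {w \<in> space M. \<not> Q (w, b)} \<subseteq> A \<and> A \<in> sets M \<and> emeasure M A = 0" for b
  proof -
    from * have "AE w in M. Q (w, b)" by auto
    then obtain N where "{w \<in> space M. \<not> Q (w, b)} \<subseteq> N" "emeasure M N = 0" "N \<in> sets M" by (rule AE_E)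
    then show ?thesis by (intro exI[of _ N]) simp
  qed
  then obtain A where A: "\<And>b. {w \<in> space M. \<not> Q (w, b)} \<subseteq> A b" "\<And>b. A b \<in> sets M" "\<And>b. emeasure M (A b) = 0"
    by metis
  interpret C: prob_space coin by (rule prob_space_coin)
  have n: "(A b \<times> {b}) \<in> null_sets (M \<Otimes>\<^sub>M coin)" for b
    using A by (intro null_setsI) (auto simp: C.emeasure_pair_measure_Times)
  show "AE z in M \<Otimes>\<^sub>M coin. Q z"
  proof (rule AE_I')
    show "(A False \<times> {False}) \<union> (A True \<times> {True}) \<in> null_sets (M \<Otimes>\<^sub>M coin)" using n by auto
    show "{z \<in> space (M \<Otimes>\<^sub>M coin). \<not> Q z} \<subseteq> (A False \<times> {False}) \<union> (A True \<times> {True})"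
    proof
      fix z assume z: "z \<in> {z \<in> space (M \<Otimes>\<^sub>M coin). \<not> Q z}"
      obtain w b where [simp]: "z = (w, b)" by (cases z)
      have "w \<in> A b" using z A(1)[of b] by (auto simp: space_pair_measure)
      then show "z \<in> (A False \<times> {False}) \<union> (A True \<times> {True})" by (cases b) auto
    qed
  qed
qed

lemma Lp_pair_coin_iff: "f \<in> Lp (M \<Otimes>\<^sub>M coin) p \<longleftrightarrow> (\<forall>b. (\<lambda>w. f (w, b)) \<in> Lp M p)"
  by (auto simp: Lp_def measurable_pair_coin_iff integrable_pair_coin_iff)

end

text \<open>The projection acts on each half separately. The trees found for the two halves are
  joined by \<open>TDisj\<close>, and the squared error is the average of the two errors.\<close>

lemma good_disjoint:
  fixes B :: "('a \<Rightarrow> real) set"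
  assumes p: "1 < p" and g: "good p M B"
  shows "good p (M \<Otimes>\<^sub>M coin) {b \<in> Lp (M \<Otimes>\<^sub>M coin) p. \<exists>b0\<in>B. \<exists>b1\<in>B.
     AE z in M \<Otimes>\<^sub>M coin. b z = (if snd z then b1 (fst z) else b0 (fst z))}"
proof -
  let ?N = "M \<Otimes>\<^sub>M coin"
  obtain P where M: "prob_space M" and P: "orth_proj M P" "AE w in M. P (\<lambda>_. 1) w = 1" "appr M P" 
    and B: "B = Lp_closure M p (P ` (Lp M 2 \<inter> Lp M p))"
    using g by (auto simp: good_def)
  interpret prob_space M by fact
  interpret C: prob_space coin by (rule prob_space_coin)
  interpret N: pair_prob_space M coin ..
  have N: "prob_space ?N" by (rule N.prob_space_axioms)
  define Q where "Q f z = P (\<lambda>w. f (w, snd z)) (fst z)" for f :: "'a \<times> bool \<Rightarrow> real" and z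
  have Q: "Q f (w, b) = P (\<lambda>w. f (w, b)) w" for f w b by (simp add: Q_def)
  have Ipp: "Ip ?N p f = (Ip M p (\<lambda>w. f (w, False)) + Ip M p (\<lambda>w. f (w, True))) / 2"
    if "f \<in> Lp ?N p" for f p
    using that by (subst integral_pair_coin) (auto simp: Lp_pair_coin_iff LpD)
  have Qp: "Q f \<in> Lp ?N 2" if "f \<in> Lp ?N 2" for f
    using that orth_projD(1)[OF P(1)] by (simp add: Lp_pair_coin_iff Q)
  have QL: "Q f \<in> Lp ?N p" if "f \<in> Lp ?N 2" "f \<in> Lp ?N p" for f
    using that orth_proj_appr_bound[OF M p P(1,3)] by (simp add: Lp_pair_coin_iff Q)
  have o: "orth_proj ?N Q"
    unfolding orth_proj_def
  proof (intro conjI ballI allI impI)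
    fix f g :: "'a \<times> bool \<Rightarrow> real" assume f: "f \<in> Lp ?N 2" and g: "g \<in> Lp ?N 2"
    have fb: "(\<lambda>w. f (w, b)) \<in> Lp M 2" and gb: "(\<lambda>w. g (w, b)) \<in> Lp M 2" for b
      using f g by (auto simp: Lp_pair_coin_iff)
    note Pf = orth_projD(1)[OF P(1) fb] and Pg = orth_projD(1)[OF P(1) gb]
    show "AE w in ?N. Q f w = Q g w" if "AE w in ?N. f w = g w"
      using that orth_projD(2)[OF P(1) fb gb] unfolding AE_pair_coin_iff Q by auto
    show "AE w in ?N. Q (\<lambda>v. a * f v + b * g v) w = a * Q f w + b * Q g w" for a b
      using orth_projD(3)[OF P(1) fb gb] unfolding AE_pair_coin_iff Q by auto
    show "(\<integral>w. Q f w * g w \<partial>?N) = (\<integral>w. f w * Q g w \<partial>?N)"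
      by (subst (1 2) integral_pair_coin) (auto simp: Q L2_mult(1)[OF Pf gb] L2_mult(1)[OF fb Pg] orth_projD(5)[OF P(1) fb gb])
    show "Q f \<in> Lp ?N 2" by (rule Qp[OF f])
    show "AE w in ?N. Q (Q f) w = Q f w"
      using orth_projD(4)[OF P(1) fb] unfolding AE_pair_coin_iff Q by auto
  qed
  have a: "appr ?N Q"
    unfolding appr_def
  proof (intro ballI allI impI)
    fix f :: "'a \<times> bool \<Rightarrow> real" and e :: real assume f: "f \<in> Lp ?N 2" and e: "0 < e"
    have fb: "(\<lambda>w. f (w, b)) \<in> Lp M 2" for b using f by (auto simp: Lp_pair_coin_iff)
    obtain t0 \<pi>0 F0 where t0: "tree_map M t0 \<pi>0" "tree_cond M t0 \<pi>0 (\<lambda>w. f (w, False)) F0"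
      "(\<integral>w. (P (\<lambda>w. f (w, False)) w - tproj t0 F0 (\<pi>0 w))\<^sup>2 \<partial>M) < e"
      using P(3) fb e unfolding appr_def by meson
    obtain t1 \<pi>1 F1 where t1: "tree_map M t1 \<pi>1" "tree_cond M t1 \<pi>1 (\<lambda>w. f (w, True)) F1"
      "(\<integral>w. (P (\<lambda>w. f (w, True)) w - tproj t1 F1 (\<pi>1 w))\<^sup>2 \<partial>M) < e"
      using P(3) fb e unfolding appr_def by meson
    define t where "t = TDisj t0 t1"
    define \<pi> where "\<pi> z = (if snd z then PRight (\<pi>1 (fst z)) else PLeft (\<pi>0 (fst z)))" for z
    define F where "F z = (case z of PLeft x \<Rightarrow> F0 x | PRight x \<Rightarrow> F1 x | _ \<Rightarrow> 0)" for z
    have m: "tree_map ?N t \<pi>"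
      unfolding tree_map_def
    proof (intro conjI allI)
      have "(\<lambda>w. \<pi> (w, b)) \<in> measurable M (count_space (tset t))" for b
        using measurable_compose[OF tree_mapD(1)[OF t0(1)], of PLeft "count_space (tset t)"]
          measurable_compose[OF tree_mapD(1)[OF t1(1)], of PRight "count_space (tset t)"]
        by (cases b) (auto simp: \<pi>_def t_def)
      then show "\<pi> \<in> measurable ?N (count_space (tset t))" by (simp add: measurable_pair_coin_iff)
      fix h :: "fpoint \<Rightarrow> real"
      have "integrable M (\<lambda>w. h (\<pi> (w, b)))" for b
        using L2_integrable[OF tree_map_Lp[OF t0(1), of 2 "\<lambda>x. h (PLeft x)"]]
          L2_integrable[OF tree_map_Lp[OF t1(1), of 2 "\<lambda>x. h (PRight x)"]] by (cases b) (auto simp: \<pi>_def)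
      then show "(\<integral>z. h (\<pi> z) \<partial>?N) = texp t h"
        using tree_mapD(2)[OF t0(1), of "\<lambda>x. h (PLeft x)"] tree_mapD(2)[OF t1(1), of "\<lambda>x. h (PRight x)"]
        by (subst integral_pair_coin) (auto simp: \<pi>_def t_def)
    qed
    have c: "tree_cond ?N t \<pi> f F"
      unfolding tree_cond_def
    proof
      fix h :: "fpoint \<Rightarrow> real"
      have "integrable M (\<lambda>w. f (w, b) * h (\<pi> (w, b)))" for b
        using L2_mult(1)[OF fb tree_map_Lp[OF t0(1), of 2 "\<lambda>x. h (PLeft x)"]]
          L2_mult(1)[OF fb tree_map_Lp[OF t1(1), of 2 "\<lambda>x. h (PRight x)"]] by (cases b) (auto simp: \<pi>_def)
      then show "(\<integral>w. f w * h (\<pi> w) \<partial>?N) = texp t (\<lambda>x. F x * h x)"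
        using t0(2)[unfolded tree_cond_def, rule_format, of "\<lambda>x. h (PLeft x)"]
          t1(2)[unfolded tree_cond_def, rule_format, of "\<lambda>x. h (PRight x)"]
        by (subst integral_pair_coin) (auto simp: \<pi>_def t_def F_def)
    qed
    have d: "(\<integral>z. (Q f z - tproj t F (\<pi> z))\<^sup>2 \<partial>?N) < e"
    proof -
      have "(\<lambda>w. P (\<lambda>w. f (w, b)) w - g w) \<in> Lp M 2" if "g \<in> Lp M 2" for b g
        using Lp_diff(1)[OF _ orth_projD(1)[OF P(1) fb[of b]] that] by simp
      from this[OF tree_map_Lp[OF t0(1)]] this[OF tree_map_Lp[OF t1(1)]]
      have "integrable M (\<lambda>w. (Q f (w, b) - tproj t F (\<pi> (w, b)))\<^sup>2)" for b
        by (cases b) (auto simp: Lp_2_iff Q \<pi>_def t_def F_def)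
      then show ?thesis using t0(3) t1(3) by (subst integral_pair_coin) (auto simp: Q \<pi>_def t_def F_def)
    qed
    show "\<exists>t \<pi> F. tree_map ?N t \<pi> \<and> tree_cond ?N t \<pi> f F \<and> (\<integral>w. (Q f w - tproj t F (\<pi> w))\<^sup>2 \<partial>?N) < e"
      using m c d by blast
  qed
  have one: "AE z in ?N. Q (\<lambda>_. 1) z = 1" using P(2) by (simp add: AE_pair_coin_iff Q)
  have pos: "0 < p" using p by simp
  have cl: "{b \<in> Lp ?N p. \<exists>b0\<in>B. \<exists>b1\<in>B.
     AE z in ?N. b z = (if snd z then b1 (fst z) else b0 (fst z))} = Lp_closure ?N p (Q ` (Lp ?N 2 \<inter> Lp ?N p))"
    (is "?A = ?C")
  proof (intro set_eqI iffI)
    fix b assume "b \<in> ?A"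
    then obtain b0 b1 where b: "b \<in> Lp ?N p" "b0 \<in> B" "b1 \<in> B"
      and ae: "AE w in M. b (w, False) = b0 w" "AE w in M. b (w, True) = b1 w"
      by (auto simp: AE_pair_coin_iff all_bool_eq)
    have "\<exists>f\<in>Q ` (Lp ?N 2 \<inter> Lp ?N p). Ip ?N p (\<lambda>w. b w - f w) < e" if e: "0 < e" for e
    proof -
      obtain f0 where f0: "f0 \<in> Lp M 2" "f0 \<in> Lp M p" "Ip M p (\<lambda>w. b0 w - P f0 w) < e"
        using b(2) e unfolding B Lp_closure_iff[OF pos] by auto
      obtain f1 where f1: "f1 \<in> Lp M 2" "f1 \<in> Lp M p" "Ip M p (\<lambda>w. b1 w - P f1 w) < e"
        using b(3) e unfolding B Lp_closure_iff[OF pos] by auto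
      define f where "f z = (if snd z then f1 (fst z) else f0 (fst z))" for z
      have f: "f \<in> Lp ?N 2" "f \<in> Lp ?N p"
        using f0 f1 by (auto simp: Lp_pair_coin_iff f_def all_bool_eq)
      have bL: "b0 \<in> Lp M p" "b1 \<in> Lp M p" using b(2,3) unfolding B Lp_closure_iff[OF pos] by auto
      have bb: "(\<lambda>w. b (w, c)) \<in> Lp M p" for c using b(1) by (simp add: Lp_pair_coin_iff)
      have Pm: "P f0 \<in> borel_measurable M" "P f1 \<in> borel_measurable M"
        using LpD(1)[OF orth_projD(1)[OF P(1)]] f0 f1 by auto
      have "Ip M p (\<lambda>w. b (w, False) - P f0 w) = Ip M p (\<lambda>w. b0 w - P f0 w)"
        using ae(1) LpD(1)[OF bL(1)] LpD(1)[OF bb] Pm by (intro Ip_cong_AE) auto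
      moreover have "Ip M p (\<lambda>w. b (w, True) - P f1 w) = Ip M p (\<lambda>w. b1 w - P f1 w)"
        using ae(2) LpD(1)[OF bL(2)] LpD(1)[OF bb] Pm by (intro Ip_cong_AE) auto
      moreover have "(\<lambda>w. b w - Q f w) \<in> Lp ?N p"
        by (rule Lp_diff(1)[OF pos b(1) QL[OF f]])
      ultimately have "Ip ?N p (\<lambda>w. b w - Q f w) < e"
        using f0(3) f1(3) by (subst Ipp) (auto simp: Q f_def)
      then show ?thesis using f by blast
    qed
    then show "b \<in> ?C" using b(1) by (simp only: Lp_closure_iff[OF pos]) blast
  next
    fix b assume "b \<in> ?C"
    then have b: "b \<in> Lp ?N p" and ap: "\<And>e. e > 0 \<Longrightarrow> \<exists>f\<in>Q ` (Lp ?N 2 \<inter> Lp ?N p). Ip ?N p (\<lambda>w. b w - f w) < e"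
      unfolding Lp_closure_iff[OF pos] by auto
    have bB: "(\<lambda>w. b (w, c)) \<in> B" for c
      unfolding B Lp_closure_iff[OF pos]
    proof (intro conjI allI impI)
      show "(\<lambda>w. b (w, c)) \<in> Lp M p" using b by (simp add: Lp_pair_coin_iff)
      fix e :: real assume e: "0 < e"
      then obtain f where f: "f \<in> Lp ?N 2" "f \<in> Lp ?N p" "Ip ?N p (\<lambda>w. b w - Q f w) < e / 2"
        using ap[of "e / 2"] by auto
      have "(\<lambda>w. b w - Q f w) \<in> Lp ?N p" by (rule Lp_diff(1)[OF pos b QL[OF f(1,2)]])
      from Ipp[OF this] f(3)
      have "Ip M p (\<lambda>w. b (w, False) - P (\<lambda>w. f (w, False)) w) + Ip M p (\<lambda>w. b (w, True) - P (\<lambda>w. f (w, True)) w) < e"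
        by (simp add: Q)
      then have "Ip M p (\<lambda>w. b (w, False) - P (\<lambda>w. f (w, False)) w) < e" "Ip M p (\<lambda>w. b (w, True) - P (\<lambda>w. f (w, True)) w) < e"
        using Ip_nonneg[of M "\<lambda>w. b (w, False) - P (\<lambda>w. f (w, False)) w" p] Ip_nonneg[of M "\<lambda>w. b (w, True) - P (\<lambda>w. f (w, True)) w" p]
        by linarith+
      then have "Ip M p (\<lambda>w. b (w, c) - P (\<lambda>w. f (w, c)) w) < e" by (cases c) simp_all
      moreover have "(\<lambda>w. f (w, c)) \<in> Lp M 2 \<inter> Lp M p" using f by (simp add: Lp_pair_coin_iff)
      ultimately show "\<exists>g\<in>P ` (Lp M 2 \<inter> Lp M p). Ip M p (\<lambda>w. b (w, c) - g w) < e" by blast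
    qed
    show "b \<in> ?A" using b
      by (intro CollectI conjI bexI[OF _ bB[of False]] bexI[OF _ bB[of True]]) (auto simp: AE_pair_coin_iff)
  qed
  show ?thesis unfolding good_def using N o a one cl by blast
qed

section \<open>Independent sums\<close>

locale ind_sum =
  fixes I :: "nat set" and M :: "nat \<Rightarrow> 'a measure" and P :: "nat \<Rightarrow> ('a \<Rightarrow> real) \<Rightarrow> 'a \<Rightarrow> real"
  assumes M: "\<And>i. i \<in> I \<Longrightarrow> prob_space (M i)"
    and P: "\<And>i. i \<in> I \<Longrightarrow> orth_proj (M i) (P i)"
    and P1: "\<And>i. i \<in> I \<Longrightarrow> AE w in M i. P i (\<lambda>_. 1) w = 1"
    and Pa: "\<And>i. i \<in> I \<Longrightarrow> appr (M i) (P i)"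
begin

abbreviation N :: "(nat \<Rightarrow> 'a) measure" where "N \<equiv> PiM I M"

lemma prob_space_N: "prob_space N"
  using M by (rule prob_space_PiM)

sublocale prob_space N
  by (rule prob_space_N)

text \<open>The conditional expectation given the coordinate \<open>i\<close>.\<close>
definition sec :: "nat \<Rightarrow> ((nat \<Rightarrow> 'a) \<Rightarrow> real) \<Rightarrow> 'a \<Rightarrow> real" where
  "sec i f w = (\<integral>z. f (z(i := w)) \<partial>N)"

text \<open>Overwriting coordinate \<open>i\<close> by an independent copy preserves the product
  measure. Fubini for a single coordinate follows without splitting the index set.\<close>

lemma distr_upd:
  assumes i: "i \<in> I"
  shows "distr (M i \<Otimes>\<^sub>M N) N (\<lambda>(w, z). z(i := w)) = N"
  using distr_pair_PiM_eq_PiM[of I M i, OF M M[OF i]] unfolding insert_absorb[OF i] .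

lemma measurable_upd: "i \<in> I \<Longrightarrow> (\<lambda>(w, z). z(i := w)) \<in> measurable (M i \<Otimes>\<^sub>M N) N"
proof -
  assume i: "i \<in> I"
  have "(\<lambda>(w, z). z(i := w)) \<in> measurable (M i \<Otimes>\<^sub>M N) (PiM (insert i I) M)" by measurable
  then show ?thesis using i by (simp add: insert_absorb)
qed

lemma measurable_coord: "i \<in> I \<Longrightarrow> (\<lambda>z. z i) \<in> measurable N (M i)"
  by (rule measurable_component_singleton)

lemma integral_sec:
  assumes i: "i \<in> I" and f: "integrable N f"
  shows "integrable (M i) (sec i f)" "(\<integral>z. f z \<partial>N) = (\<integral>w. sec i f w \<partial>M i)"
    "AE w in M i. integrable N (\<lambda>z. f (z(i := w)))"
proof -
  interpret Mi: prob_space "M i" by (rule M[OF i])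
  interpret pair_sigma_finite "M i" N ..
  have int: "integrable (M i \<Otimes>\<^sub>M N) (\<lambda>(w, z). f (z(i := w)))"
    using integrable_distr[OF measurable_upd[OF i], of f] f distr_upd[OF i] by (simp add: split_def)
  have "(\<integral>z. f z \<partial>N) = (\<integral>x. f ((\<lambda>(w, z). z(i := w)) x) \<partial>(M i \<Otimes>\<^sub>M N))"
    using integral_distr[OF measurable_upd[OF i], of f] f distr_upd[OF i] by simp
  also have "\<dots> = (\<integral>w. sec i f w \<partial>M i)"
    using integral_fst[OF int] by (simp add: sec_def split_def)
  finally show "(\<integral>z. f z \<partial>N) = (\<integral>w. sec i f w \<partial>M i)" .
  show "integrable (M i) (sec i f)" using integrable_fst[OF int] by (simp add: sec_def[abs_def])
  show "AE w in M i. integrable N (\<lambda>z. f (z(i := w)))" using AE_integrable_fst[OF int] by simp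
qed

lemma measurable_section:
  assumes i: "i \<in> I" and f: "f \<in> borel_measurable N" and w: "w \<in> space (M i)"
  shows "(\<lambda>z. f (z(i := w))) \<in> borel_measurable N"
proof -
  have "(\<lambda>z. (w, z)) \<in> measurable N (M i \<Otimes>\<^sub>M N)" using w by measurable
  from measurable_compose[OF measurable_compose[OF this measurable_upd[OF i]] f] show ?thesis by simp
qed

lemma sec_L2:
  assumes i: "i \<in> I" and f: "f \<in> Lp N 2"
  shows "sec i f \<in> Lp (M i) 2"
proof -
  interpret Mi: prob_space "M i" by (rule M[OF i])
  have f2: "integrable N (\<lambda>z. (f z)\<^sup>2)" using f by (simp add: Lp_2_iff)
  note s2 = integral_sec[OF i f2]
  have "AE w in M i. norm ((sec i f w)\<^sup>2) \<le> norm (sec i (\<lambda>z. (f z)\<^sup>2) w)"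
    using s2(3) AE_space
  proof eventually_elim
    fix w assume int: "integrable N (\<lambda>z. (f (z(i := w)))\<^sup>2)" and w: "w \<in> space (M i)"
    have L: "(\<lambda>z. f (z(i := w))) \<in> Lp N 2"
      using measurable_section[OF i LpD(1)[OF f] w] int by (simp add: Lp_2_iff)
    have "\<bar>\<integral>z. f (z(i := w)) * 1 \<partial>N\<bar> \<le> sqrt (\<integral>z. (f (z(i := w)))\<^sup>2 \<partial>N) * sqrt (\<integral>z. 1\<^sup>2 \<partial>N)"
      by (rule L2_mult(2)[OF L]) simp
    then have "\<bar>sec i f w\<bar> \<le> sqrt (sec i (\<lambda>z. (f z)\<^sup>2) w)" by (simp add: sec_def prob_space)
    then have "\<bar>sec i f w\<bar>\<^sup>2 \<le> (sqrt (sec i (\<lambda>z. (f z)\<^sup>2) w))\<^sup>2" by (rule power_mono) simp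
    moreover have "0 \<le> sec i (\<lambda>z. (f z)\<^sup>2) w" by (simp add: sec_def)
    ultimately show "norm ((sec i f w)\<^sup>2) \<le> norm (sec i (\<lambda>z. (f z)\<^sup>2) w)" by simp
  qed
  moreover have m: "sec i f \<in> borel_measurable (M i)"
    using integral_sec(1)[OF i L2_integrable[OF f]] by auto
  ultimately have "integrable (M i) (\<lambda>w. (sec i f w)\<^sup>2)"
    using s2(1) by (intro Bochner_Integration.integrable_bound[OF s2(1)]) auto
  then show ?thesis using m by (simp add: Lp_2_iff)
qed

lemma integral_coord:
  fixes h :: "'a \<Rightarrow> real"
  assumes i: "i \<in> I" and h: "h \<in> borel_measurable (M i)"
  shows "(\<integral>z. h (z i) \<partial>N) = (\<integral>w. h w \<partial>M i)" "integrable N (\<lambda>z. h (z i)) \<longleftrightarrow> integrable (M i) h"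
    "(\<lambda>z. h (z i)) \<in> borel_measurable N"
proof -
  have d: "distr N (M i) (\<lambda>z. z i) = M i" by (rule distr_PiM_component[OF M i])
  show "(\<integral>z. h (z i) \<partial>N) = (\<integral>w. h w \<partial>M i)" using integral_distr[OF measurable_coord[OF i] h] d by simp
  show "integrable N (\<lambda>z. h (z i)) \<longleftrightarrow> integrable (M i) h" using integrable_distr_eq[OF measurable_coord[OF i] h] d by simp
  show "(\<lambda>z. h (z i)) \<in> borel_measurable N" by (rule measurable_compose[OF measurable_coord[OF i] h])
qed

lemma Lp_coord:
  assumes i: "i \<in> I" and h: "h \<in> Lp (M i) p"
  shows "(\<lambda>z. h (z i)) \<in> Lp N p" "Ip N p (\<lambda>z. h (z i)) = Ip (M i) p h"
proof -
  have m: "(\<lambda>w. \<bar>h w\<bar> powr p) \<in> borel_measurable (M i)" using LpD(1)[OF h] by measurable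
  note c = integral_coord[OF i m]
  show "(\<lambda>z. h (z i)) \<in> Lp N p"
    by (rule LpI[OF integral_coord(3)[OF i LpD(1)[OF h]]]) (simp only: c(2) LpD(2)[OF h])
  show "Ip N p (\<lambda>z. h (z i)) = Ip (M i) p h" by (rule c(1))
qed

lemma AE_coord: "i \<in> I \<Longrightarrow> AE w in M i. Q w \<Longrightarrow> AE z in N. Q (z i)"
  by (rule AE_PiM_component[OF M])

lemma integral_mult_coord:
  assumes i: "i \<in> I" and f: "f \<in> Lp N 2" and h: "h \<in> Lp (M i) 2"
  shows "(\<integral>z. f z * h (z i) \<partial>N) = (\<integral>w. sec i f w * h w \<partial>M i)"
proof -
  have "integrable N (\<lambda>z. f z * h (z i))" by (rule L2_mult(1)[OF f Lp_coord(1)[OF i h]])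
  from integral_sec(2)[OF i this] show ?thesis by (simp add: sec_def)
qed

lemma sec_coord_same: "sec i (\<lambda>z. h (z i)) = h"
  by (simp add: sec_def fun_eq_iff prob_space)

lemma sec_coord_other:
  assumes "j \<in> I" "j \<noteq> i" "h \<in> borel_measurable (M j)"
  shows "sec i (\<lambda>z. h (z j)) = (\<lambda>w. \<integral>v. h v \<partial>M j)"
proof
  fix w
  have "sec i (\<lambda>z. h (z j)) w = (\<integral>z. h (z j) \<partial>N)" using assms(2) by (simp add: sec_def)
  then show "sec i (\<lambda>z. h (z j)) w = (\<integral>v. h v \<partial>M j)" by (simp only: integral_coord(1)[OF assms(1,3)])
qed

lemma sec_const [simp]: "sec i (\<lambda>z. c) = (\<lambda>w. c)"
  by (simp add: sec_def fun_eq_iff prob_space)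

section \<open>Finite partial sums of the independent projection\<close>

definition mean :: "((nat \<Rightarrow> 'a) \<Rightarrow> real) \<Rightarrow> real" where
  "mean f = (\<integral>z. f z \<partial>N)"

text \<open>The summands are centered functions of different coordinates, hence mutually orthogonal,
  and the mean is counted once. The sum follows the order of the natural numbers that code the
  indices.\<close>

definition ipart :: "nat \<Rightarrow> ((nat \<Rightarrow> 'a) \<Rightarrow> real) \<Rightarrow> (nat \<Rightarrow> 'a) \<Rightarrow> real" where
  "ipart n f z = mean f + (\<Sum>i\<in>I \<inter> {..<n}. P i (sec i f) (z i) - mean f)"

text \<open>Self-adjointness moves \<open>P i\<close> onto the constant 1, which it fixes; this
  centers the summands of \<open>ipart\<close>.\<close>

lemma integral_P:
  assumes i: "i \<in> I" and h: "h \<in> Lp (M i) 2"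
  shows "(\<integral>w. P i h w \<partial>M i) = (\<integral>w. h w \<partial>M i)"
proof -
  interpret Mi: prob_space "M i" by (rule M[OF i])
  have one: "(\<lambda>_. 1) \<in> Lp (M i) 2" by simp
  note [measurable] = LpD(1)[OF orth_projD(1)[OF P[OF i] one]] LpD(1)[OF h]
  have "(\<integral>w. P i h w \<partial>M i) = (\<integral>w. P i h w * 1 \<partial>M i)" by simp
  also have "\<dots> = (\<integral>w. h w * P i (\<lambda>_. 1) w \<partial>M i)" by (rule orth_projD(5)[OF P[OF i] h one])
  also have "\<dots> = (\<integral>w. h w \<partial>M i)"
  proof (rule integral_cong_AE)
    show "AE w in M i. h w * P i (\<lambda>_. 1) w = h w" using P1[OF i] by eventually_elim simp
  qed auto
  finally show ?thesis .
qed

lemma P_sec: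
  assumes i: "i \<in> I" and f: "f \<in> Lp N 2"
  shows "P i (sec i f) \<in> Lp (M i) 2" "(\<integral>w. P i (sec i f) w \<partial>M i) = mean f"
  unfolding mean_def integral_P[OF i sec_L2[OF i f]] integral_sec(2)[OF i L2_integrable[OF f]]
  by (rule orth_projD(1)[OF P[OF i] sec_L2[OF i f]]) (rule refl)

lemma L2_sum:
  assumes "finite A" "\<And>i. i \<in> A \<Longrightarrow> g i \<in> Lp N 2"
  shows "(\<lambda>z. \<Sum>i\<in>A. g i z) \<in> Lp N 2"
  using assms
proof (induction A rule: finite_induct)
  case (insert x A)
  then show ?case using Lp_add(1)[of 2 "g x" N "\<lambda>z. \<Sum>i\<in>A. g i z"] by simp
qed simp

lemma part_term_L2:
  assumes i: "i \<in> I" and f: "f \<in> Lp N 2"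
  shows "(\<lambda>z. P i (sec i f) (z i) - mean f) \<in> Lp N 2"
  by (rule Lp_diff(1)[OF _ Lp_coord(1)[OF i P_sec(1)[OF i f]]]) auto

lemma part_L2:
  assumes f: "f \<in> Lp N 2"
  shows "ipart n f \<in> Lp N 2"
proof -
  have "(\<lambda>z. \<Sum>i\<in>I \<inter> {..<n}. P i (sec i f) (z i) - mean f) \<in> Lp N 2"
    by (rule L2_sum) (use part_term_L2[OF _ f] in auto)
  from Lp_add(1)[OF _ Lp_const this] show ?thesis unfolding ipart_def by simp
qed

text \<open>Inner products with partial sums become inner products on the factors, so symmetry and
  idempotence can be read off from the \<open>P i\<close>.\<close>

lemma integral_mult_part:
  assumes f: "f \<in> Lp N 2" and g: "g \<in> Lp N 2"
  shows "(\<integral>z. g z * ipart n f z \<partial>N) =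
    mean f * mean g + (\<Sum>i\<in>I \<inter> {..<n}. (\<integral>w. sec i g w * P i (sec i f) w \<partial>M i) - mean f * mean g)"
proof -
  have int: "integrable N (\<lambda>z. g z * (P i (sec i f) (z i) - mean f))" if "i \<in> I" for i
    by (rule L2_mult(1)[OF g part_term_L2[OF that f]])
  have "(\<integral>z. g z * ipart n f z \<partial>N) = (\<integral>z. mean f * g z + (\<Sum>i\<in>I \<inter> {..<n}. g z * (P i (sec i f) (z i) - mean f)) \<partial>N)"
    by (simp add: ipart_def distrib_left sum_distrib_left mult.commute)
  also have "\<dots> = mean f * mean g + (\<Sum>i\<in>I \<inter> {..<n}. (\<integral>z. g z * (P i (sec i f) (z i) - mean f) \<partial>N))"
    using int L2_integrable[OF g]
    by (subst Bochner_Integration.integral_add) (auto simp: Bochner_Integration.integral_sum mean_def[of g])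
  also have "(\<Sum>i\<in>I \<inter> {..<n}. (\<integral>z. g z * (P i (sec i f) (z i) - mean f) \<partial>N))
     = (\<Sum>i\<in>I \<inter> {..<n}. (\<integral>w. sec i g w * P i (sec i f) w \<partial>M i) - mean f * mean g)"
  proof (intro sum.cong refl)
    fix i assume "i \<in> I \<inter> {..<n}"
    then have i: "i \<in> I" by simp
    have "(\<integral>z. g z * (P i (sec i f) (z i) - mean f) \<partial>N) = (\<integral>z. g z * P i (sec i f) (z i) - mean f * g z \<partial>N)"
      by (simp add: algebra_simps)
    also have "\<dots> = (\<integral>z. g z * P i (sec i f) (z i) \<partial>N) - mean f * mean g"
      using L2_mult(1)[OF g Lp_coord(1)[OF i P_sec(1)[OF i f]]] L2_integrable[OF g] by (simp add: mean_def)
    finally show "(\<integral>z. g z * (P i (sec i f) (z i) - mean f) \<partial>N) = (\<integral>w. sec i g w * P i (sec i f) w \<partial>M i) - mean f * mean g"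
      using integral_mult_coord[OF i g P_sec(1)[OF i f]] by simp
  qed
  finally show ?thesis .
qed

lemma part_sym:
  assumes f: "f \<in> Lp N 2" and g: "g \<in> Lp N 2"
  shows "(\<integral>z. ipart n f z * g z \<partial>N) = (\<integral>z. f z * ipart n g z \<partial>N)"
proof -
  have "(\<integral>w. sec i g w * P i (sec i f) w \<partial>M i) = (\<integral>w. sec i f w * P i (sec i g) w \<partial>M i)" if "i \<in> I" for i
    using orth_projD(5)[OF P[OF that] sec_L2[OF that f] sec_L2[OF that g]] by (simp add: mult.commute)
  then have "(\<Sum>i\<in>I \<inter> {..<n}. (\<integral>w. sec i g w * P i (sec i f) w \<partial>M i) - mean f * mean g)
    = (\<Sum>i\<in>I \<inter> {..<n}. (\<integral>w. sec i f w * P i (sec i g) w \<partial>M i) - mean g * mean f)"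
    by (intro sum.cong) (auto simp: mult.commute)
  then show ?thesis
    using integral_mult_part[OF f g, of n] integral_mult_part[OF g f, of n] by (simp add: mult.commute)
qed

lemma mean_part:
  assumes f: "f \<in> Lp N 2"
  shows "mean (ipart n f) = mean f"
proof -
  have one: "(\<lambda>_. 1) \<in> Lp N 2" "mean (\<lambda>_. 1) = 1" by (simp_all add: mean_def prob_space)
  have "mean (ipart n f) = (\<integral>z. 1 * ipart n f z \<partial>N)" unfolding mean_def by simp
  also have "\<dots> = mean f * 1 + (\<Sum>i\<in>I \<inter> {..<n}. (\<integral>w. sec i (\<lambda>_. 1) w * P i (sec i f) w \<partial>M i) - mean f * 1)"
    unfolding integral_mult_part[OF f one(1)] one(2) ..
  also have "(\<Sum>i\<in>I \<inter> {..<n}. (\<integral>w. sec i (\<lambda>_. 1) w * P i (sec i f) w \<partial>M i) - mean f * 1) = 0"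
    using P_sec(2)[OF _ f] by (intro sum.neutral) auto
  finally show ?thesis by simp
qed

text \<open>By independence, conditioning on coordinate \<open>i\<close> annihilates the centered
  terms of all other coordinates.\<close>

lemma sec_part:
  assumes f: "f \<in> Lp N 2" and i: "i \<in> I" "i < n"
  shows "sec i (ipart n f) = P i (sec i f)"
proof
  fix w
  define J where "J = I \<inter> {..<n} - {i}"
  have J: "I \<inter> {..<n} = insert i J" "i \<notin> J" "finite J" using i by (auto simp: J_def)
  have int: "integrable N (\<lambda>z. P j (sec j f) (z j))" and iz: "(\<integral>z. P j (sec j f) (z j) \<partial>N) = mean f" if "j \<in> J" for j
  proof -
    have j: "j \<in> I" using that by (simp add: J_def)
    show "integrable N (\<lambda>z. P j (sec j f) (z j))" by (rule L2_integrable[OF Lp_coord(1)[OF j P_sec(1)[OF j f]]])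
    show "(\<integral>z. P j (sec j f) (z j) \<partial>N) = mean f"
      using integral_coord(1)[OF j LpD(1)[OF P_sec(1)[OF j f]]] P_sec(2)[OF j f] by simp
  qed
  have "ipart n f (z(i := w)) = P i (sec i f) w + (\<Sum>j\<in>J. P j (sec j f) (z j) - mean f)" for z
  proof -
    have "(\<Sum>j\<in>J. P j (sec j f) ((z(i := w)) j) - mean f) = (\<Sum>j\<in>J. P j (sec j f) (z j) - mean f)"
      using J(2) by (intro sum.cong) auto
    then show ?thesis unfolding ipart_def J(1) using J(2,3) by simp
  qed
  then have "sec i (ipart n f) w = (\<integral>z. P i (sec i f) w + (\<Sum>j\<in>J. P j (sec j f) (z j) - mean f) \<partial>N)"
    by (simp add: sec_def)
  also have "\<dots> = P i (sec i f) w + (\<Sum>j\<in>J. (\<integral>z. P j (sec j f) (z j) - mean f \<partial>N))"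
    using int by (simp add: Bochner_Integration.integral_sum prob_space)
  also have "\<dots> = P i (sec i f) w" using int iz by (simp add: prob_space)
  finally show "sec i (ipart n f) w = P i (sec i f) w" .
qed

text \<open>The weak form of \<open>ipart k\<close> after \<open>ipart n\<close> being
  \<open>ipart k\<close>: by \<open>sec_part\<close> each factor contributes an inner product in
  which the second \<open>P i\<close> is absorbed.\<close>

lemma part_part:
  assumes f: "f \<in> Lp N 2" and g: "g \<in> Lp N 2" and k: "k \<le> n"
  shows "(\<integral>z. ipart n g z * ipart k f z \<partial>N) = (\<integral>z. g z * ipart k f z \<partial>N)"
proof -
  have "(\<integral>w. sec i (ipart n g) w * P i (sec i f) w \<partial>M i) = (\<integral>w. sec i g w * P i (sec i f) w \<partial>M i)"
    if i: "i \<in> I" "i < k" for i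
  proof -
    note Pf = P_sec(1)[OF i(1) f]
    note PPf = orth_projD(1)[OF P[OF i(1)] Pf]
    note sg = sec_L2[OF i(1) g]
    note [measurable] = LpD(1)[OF Pf] LpD(1)[OF PPf] LpD(1)[OF sg]
    have "(\<integral>w. sec i (ipart n g) w * P i (sec i f) w \<partial>M i) = (\<integral>w. P i (sec i g) w * P i (sec i f) w \<partial>M i)"
      using sec_part[OF g i(1), of n] i k by simp
    also have "\<dots> = (\<integral>w. sec i g w * P i (P i (sec i f)) w \<partial>M i)"
      by (rule orth_projD(5)[OF P[OF i(1)] sg Pf])
    also have "\<dots> = (\<integral>w. sec i g w * P i (sec i f) w \<partial>M i)"
      using orth_projD(4)[OF P[OF i(1)] sec_L2[OF i(1) f]] by (intro integral_cong_AE) auto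
    finally show ?thesis .
  qed
  then have "(\<Sum>i\<in>I \<inter> {..<k}. (\<integral>w. sec i (ipart n g) w * P i (sec i f) w \<partial>M i) - mean f * mean g)
    = (\<Sum>i\<in>I \<inter> {..<k}. (\<integral>w. sec i g w * P i (sec i f) w \<partial>M i) - mean f * mean g)"
    by (intro sum.cong) auto
  then show ?thesis
    using integral_mult_part[OF f part_L2[OF g, of n], of k] integral_mult_part[OF f g, of k]
    by (simp add: mean_part[OF g])
qed

lemma L2_expand:
  assumes f: "f \<in> Lp N 2" and g: "g \<in> Lp N 2"
  shows "(\<integral>z. (f z - g z)\<^sup>2 \<partial>N) = (\<integral>z. f z * f z \<partial>N) - 2 * (\<integral>z. f z * g z \<partial>N) + (\<integral>z. g z * g z \<partial>N)"
proof -
  have "(\<integral>z. (f z - g z)\<^sup>2 \<partial>N) = (\<integral>z. f z * f z - 2 * (f z * g z) + g z * g z \<partial>N)"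
    by (simp add: power2_eq_square algebra_simps)
  then show ?thesis using L2_mult(1)[OF f f] L2_mult(1)[OF f g] L2_mult(1)[OF g g] by simp
qed

text \<open>The numbers \<open>a n\<close> are the squared norms of the partial sums. They increase,
  are bounded by the squared norm of \<open>f\<close>, and their differences are the squared
  distances.\<close>

lemma part_Cauchy:
  assumes f: "f \<in> Lp N 2" and e: "0 < e"
  shows "\<exists>n0. \<forall>m\<ge>n0. \<forall>n\<ge>n0. (\<integral>z. (ipart m f z - ipart n f z)\<^sup>2 \<partial>N) < e"
proof -
  define a where "a n = (\<integral>z. f z * ipart n f z \<partial>N)" for n
  have pL: "ipart n f \<in> Lp N 2" for n by (rule part_L2[OF f])
  have aa: "(\<integral>z. ipart n f z * ipart k f z \<partial>N) = a k" if "k \<le> n" for k n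
    using part_part[OF f f that] by (simp add: a_def)
  have diff: "(\<integral>z. (ipart n f z - ipart k f z)\<^sup>2 \<partial>N) = a n - a k" if "k \<le> n" for k n
    using L2_expand[OF pL pL, of n k] aa[OF that] aa[of n n] aa[of k k] by simp
  have inc: "a k \<le> a n" if "k \<le> n" for k n
  proof -
    have "0 \<le> (\<integral>z. (ipart n f z - ipart k f z)\<^sup>2 \<partial>N)" by simp
    then show ?thesis using diff[OF that] by simp
  qed
  have bnd: "a n \<le> (\<integral>z. f z * f z \<partial>N)" for n
  proof -
    have "0 \<le> (\<integral>z. (f z - ipart n f z)\<^sup>2 \<partial>N)" by simp
    then show ?thesis using L2_expand[OF f pL, of n] aa[of n n] by (simp add: a_def)
  qed
  have "convergent a"
  proof (rule Bseq_mono_convergent)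
    show "Bseq a"
    proof (rule BseqI'[of _ "\<bar>a 0\<bar> + \<bar>\<integral>z. f z * f z \<partial>N\<bar>"])
      fix n
      show "norm (a n) \<le> \<bar>a 0\<bar> + \<bar>\<integral>z. f z * f z \<partial>N\<bar>" using inc[of 0 n] bnd[of n] unfolding real_norm_def by linarith
    qed
  qed (use inc in auto)
  then have "Cauchy a" by (rule convergent_Cauchy)
  then obtain n0 where n0: "\<And>m n. m \<ge> n0 \<Longrightarrow> n \<ge> n0 \<Longrightarrow> norm (a m - a n) < e"
    using CauchyD[OF _ e] by blast
  have "(\<integral>z. (ipart m f z - ipart n f z)\<^sup>2 \<partial>N) < e" if "m \<ge> n0" "n \<ge> n0" for m n
  proof (cases "n \<le> m")
    case True
    then show ?thesis using diff[OF True] n0[OF that] by simp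
  next
    case False
    then have "(\<integral>z. (ipart m f z - ipart n f z)\<^sup>2 \<partial>N) = a n - a m"
      using diff[of m n] by (simp add: power2_commute)
    then show ?thesis using n0[OF that] by simp
  qed
  then show ?thesis by blast
qed

section \<open>The limit projection\<close>

text \<open>The partial sums converge in \<open>L\<^sub>2\<close>; the limit is only determined almost everywhere.\<close>
definition iproj :: "((nat \<Rightarrow> 'a) \<Rightarrow> real) \<Rightarrow> (nat \<Rightarrow> 'a) \<Rightarrow> real" where
  "iproj f = (SOME h. h \<in> Lp N 2 \<and> (\<lambda>n. \<integral>z. (h z - ipart n f z)\<^sup>2 \<partial>N) \<longlonglongrightarrow> 0)"

lemma iproj:
  assumes f: "f \<in> Lp N 2"
  shows "iproj f \<in> Lp N 2" "(\<lambda>n. \<integral>z. (iproj f z - ipart n f z)\<^sup>2 \<partial>N) \<longlonglongrightarrow> 0"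
proof -
  have "\<exists>h. h \<in> Lp N 2 \<and> (\<lambda>n. \<integral>z. (h z - ipart n f z)\<^sup>2 \<partial>N) \<longlonglongrightarrow> 0"
    using L2_complete[of "\<lambda>n. ipart n f"] part_L2[OF f] part_Cauchy[OF f] by auto
  from someI_ex[OF this] show "iproj f \<in> Lp N 2" "(\<lambda>n. \<integral>z. (iproj f z - ipart n f z)\<^sup>2 \<partial>N) \<longlonglongrightarrow> 0"
    by (auto simp: iproj_def)
qed

lemma proj_unique:
  assumes f: "f \<in> Lp N 2" and h: "h \<in> Lp N 2" and lim: "(\<lambda>n. \<integral>z. (h z - ipart n f z)\<^sup>2 \<partial>N) \<longlonglongrightarrow> 0"
  shows "AE z in N. iproj f z = h z"
proof (rule L2_AE_eqI[OF iproj(1)[OF f] h])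
  have "(\<lambda>n. 2 * ((\<integral>z. (iproj f z - ipart n f z)\<^sup>2 \<partial>N) + (\<integral>z. (h z - ipart n f z)\<^sup>2 \<partial>N))) \<longlonglongrightarrow> 2 * (0 + 0)"
    by (intro tendsto_intros iproj(2)[OF f] lim)
  then have "(\<integral>z. (iproj f z - h z)\<^sup>2 \<partial>N) \<le> 2 * (0 + 0)"
  proof (rule LIMSEQ_le_const, intro exI allI impI)
    fix n
    show "(\<integral>z. (iproj f z - h z)\<^sup>2 \<partial>N) \<le> 2 * ((\<integral>z. (iproj f z - ipart n f z)\<^sup>2 \<partial>N) + (\<integral>z. (h z - ipart n f z)\<^sup>2 \<partial>N))"
      using L2_diff_triangle[OF iproj(1)[OF f] part_L2[OF f, of n] h] by (simp add: power2_commute[of "h _"])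
  qed
  then show "(\<integral>z. (iproj f z - h z)\<^sup>2 \<partial>N) = 0" by (intro antisym) simp_all
qed

lemma integral_proj_lim:
  assumes f: "f \<in> Lp N 2" and g: "g \<in> Lp N 2"
  shows "(\<lambda>n. \<integral>z. ipart n f z * g z \<partial>N) \<longlonglongrightarrow> (\<integral>z. iproj f z * g z \<partial>N)"
proof -
  have "(\<lambda>n. (\<integral>z. ipart n f z * g z \<partial>N) - (\<integral>z. iproj f z * g z \<partial>N)) \<longlonglongrightarrow> 0"
  proof (rule Lim_null_comparison)
    have "(\<lambda>n. sqrt (\<integral>z. (iproj f z - ipart n f z)\<^sup>2 \<partial>N) * sqrt (\<integral>z. (g z)\<^sup>2 \<partial>N)) \<longlonglongrightarrow> sqrt 0 * sqrt (\<integral>z. (g z)\<^sup>2 \<partial>N)"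
      by (intro tendsto_intros iproj(2)[OF f])
    then show "(\<lambda>n. sqrt (\<integral>z. (iproj f z - ipart n f z)\<^sup>2 \<partial>N) * sqrt (\<integral>z. (g z)\<^sup>2 \<partial>N)) \<longlonglongrightarrow> 0" by simp
    show "\<forall>\<^sub>F n in sequentially. norm ((\<integral>z. ipart n f z * g z \<partial>N) - (\<integral>z. iproj f z * g z \<partial>N))
       \<le> sqrt (\<integral>z. (iproj f z - ipart n f z)\<^sup>2 \<partial>N) * sqrt (\<integral>z. (g z)\<^sup>2 \<partial>N)"
    proof (intro always_eventually allI)
      fix n
      have "(\<lambda>z. iproj f z - ipart n f z) \<in> Lp N 2" by (rule Lp_diff(1)) (use iproj(1)[OF f] part_L2[OF f] in auto)
      from L2_mult(2)[OF this g] have "\<bar>\<integral>z. (iproj f z - ipart n f z) * g z \<partial>N\<bar> \<le> sqrt (\<integral>z. (iproj f z - ipart n f z)\<^sup>2 \<partial>N) * sqrt (\<integral>z. (g z)\<^sup>2 \<partial>N)" .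
      moreover have "(\<integral>z. (iproj f z - ipart n f z) * g z \<partial>N) = (\<integral>z. iproj f z * g z \<partial>N) - (\<integral>z. ipart n f z * g z \<partial>N)"
        using L2_mult(1)[OF iproj(1)[OF f] g] L2_mult(1)[OF part_L2[OF f] g, of n] by (simp add: left_diff_distrib)
      ultimately show "norm ((\<integral>z. ipart n f z * g z \<partial>N) - (\<integral>z. iproj f z * g z \<partial>N))
       \<le> sqrt (\<integral>z. (iproj f z - ipart n f z)\<^sup>2 \<partial>N) * sqrt (\<integral>z. (g z)\<^sup>2 \<partial>N)" by (simp add: abs_minus_commute)
    qed
  qed
  then show ?thesis by (simp add: LIM_zero_iff)
qed

lemma proj_sym:
  assumes f: "f \<in> Lp N 2" and g: "g \<in> Lp N 2"
  shows "(\<integral>z. iproj f z * g z \<partial>N) = (\<integral>z. f z * iproj g z \<partial>N)"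
proof (rule LIMSEQ_unique[OF integral_proj_lim[OF f g]])
  have "(\<integral>z. ipart n f z * g z \<partial>N) = (\<integral>z. ipart n g z * f z \<partial>N)" for n
    unfolding part_sym[OF f g] by (simp add: mult.commute)
  moreover have "(\<integral>z. f z * iproj g z \<partial>N) = (\<integral>z. iproj g z * f z \<partial>N)" by (simp add: mult.commute)
  ultimately show "(\<lambda>n. \<integral>z. ipart n f z * g z \<partial>N) \<longlonglongrightarrow> (\<integral>z. f z * iproj g z \<partial>N)"
    using integral_proj_lim[OF g f] by simp
qed

lemma proj_proj:
  assumes f: "f \<in> Lp N 2" and g: "g \<in> Lp N 2"
  shows "(\<integral>z. iproj f z * iproj g z \<partial>N) = (\<integral>z. iproj f z * g z \<partial>N)"
proof -
  \<comment> \<open>The two limits are taken one after the other: with \<open>k\<close> fixed, the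
    pairings are constant in \<open>n\<close> from \<open>k\<close> on by \<open>part_part\<close>;
    then \<open>k\<close> tends to infinity.\<close>
  have k: "(\<integral>z. ipart k f z * iproj g z \<partial>N) = (\<integral>z. ipart k f z * g z \<partial>N)" for k
  proof (rule LIMSEQ_unique)
    show "(\<lambda>n. \<integral>z. ipart n g z * ipart k f z \<partial>N) \<longlonglongrightarrow> (\<integral>z. ipart k f z * iproj g z \<partial>N)"
      using integral_proj_lim[OF g part_L2[OF f, of k]] by (simp add: mult.commute)
    show "(\<lambda>n. \<integral>z. ipart n g z * ipart k f z \<partial>N) \<longlonglongrightarrow> (\<integral>z. ipart k f z * g z \<partial>N)"
    proof (rule tendsto_eventually)
      show "\<forall>\<^sub>F n in sequentially. (\<integral>z. ipart n g z * ipart k f z \<partial>N) = (\<integral>z. ipart k f z * g z \<partial>N)"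
        unfolding eventually_sequentially by (intro exI[of _ k]) (auto simp: part_part[OF f g] mult.commute)
    qed
  qed
  show ?thesis
    using LIMSEQ_unique[OF integral_proj_lim[OF f iproj(1)[OF g]], of "\<integral>z. iproj f z * g z \<partial>N"] integral_proj_lim[OF f g]
    by (simp add: k)
qed

text \<open>The limit is fixed only up to null sets, so the laws of an orthogonal projection are
  checked by testing against all of \<open>L_2\<close>.\<close>

lemma L2_AE_eq_weak:
  assumes f: "f \<in> Lp N 2" and g: "g \<in> Lp N 2" and *: "\<And>h. h \<in> Lp N 2 \<Longrightarrow> (\<integral>z. f z * h z \<partial>N) = (\<integral>z. g z * h z \<partial>N)"
  shows "AE z in N. f z = g z"
  by (rule L2_AE_eqI[OF f g]) (use L2_expand[OF f g] *[OF f] *[OF g] in \<open>simp add: mult.commute\<close>)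

lemma orth_proj_proj: "orth_proj N iproj"
  unfolding orth_proj_def
proof (intro conjI ballI allI impI)
  fix f g :: "(nat \<Rightarrow> 'a) \<Rightarrow> real" assume f: "f \<in> Lp N 2" and g: "g \<in> Lp N 2"
  note pf = iproj(1)[OF f] and pg = iproj(1)[OF g]
  show "iproj f \<in> Lp N 2" by fact
  show "(\<integral>z. iproj f z * g z \<partial>N) = (\<integral>z. f z * iproj g z \<partial>N)" by (rule proj_sym[OF f g])
  show "AE z in N. iproj f z = iproj g z" if "AE z in N. f z = g z"
  proof (rule L2_AE_eq_weak[OF pf pg])
    fix h :: "(nat \<Rightarrow> 'a) \<Rightarrow> real" assume h: "h \<in> Lp N 2"
    note [measurable] = LpD(1)[OF f] LpD(1)[OF g] LpD(1)[OF iproj(1)[OF h]]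
    have "(\<integral>z. f z * iproj h z \<partial>N) = (\<integral>z. g z * iproj h z \<partial>N)" using that by (intro integral_cong_AE) auto
    then show "(\<integral>z. iproj f z * h z \<partial>N) = (\<integral>z. iproj g z * h z \<partial>N)" by (simp add: proj_sym f g h)
  qed
  show "AE z in N. iproj (iproj f) z = iproj f z"
  proof (rule L2_AE_eq_weak[OF iproj(1)[OF pf] pf])
    fix h :: "(nat \<Rightarrow> 'a) \<Rightarrow> real" assume h: "h \<in> Lp N 2"
    show "(\<integral>z. iproj (iproj f) z * h z \<partial>N) = (\<integral>z. iproj f z * h z \<partial>N)"
      by (simp add: proj_sym[OF pf h] proj_proj[OF f h])
  qed
  fix a b :: real
  have fg: "(\<lambda>v. a * f v + b * g v) \<in> Lp N 2" by (rule Lp_lincomb) (use f g in auto)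
  have pfg: "(\<lambda>v. a * iproj f v + b * iproj g v) \<in> Lp N 2" by (rule Lp_lincomb) (use pf pg in auto)
  show "AE z in N. iproj (\<lambda>v. a * f v + b * g v) z = a * iproj f z + b * iproj g z"
  proof (rule L2_AE_eq_weak[OF iproj(1)[OF fg] pfg])
    fix h :: "(nat \<Rightarrow> 'a) \<Rightarrow> real" assume h: "h \<in> Lp N 2"
    have lin: "(\<integral>z. (a * u z + b * v z) * k z \<partial>N) = a * (\<integral>z. u z * k z \<partial>N) + b * (\<integral>z. v z * k z \<partial>N)"
      if "u \<in> Lp N 2" "v \<in> Lp N 2" "k \<in> Lp N 2" for u v k
      using L2_mult(1)[of u N k] L2_mult(1)[of v N k] that by (simp add: distrib_right mult.assoc)
    show "(\<integral>z. iproj (\<lambda>v. a * f v + b * g v) z * h z \<partial>N) = (\<integral>z. (a * iproj f z + b * iproj g z) * h z \<partial>N)"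
      unfolding proj_sym[OF fg h] lin[OF f g iproj(1)[OF h]] lin[OF pf pg h] by (simp add: proj_sym f g h)
  qed
qed

lemma P_const:
  assumes i: "i \<in> I"
  shows "AE w in M i. P i (\<lambda>_. c) w = c"
proof -
  interpret Mi: prob_space "M i" by (rule M[OF i])
  have "AE w in M i. P i (\<lambda>v. c * 1 + 0 * 1) w = c * P i (\<lambda>_. 1) w + 0 * P i (\<lambda>_. 1) w"
    by (rule orth_projD(3)[OF P[OF i], of "\<lambda>_. 1" "\<lambda>_. 1"]) auto
  then show ?thesis using P1[OF i] by eventually_elim simp
qed

text \<open>Conditioning a function of coordinate \<open>y\<close> on another coordinate gives a
  constant, which \<open>P i\<close> fixes; all terms but one vanish, and the partial sums are
  stationary once \<open>n > y\<close>.\<close>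

lemma proj_coord:
  assumes y: "y \<in> I" and h: "h \<in> Lp (M y) 2"
  shows "AE z in N. iproj (\<lambda>z. h (z y)) z = P y h (z y)"
proof (rule proj_unique)
  define f where "f z = h (z y)" for z
  have f: "f \<in> Lp N 2" unfolding f_def by (rule Lp_coord(1)[OF y h])
  then show "(\<lambda>z. h (z y)) \<in> Lp N 2" unfolding f_def .
  show Ph: "(\<lambda>z. P y h (z y)) \<in> Lp N 2" by (rule Lp_coord(1)[OF y orth_projD(1)[OF P[OF y] h]])
  have mf: "mean f = (\<integral>w. h w \<partial>M y)" unfolding mean_def f_def by (rule integral_coord(1)[OF y LpD(1)[OF h]])
  have sy: "sec y f = h" unfolding f_def by (rule sec_coord_same)
  have so: "sec i f = (\<lambda>_. mean f)" if "i \<noteq> y" for i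
    unfolding mf unfolding f_def by (rule sec_coord_other[OF y _ LpD(1)[OF h]]) (use that in auto)
  have "AE z in N. \<forall>i\<in>I \<inter> {..<n} - {y}. P i (sec i f) (z i) = mean f" for n
  proof (rule AE_finite_allI)
    fix i assume i: "i \<in> I \<inter> {..<n} - {y}"
    then show "AE z in N. P i (sec i f) (z i) = mean f" using so[of i] P_const[of i "mean f"] by (intro AE_coord) auto
  qed auto
  then have "AE z in N. ipart n f z = P y h (z y)" if "y < n" for n
  proof eventually_elim
    fix z assume *: "\<forall>i\<in>I \<inter> {..<n} - {y}. P i (sec i f) (z i) = mean f"
    define J where "J = I \<inter> {..<n} - {y}"
    have J: "I \<inter> {..<n} = insert y J" "y \<notin> J" "finite J" using y that by (auto simp: J_def)
    have "ipart n f z = mean f + (P y (sec y f) (z y) - mean f + (\<Sum>i\<in>J. P i (sec i f) (z i) - mean f))"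
      unfolding ipart_def J(1) using J(2,3) by simp
    also have "(\<Sum>i\<in>J. P i (sec i f) (z i) - mean f) = 0" using * by (intro sum.neutral) (auto simp: J_def)
    also have "mean f + (P y (sec y f) (z y) - mean f + 0) = P y h (z y)" by (simp add: sy)
    finally show "ipart n f z = P y h (z y)" .
  qed
  then have "(\<integral>z. (P y h (z y) - ipart n f z)\<^sup>2 \<partial>N) = 0" if "y < n" for n
  proof -
    have "AE z in N. (P y h (z y) - ipart n f z)\<^sup>2 = 0" using \<open>\<And>n. y < n \<Longrightarrow> AE z in N. ipart n f z = P y h (z y)\<close>[OF that]
      by eventually_elim simp
    then show ?thesis by (simp add: integral_eq_zero_AE)
  qed
  then have "(\<lambda>n. \<integral>z. (P y h (z y) - ipart n f z)\<^sup>2 \<partial>N) \<longlonglongrightarrow> 0"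
    by (intro tendsto_eventually) (auto simp: eventually_sequentially intro!: exI[of _ "Suc y"])
  then show "(\<lambda>n. \<integral>z. (P y h (z y) - ipart n (\<lambda>z. h (z y)) z)\<^sup>2 \<partial>N) \<longlonglongrightarrow> 0" by (simp add: f_def[abs_def])
qed

lemma proj_one: "AE z in N. iproj (\<lambda>_. 1) z = 1"
proof (rule proj_unique)
  have "AE z in N. ipart n (\<lambda>_. 1) z = 1" for n
  proof -
    have "AE z in N. \<forall>i\<in>I \<inter> {..<n}. P i (\<lambda>_. 1) (z i) = 1"
      by (rule AE_finite_allI) (auto intro!: AE_coord P1)
    then show ?thesis by eventually_elim (simp add: ipart_def mean_def prob_space)
  qed
  then have "AE z in N. (1 - ipart n (\<lambda>_. 1) z)\<^sup>2 = 0" for n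
  proof -
    show ?thesis using \<open>\<And>n. AE z in N. ipart n (\<lambda>_. 1) z = 1\<close>[of n] by eventually_elim simp
  qed
  then have "(\<integral>z. (1 - ipart n (\<lambda>_. 1) z)\<^sup>2 \<partial>N) = 0" for n by (simp add: integral_eq_zero_AE)
  then show "(\<lambda>n. \<integral>z. (1 - ipart n (\<lambda>_. 1) z)\<^sup>2 \<partial>N) \<longlonglongrightarrow> 0" by simp
qed auto

end

section \<open>Product trees approximate the independent projection\<close>

context ind_sum
begin

primrec ptree :: "(nat \<Rightarrow> ftree) \<Rightarrow> nat \<Rightarrow> ftree" where
  "ptree t 0 = TPt"
| "ptree t (Suc n) = (if n \<in> I then TInd (t n) (ptree t n) else ptree t n)"

primrec pmap :: "(nat \<Rightarrow> 'a \<Rightarrow> fpoint) \<Rightarrow> nat \<Rightarrow> (nat \<Rightarrow> 'a) \<Rightarrow> fpoint" where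
  "pmap \<pi> 0 z = PUnit"
| "pmap \<pi> (Suc n) z = (if n \<in> I then PPair (\<pi> n (z n)) (pmap \<pi> n z) else pmap \<pi> n z)"

lemma pmap_upd: "n \<le> i \<Longrightarrow> pmap \<pi> n (z(i := w)) = pmap \<pi> n z"
  by (induction n) auto

lemma tree_map_ptree:
  assumes t: "\<And>i. i \<in> I \<Longrightarrow> tree_map (M i) (t i) (\<pi> i)"
  shows "tree_map N (ptree t n) (pmap \<pi> n)"
proof (induction n)
  case 0
  show ?case by (simp add: tree_map_def prob_space)
next
  case (Suc n)
  show ?case
  proof (cases "n \<in> I")
    case True
    interpret Mn: prob_space "M n" by (rule M[OF True])
    note tn = t[OF True]
    have m: "pmap \<pi> (Suc n) \<in> measurable N (count_space (tset (ptree t (Suc n))))"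
    proof -
      have a: "(\<lambda>z. \<pi> n (z n)) \<in> measurable N (count_space (tset (t n)))"
        by (rule measurable_compose[OF measurable_coord[OF True] tree_mapD(1)[OF tn]])
      have "(\<lambda>z. (\<pi> n (z n), pmap \<pi> n z)) \<in> measurable N (count_space (tset (t n)) \<Otimes>\<^sub>M count_space (tset (ptree t n)))"
        by (intro measurable_Pair a tree_mapD(1)[OF Suc.IH])
      also have "count_space (tset (t n)) \<Otimes>\<^sub>M count_space (tset (ptree t n)) = count_space (tset (t n) \<times> tset (ptree t n))"
        by (rule pair_measure_count_space) auto
      finally have b: "(\<lambda>z. (\<pi> n (z n), pmap \<pi> n z)) \<in> measurable N (count_space (tset (t n) \<times> tset (ptree t n)))" .
      have "(\<lambda>z. (\<lambda>(x, y). PPair x y) (\<pi> n (z n), pmap \<pi> n z)) \<in> measurable N (count_space (tset (ptree t (Suc n))))"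
        by (rule measurable_compose[OF b]) (use True in auto)
      moreover have "pmap \<pi> (Suc n) = (\<lambda>z. (\<lambda>(x, y). PPair x y) (\<pi> n (z n), pmap \<pi> n z))"
        using True by (simp add: fun_eq_iff)
      ultimately show ?thesis by simp
    qed
    moreover have "(\<integral>z. h (pmap \<pi> (Suc n) z) \<partial>N) = texp (ptree t (Suc n)) h" for h
    proof -
      define f where "f z = h (PPair (\<pi> n (z n)) (pmap \<pi> n z))" for z
      have fm: "f \<in> borel_measurable N"
        using measurable_compose[OF m, of h borel] True by (simp add: f_def[abs_def])
      have "f \<in> Lp N 2"
      proof (rule Lp_bounded[OF fm])
        fix z assume z: "z \<in> space N"
        have "PPair (\<pi> n (z n)) (pmap \<pi> n z) \<in> tset (ptree t (Suc n))"
          using measurable_space[OF m z] True by simp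
        then show "\<bar>f z\<bar> \<le> (\<Sum>x\<in>tset (ptree t (Suc n)). \<bar>h x\<bar>)"
          unfolding f_def by (intro member_le_sum[where f="\<lambda>x. \<bar>h x\<bar>"]) auto
      qed auto
      then have int: "integrable N f" by (rule L2_integrable)
      have "(\<integral>z. h (pmap \<pi> (Suc n) z) \<partial>N) = (\<integral>z. f z \<partial>N)" using True by (simp add: f_def)
      also have "\<dots> = (\<integral>w. sec n f w \<partial>M n)" by (rule integral_sec(2)[OF True int])
      also have "\<dots> = (\<integral>w. texp (ptree t n) (\<lambda>y. h (PPair (\<pi> n w) y)) \<partial>M n)"
      proof (intro Bochner_Integration.integral_cong refl)
        fix w
        show "sec n f w = texp (ptree t n) (\<lambda>y. h (PPair (\<pi> n w) y))"
          unfolding sec_def f_def using tree_mapD(2)[OF Suc.IH, of "\<lambda>y. h (PPair (\<pi> n w) y)"] by (simp add: pmap_upd)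
      qed
      also have "\<dots> = texp (t n) (\<lambda>x. texp (ptree t n) (\<lambda>y. h (PPair x y)))"
        by (rule tree_mapD(2)[OF tn, of "\<lambda>x. texp (ptree t n) (\<lambda>y. h (PPair x y))"])
      finally show ?thesis using True by simp
    qed
    ultimately show ?thesis unfolding tree_map_def by blast
  next
    case False
    then have "pmap \<pi> (Suc n) = pmap \<pi> n" by (simp add: fun_eq_iff)
    then show ?thesis using Suc False by simp
  qed
qed

text \<open>Compression commutes with forming the independent sum: averaging the conditional
  expectation \<open>F\<close> over the other factors gives a conditional expectation of
  \<open>sec i f\<close>, and by \<open>tree_cond_unique\<close> this is the given
  \<open>G i\<close>.\<close>

lemma tproj_ptree:
  assumes t: "\<And>i. i \<in> I \<Longrightarrow> tree_map (M i) (t i) (\<pi> i)" and f: "f \<in> Lp N 2"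
    and G: "\<And>i. i \<in> I \<Longrightarrow> tree_cond (M i) (t i) (\<pi> i) (sec i f) (G i)"
    and F: "tree_cond N (ptree t n) (pmap \<pi> n) f F" and z: "z \<in> space N"
  shows "tproj (ptree t n) F (pmap \<pi> n z) = mean f + (\<Sum>i\<in>I \<inter> {..<n}. tproj (t i) (G i) (\<pi> i (z i)) - mean f)"
  using F
proof (induction n arbitrary: F)
  case 0
  then show ?case using 0[unfolded tree_cond_def, rule_format, of "\<lambda>_. 1"] by (simp add: mean_def)
next
  case (Suc n)
  show ?case
  proof (cases "n \<in> I")
    case True
    note tn = t[OF True]
    define Fa where "Fa x = texp (ptree t n) (\<lambda>y. F (PPair x y))" for x
    define Fb where "Fb y = texp (t n) (\<lambda>x. F (PPair x y))" for y
    have cond: "(\<integral>z. f z * h (PPair (\<pi> n (z n)) (pmap \<pi> n z)) \<partial>N)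
       = texp (t n) (\<lambda>x. texp (ptree t n) (\<lambda>y. F (PPair x y) * h (PPair x y)))" for h
      using Suc.prems[unfolded tree_cond_def, rule_format, of h] True by simp
    have Fb: "tree_cond N (ptree t n) (pmap \<pi> n) f Fb"
      unfolding tree_cond_def
    proof
      fix h :: "fpoint \<Rightarrow> real"
      define k where "k z = (case z of PPair x y \<Rightarrow> h y | _ \<Rightarrow> 0)" for z
      have "(\<integral>z. f z * h (pmap \<pi> n z) \<partial>N) = texp (t n) (\<lambda>x. texp (ptree t n) (\<lambda>y. h y * F (PPair x y)))"
        using cond[of k] by (simp add: k_def mult.commute)
      also have "\<dots> = texp (ptree t n) (\<lambda>y. Fb y * h y)"
        by (subst texp_swap) (simp add: texp_cmult Fb_def mult.commute)
      finally show "(\<integral>z. f z * h (pmap \<pi> n z) \<partial>N) = texp (ptree t n) (\<lambda>y. Fb y * h y)" .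
    qed
    have Fa: "tree_cond (M n) (t n) (\<pi> n) (sec n f) Fa"
      unfolding tree_cond_def
    proof
      fix h :: "fpoint \<Rightarrow> real"
      interpret Mn: prob_space "M n" by (rule M[OF True])
      define k where "k z = (case z of PPair x y \<Rightarrow> h x | _ \<Rightarrow> 0)" for z
      have "(\<integral>w. sec n f w * h (\<pi> n w) \<partial>M n) = (\<integral>z. f z * h (\<pi> n (z n)) \<partial>N)"
        using integral_mult_coord[OF True f Mn.tree_map_Lp[OF tn, of 2 h]] by simp
      also have "\<dots> = texp (t n) (\<lambda>x. texp (ptree t n) (\<lambda>y. h x * F (PPair x y)))"
        using cond[of k] by (simp add: k_def mult.commute)
      also have "\<dots> = texp (t n) (\<lambda>x. Fa x * h x)" by (simp add: texp_cmult Fa_def mult.commute)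
      finally show "(\<integral>w. sec n f w * h (\<pi> n w) \<partial>M n) = texp (t n) (\<lambda>x. Fa x * h x)" .
    qed
    have m: "texp (t n) (\<lambda>x. texp (ptree t n) (\<lambda>y. F (PPair x y))) = mean f"
      using cond[of "\<lambda>_. 1"] by (simp add: mean_def)
    have zn: "\<pi> n (z n) \<in> tset (t n)"
      using tree_mapD(4)[OF tn] measurable_space[OF measurable_coord[OF True] z] by simp
    have a: "tproj (t n) Fa (\<pi> n (z n)) = tproj (t n) (G n) (\<pi> n (z n))"
      by (rule tproj_cong[OF tree_cond_unique[OF Fa G[OF True]] zn])
    have s: "I \<inter> {..<Suc n} = insert n (I \<inter> {..<n})" using True by auto
    have "tproj (ptree t (Suc n)) F (pmap \<pi> (Suc n) z) = tproj (t n) Fa (\<pi> n (z n)) + tproj (ptree t n) Fb (pmap \<pi> n z) - mean f"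
      using True m by (simp add: Fa_def[abs_def] Fb_def[abs_def])
    also have "\<dots> = mean f + (\<Sum>i\<in>I \<inter> {..<Suc n}. tproj (t i) (G i) (\<pi> i (z i)) - mean f)"
      unfolding a Suc.IH[OF Fb] s by simp
    finally show ?thesis .
  next
    case False
    have s: "I \<inter> {..<Suc n} = I \<inter> {..<n}" using False by (auto simp: less_Suc_eq)
    have e: "pmap \<pi> (Suc n) = pmap \<pi> n" "ptree t (Suc n) = ptree t n" using False by (simp_all add: fun_eq_iff)
    show ?thesis using Suc unfolding s e by blast
  qed
qed

lemma appr_part: "appr N (ipart n)"
  unfolding appr_def
proof (intro ballI allI impI)
  fix f :: "(nat \<Rightarrow> 'a) \<Rightarrow> real" and e :: real assume f: "f \<in> Lp N 2" and e: "0 < e"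
  define J where "J = I \<inter> {..<n}"
  have J: "finite J" "J \<subseteq> I" by (auto simp: J_def)
  define c where "c = real (card J)"
  \<comment> \<open>Cauchy-Schwarz for a sum of \<open>c\<close> terms costs one factor
    \<open>c\<close>, and summing the errors costs another; the \<open>+ 1\<close> covers empty
    \<open>J\<close>.\<close>
  define \<delta> where "\<delta> = e / (c * c + 1)"
  have \<delta>: "0 < \<delta>" using e by (simp add: \<delta>_def c_def add_nonneg_pos)
  have "\<forall>i\<in>I. \<exists>t \<pi> G. tree_map (M i) t \<pi> \<and> tree_cond (M i) t \<pi> (sec i f) G \<and>
      (\<integral>w. (P i (sec i f) w - tproj t G (\<pi> w))\<^sup>2 \<partial>M i) < \<delta>"
    using Pa sec_L2[OF _ f] \<delta> unfolding appr_def by simp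
  from bchoice[OF this] obtain t where "\<forall>i\<in>I. \<exists>\<pi> G. tree_map (M i) (t i) \<pi> \<and> tree_cond (M i) (t i) \<pi> (sec i f) G \<and>
      (\<integral>w. (P i (sec i f) w - tproj (t i) G (\<pi> w))\<^sup>2 \<partial>M i) < \<delta>" ..
  from bchoice[OF this] obtain \<pi> where "\<forall>i\<in>I. \<exists>G. tree_map (M i) (t i) (\<pi> i) \<and> tree_cond (M i) (t i) (\<pi> i) (sec i f) G \<and>
      (\<integral>w. (P i (sec i f) w - tproj (t i) G (\<pi> i w))\<^sup>2 \<partial>M i) < \<delta>" ..
  from bchoice[OF this] obtain G where tG: "\<forall>i\<in>I. tree_map (M i) (t i) (\<pi> i) \<and> tree_cond (M i) (t i) (\<pi> i) (sec i f) (G i) \<and>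
      (\<integral>w. (P i (sec i f) w - tproj (t i) (G i) (\<pi> i w))\<^sup>2 \<partial>M i) < \<delta>" ..
  have t: "\<And>i. i \<in> I \<Longrightarrow> tree_map (M i) (t i) (\<pi> i)"
    and G: "\<And>i. i \<in> I \<Longrightarrow> tree_cond (M i) (t i) (\<pi> i) (sec i f) (G i)"
    and d: "\<And>i. i \<in> I \<Longrightarrow> (\<integral>w. (P i (sec i f) w - tproj (t i) (G i) (\<pi> i w))\<^sup>2 \<partial>M i) < \<delta>"
    using tG by auto
  note tm = tree_map_ptree[OF t, of n]
  obtain F where F: "tree_cond N (ptree t n) (pmap \<pi> n) f F" using tree_cond_exists[OF tm f] by blast
  define D where "D i w = P i (sec i f) w - tproj (t i) (G i) (\<pi> i w)" for i w
  have D2: "D i \<in> Lp (M i) 2" if i: "i \<in> I" for i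
  proof -
    interpret Mi: prob_space "M i" by (rule M[OF i])
    show ?thesis unfolding D_def
      by (rule Lp_diff(1)[OF _ P_sec(1)[OF i f] Mi.tree_map_Lp[OF t[OF i]]]) auto
  qed
  have DI: "integrable N (\<lambda>z. (D i (z i))\<^sup>2)" "(\<integral>z. (D i (z i))\<^sup>2 \<partial>N) \<le> \<delta>" if i: "i \<in> I" for i
  proof -
    show "integrable N (\<lambda>z. (D i (z i))\<^sup>2)" using Lp_coord(1)[OF i D2[OF i]] by (simp add: Lp_2_iff)
    have "(\<lambda>w. (D i w)\<^sup>2) \<in> borel_measurable (M i)" using LpD(1)[OF D2[OF i]] by measurable
    from integral_coord(1)[OF i this] d[OF i] show "(\<integral>z. (D i (z i))\<^sup>2 \<partial>N) \<le> \<delta>" by (simp add: D_def)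
  qed
  have eq: "ipart n f z - tproj (ptree t n) F (pmap \<pi> n z) = (\<Sum>i\<in>J. D i (z i))" if "z \<in> space N" for z
  proof -
    have "tproj (ptree t n) F (pmap \<pi> n z) = mean f + (\<Sum>i\<in>J. tproj (t i) (G i) (\<pi> i (z i)) - mean f)"
      unfolding J_def by (rule tproj_ptree[OF t f G F that])
    then show ?thesis by (simp add: ipart_def D_def sum_subtractf flip: J_def)
  qed
  have "(\<integral>z. (ipart n f z - tproj (ptree t n) F (pmap \<pi> n z))\<^sup>2 \<partial>N) = (\<integral>z. (\<Sum>i\<in>J. D i (z i))\<^sup>2 \<partial>N)"
    by (intro Bochner_Integration.integral_cong refl) (simp add: eq)
  also have "\<dots> \<le> (\<integral>z. c * (\<Sum>i\<in>J. (D i (z i))\<^sup>2) \<partial>N)"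
  proof (rule integral_mono)
    have "(\<lambda>z. \<Sum>i\<in>J. D i (z i)) \<in> Lp N 2" using J by (intro L2_sum Lp_coord D2) auto
    then show "integrable N (\<lambda>z. (\<Sum>i\<in>J. D i (z i))\<^sup>2)" by (simp add: Lp_2_iff)
    show "integrable N (\<lambda>z. c * (\<Sum>i\<in>J. (D i (z i))\<^sup>2))"
      using DI(1) J by (intro integrable_mult_right Bochner_Integration.integrable_sum) auto
    fix z
    show "(\<Sum>i\<in>J. D i (z i))\<^sup>2 \<le> c * (\<Sum>i\<in>J. (D i (z i))\<^sup>2)"
      using Cauchy_Schwarz_ineq_sum[of "\<lambda>i. D i (z i)" "\<lambda>_. 1" J] by (simp add: c_def mult.commute)
  qed
  also have "\<dots> = c * (\<Sum>i\<in>J. (\<integral>z. (D i (z i))\<^sup>2 \<partial>N))"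
    using DI(1) J by (simp add: Bochner_Integration.integral_sum subset_eq)
  also have "\<dots> \<le> c * (\<Sum>i\<in>J. \<delta>)"
    using DI(2) J by (intro mult_left_mono sum_mono) (auto simp: c_def)
  also have "\<dots> = c * c * \<delta>" by (simp add: c_def)
  also have "\<dots> < (c * c + 1) * \<delta>" using \<delta> by (simp add: distrib_right)
  also have "\<dots> = e"
  proof -
    have "c * c + 1 > 0" by (simp add: c_def add_nonneg_pos)
    then show ?thesis by (simp add: \<delta>_def)
  qed
  finally show "\<exists>t \<pi> F. tree_map N t \<pi> \<and> tree_cond N t \<pi> f F \<and> (\<integral>z. (ipart n f z - tproj t F (\<pi> z))\<^sup>2 \<partial>N) < e"
    using tm F by blast
qed

lemma appr_proj: "appr N iproj"
  unfolding appr_def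
proof (intro ballI allI impI)
  fix f :: "(nat \<Rightarrow> 'a) \<Rightarrow> real" and e :: real assume f: "f \<in> Lp N 2" and e: "0 < e"
  have "\<forall>\<^sub>F n in sequentially. (\<integral>z. (iproj f z - ipart n f z)\<^sup>2 \<partial>N) < e / 4"
    using e by (intro order_tendstoD(2)[OF iproj(2)[OF f]]) auto
  then obtain n where n: "(\<integral>z. (iproj f z - ipart n f z)\<^sup>2 \<partial>N) < e / 4"
    by (auto simp: eventually_sequentially)
  obtain t \<pi> F where t: "tree_map N t \<pi>" "tree_cond N t \<pi> f F" "(\<integral>z. (ipart n f z - tproj t F (\<pi> z))\<^sup>2 \<partial>N) < e / 4"
    using appr_part[of n] f e unfolding appr_def by (meson divide_pos_pos zero_less_numeral)
  have "(\<integral>z. (iproj f z - tproj t F (\<pi> z))\<^sup>2 \<partial>N) \<le> 2 * ((\<integral>z. (iproj f z - ipart n f z)\<^sup>2 \<partial>N) + (\<integral>z. (ipart n f z - tproj t F (\<pi> z))\<^sup>2 \<partial>N))"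
    by (rule L2_diff_triangle[OF iproj(1)[OF f] part_L2[OF f] tree_map_Lp[OF t(1)]]) simp
  also have "\<dots> < 2 * (e / 4 + e / 4)" by (intro mult_strict_left_mono add_strict_mono n t(3)) simp
  finally have "(\<integral>z. (iproj f z - tproj t F (\<pi> z))\<^sup>2 \<partial>N) < e" by simp
  then show "\<exists>t \<pi> F. tree_map N t \<pi> \<and> tree_cond N t \<pi> f F \<and> (\<integral>z. (iproj f z - tproj t F (\<pi> z))\<^sup>2 \<partial>N) < e"
    using t by blast
qed

end

section \<open>Closures, linear spans and interpolation of norms\<close>

lemma Lp_closure_subset:
  assumes p: "0 < p" and S: "S \<subseteq> Lp_closure M p T" and T: "T \<subseteq> Lp M p"
  shows "Lp_closure M p S \<subseteq> Lp_closure M p T"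
proof
  fix g assume "g \<in> Lp_closure M p S"
  then have g: "g \<in> Lp M p" and ap: "\<And>e. 0 < e \<Longrightarrow> \<exists>f\<in>S. Ip M p (\<lambda>w. g w - f w) < e"
    by (auto simp: Lp_closure_iff[OF p])
  have "\<exists>h\<in>T. Ip M p (\<lambda>w. g w - h w) < e" if e: "0 < e" for e
  proof -
    define \<delta> where "\<delta> = e / (2 powr p * 2)"
    have \<delta>: "0 < \<delta>" using e by (simp add: \<delta>_def)
    obtain f where f: "f \<in> S" "Ip M p (\<lambda>w. g w - f w) < \<delta>" using ap[OF \<delta>] by auto
    obtain h where h: "h \<in> T" "Ip M p (\<lambda>w. f w - h w) < \<delta>"
      using f(1) S \<delta> by (auto simp: Lp_closure_iff[OF p] subset_eq)
    have "f \<in> Lp M p" "h \<in> Lp M p" using f h S T by (auto simp: Lp_closure_iff[OF p])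
    from Lp_triangle[OF p g this] have "Ip M p (\<lambda>w. g w - h w) \<le> 2 powr p * (Ip M p (\<lambda>w. g w - f w) + Ip M p (\<lambda>w. f w - h w))" .
    also have "\<dots> < 2 powr p * (\<delta> + \<delta>)" by (intro mult_strict_left_mono add_strict_mono f h) simp
    also have "\<dots> = e" by (simp add: \<delta>_def)
    finally show ?thesis using h by blast
  qed
  then show "g \<in> Lp_closure M p T" using g by (simp add: Lp_closure_iff[OF p])
qed

lemma subset_Lp_closure:
  assumes "0 < p" "S \<subseteq> Lp M p"
  shows "S \<subseteq> Lp_closure M p S"
proof
  fix f assume f: "f \<in> S"
  have "Ip M p (\<lambda>w. f w - f w) < e" if "0 < e" for e using that assms(1) by simp
  then show "f \<in> Lp_closure M p S" using f assms(2) by (auto simp: Lp_closure_iff[OF assms(1)] intro!: bexI[of _ f])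
qed

lemma lin_spanE:
  assumes "f \<in> lin_span S"
  obtains n :: nat and c g where "f = (\<lambda>w. \<Sum>i<n. c i * g i w)" "\<forall>i<n. g i \<in> S"
  using assms unfolding lin_span_def by blast

lemma lin_span_base: "f \<in> S \<Longrightarrow> f \<in> lin_span S"
  unfolding lin_span_def by (rule CollectI, rule exI[of _ 1], rule exI[of _ "\<lambda>_. 1"], rule exI[of _ "\<lambda>_. f"]) simp

lemma lin_span_lincomb:
  assumes f: "f \<in> lin_span S" and g: "g \<in> lin_span S"
  shows "(\<lambda>w. a * f w + b * g w) \<in> lin_span S"
proof -
  obtain n :: nat and c u where f: "f = (\<lambda>w. \<Sum>i<n. c i * u i w)" "\<forall>i<n. u i \<in> S" using f by (rule lin_spanE)
  obtain m :: nat and d v where g: "g = (\<lambda>w. \<Sum>i<m. d i * v i w)" "\<forall>i<m. v i \<in> S" using g by (rule lin_spanE)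
  define k where "k i = (if i < n then a * c i else b * d (i - n))" for i
  define h where "h i = (if i < n then u i else v (i - n))" for i
  have "a * f w + b * g w = (\<Sum>i<n + m. k i * h i w)" for w
  proof -
    have "(\<Sum>i<n + m. k i * h i w) = (\<Sum>i<n. k i * h i w) + (\<Sum>i<m. k (n + i) * h (n + i) w)"
      by (induction m) auto
    then show ?thesis by (simp add: f g k_def h_def sum_distrib_left mult.assoc)
  qed
  moreover have "\<forall>i<n + m. h i \<in> S" using f g by (auto simp: h_def)
  ultimately show ?thesis unfolding lin_span_def by blast
qed

lemma lin_span_subset:
  assumes S: "S \<subseteq> C" and z: "(\<lambda>_. 0) \<in> C" and C: "\<And>a b f g. f \<in> C \<Longrightarrow> g \<in> C \<Longrightarrow> (\<lambda>w. a * f w + b * g w) \<in> C"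
  shows "lin_span S \<subseteq> C"
proof
  fix f assume "f \<in> lin_span S"
  then obtain n :: nat and c g where f: "f = (\<lambda>w. \<Sum>i<n. c i * g i w)" and g: "\<forall>i<n. g i \<in> S" by (rule lin_spanE)
  have "(\<lambda>w. \<Sum>i<n. c i * g i w) \<in> C" using g
  proof (induction n)
    case (Suc n)
    then have "(\<lambda>w. 1 * (\<Sum>i<n. c i * g i w) + c n * g n w) \<in> C" using S by (intro C) auto
    then show ?case by simp
  qed (use z in simp)
  then show "f \<in> C" by (simp add: f)
qed

text \<open>\<open>P\<close> is linear only almost everywhere, so its range need not be a linear
  space of functions; the closure does not see the null sets.\<close>

lemma closure_range_lincomb:
  assumes M: "prob_space M" and p: "1 < p" and P: "orth_proj M P" "appr M P"
    and b1: "b1 \<in> Lp_closure M p (P ` (Lp M 2 \<inter> Lp M p))" and b2: "b2 \<in> Lp_closure M p (P ` (Lp M 2 \<inter> Lp M p))"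
  shows "(\<lambda>w. a * b1 w + c * b2 w) \<in> Lp_closure M p (P ` (Lp M 2 \<inter> Lp M p))"
proof -
  have pos: "0 < p" using p by simp
  have b: "b1 \<in> Lp M p" "b2 \<in> Lp M p" using b1 b2 by (auto simp: Lp_closure_iff[OF pos])
  have "\<exists>h\<in>P ` (Lp M 2 \<inter> Lp M p). Ip M p (\<lambda>w. a * b1 w + c * b2 w - h w) < e" if e: "0 < e" for e
  proof -
    define K where "K = 2 powr p * (\<bar>a\<bar> powr p + \<bar>c\<bar> powr p)"
    have K: "0 \<le> K" by (simp add: K_def)
    define \<delta> where "\<delta> = e / (K + 1)"
    have \<delta>: "0 < \<delta>" using e K by (simp add: \<delta>_def)
    obtain f1 where f1: "f1 \<in> Lp M 2" "f1 \<in> Lp M p" "Ip M p (\<lambda>w. b1 w - P f1 w) < \<delta>"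
      using b1 \<delta> by (auto simp: Lp_closure_iff[OF pos])
    obtain f2 where f2: "f2 \<in> Lp M 2" "f2 \<in> Lp M p" "Ip M p (\<lambda>w. b2 w - P f2 w) < \<delta>"
      using b2 \<delta> by (auto simp: Lp_closure_iff[OF pos])
    define f where "f w = a * f1 w + c * f2 w" for w
    have f: "f \<in> Lp M 2" "f \<in> Lp M p" unfolding f_def using f1 f2 pos by (auto intro!: Lp_lincomb)
    have PL: "P f1 \<in> Lp M p" "P f2 \<in> Lp M p" "P f \<in> Lp M p"
      using orth_proj_appr_bound[OF M p P] f1 f2 f by auto
    have d: "(\<lambda>w. b1 w - P f1 w) \<in> Lp M p" "(\<lambda>w. b2 w - P f2 w) \<in> Lp M p"
      using Lp_diff(1)[OF pos] b PL by auto
    have ae: "AE w in M. a * b1 w + c * b2 w - P f w = a * (b1 w - P f1 w) + c * (b2 w - P f2 w)"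
      using orth_projD(3)[OF P(1) f1(1) f2(1), of a c] unfolding f_def by eventually_elim (simp add: algebra_simps)
    have "Ip M p (\<lambda>w. a * b1 w + c * b2 w - P f w) = Ip M p (\<lambda>w. a * (b1 w - P f1 w) + c * (b2 w - P f2 w))"
      by (rule Ip_cong_AE[OF ae LpD(1)[OF Lp_diff(1)[OF pos Lp_lincomb[OF pos b] PL(3)]] LpD(1)[OF Lp_lincomb[OF pos d]]])
    also have "\<dots> \<le> 2 powr p * (\<bar>a\<bar> powr p * Ip M p (\<lambda>w. b1 w - P f1 w) + \<bar>c\<bar> powr p * Ip M p (\<lambda>w. b2 w - P f2 w))"
      using Lp_add(2)[OF pos Lp_cmult(1)[OF d(1), of a] Lp_cmult(1)[OF d(2), of c]]
      unfolding Lp_cmult(2)[OF d(1)] Lp_cmult(2)[OF d(2)] .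
    also have "\<dots> \<le> 2 powr p * (\<bar>a\<bar> powr p * \<delta> + \<bar>c\<bar> powr p * \<delta>)"
      using f1 f2 by (intro mult_left_mono add_mono) auto
    also have "\<dots> = K * \<delta>" by (simp add: K_def algebra_simps)
    also have "\<dots> < (K + 1) * \<delta>" using \<delta> by (simp add: distrib_right)
    also have "\<dots> = e" using K by (simp add: \<delta>_def)
    finally show ?thesis using f by blast
  qed
  then show ?thesis using Lp_lincomb[OF pos b] by (simp add: Lp_closure_iff[OF pos])
qed

lemma Lp_truncate:
  assumes p: "0 < p" and f: "f \<in> Lp M p" and e: "0 < e"
  shows "\<exists>g K. g \<in> borel_measurable M \<and> (\<forall>w. \<bar>g w\<bar> \<le> K) \<and> Ip M p (\<lambda>w. f w - g w) < e"
proof -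
  note [measurable] = LpD(1)[OF f]
  define g where "g n w = max (- real n) (min (real n) (f w))" for n w
  have [measurable]: "g n \<in> borel_measurable M" for n unfolding g_def by measurable
  have "(\<lambda>n. \<integral>w. \<bar>f w - g n w\<bar> powr p \<partial>M) \<longlonglongrightarrow> (\<integral>w. 0 \<partial>M)"
  proof (rule integral_dominated_convergence[where w="\<lambda>w. \<bar>f w\<bar> powr p"])
    show "AE w in M. (\<lambda>n. \<bar>f w - g n w\<bar> powr p) \<longlonglongrightarrow> 0"
    proof (rule AE_I2, rule tendsto_eventually)
      fix w
      obtain n where "\<bar>f w\<bar> \<le> real n" using real_arch_simple by blast
      then show "\<forall>\<^sub>F k in sequentially. \<bar>f w - g k w\<bar> powr p = 0"
        unfolding eventually_sequentially by (intro exI[of _ n]) (auto simp: g_def max_def min_def)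
    qed
    show "AE w in M. norm (\<bar>f w - g n w\<bar> powr p) \<le> \<bar>f w\<bar> powr p" for n
      using p by (auto intro!: AE_I2 powr_mono2 simp: g_def)
  qed (use LpD(2)[OF f] in auto)
  then have "\<forall>\<^sub>F n in sequentially. Ip M p (\<lambda>w. f w - g n w) < e"
    using e by (intro order_tendstoD(2)) auto
  then obtain n where n: "Ip M p (\<lambda>w. f w - g n w) < e" by (auto simp: eventually_sequentially)
  have "\<bar>g n w\<bar> \<le> real n" for w by (auto simp: g_def)
  then show ?thesis using n by (intro exI[of _ "g n"] exI[of _ "real n"]) auto
qed

lemma (in prob_space) Ip_le_L2:
  assumes p: "0 < p" "p \<le> 2" and h: "h \<in> Lp M 2"
  shows "Ip M p h \<le> (\<integral>w. (h w)\<^sup>2 \<partial>M) powr (p / 2)"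
proof (cases "p = 2")
  case True
  then show ?thesis by simp
next
  case False
  then have p2: "p < 2" using p by simp
  define q where "q = 2 / (2 - p)"
  have q: "1 < 2 / p" "1 < q" "1 / (2 / p) + 1 / q = 1" using p p2 by (auto simp: q_def field_simps)
  have "(\<lambda>w. \<bar>h w\<bar> powr p) \<in> Lp M (2 / p)"
    using h LpD(1)[OF h] p by (intro LpI) (auto simp: powr_powr Lp_2_iff)
  from Lp_holder(2)[OF q this Lp_const[of q 1]] q p show ?thesis
    by (simp add: powr_powr prob_space)
qed

text \<open>Cauchy-Schwarz for \<open>|h|\<close> times \<open>|h| powr (p - 1)\<close>. Together
  with a uniform bound in \<open>L_r\<close> for \<open>r = 2 * p - 2\<close> it upgrades
  \<open>L_2\<close> convergence to \<open>L_p\<close> convergence.\<close>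

lemma (in prob_space) Ip_interpolate:
  assumes p: "2 < p" and h: "h \<in> Lp M 2" "h \<in> Lp M (2 * p - 2)"
  shows "Ip M p h \<le> sqrt (\<integral>w. (h w)\<^sup>2 \<partial>M) * sqrt (Ip M (2 * p - 2) h)"
proof -
  note [measurable] = LpD(1)[OF h(1)]
  have sq: "(\<bar>h w\<bar> powr (p - 1))\<^sup>2 = \<bar>h w\<bar> powr (2 * p - 2)" for w
    by (simp add: power2_eq_square flip: powr_add)
  have 1: "(\<lambda>w. \<bar>h w\<bar>) \<in> Lp M 2" using h(1) by (simp add: Lp_2_iff)
  have 2: "(\<lambda>w. \<bar>h w\<bar> powr (p - 1)) \<in> Lp M 2" using LpD(2)[OF h(2)] by (simp add: Lp_2_iff sq)
  have "\<bar>h w\<bar> * \<bar>h w\<bar> powr (p - 1) = \<bar>h w\<bar> powr p" for w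
    using powr_add[of "\<bar>h w\<bar>" 1 "p - 1"] by (cases "h w = 0") auto
  then show ?thesis using L2_mult(2)[OF 1 2] by (simp add: sq)
qed

section \<open>The closed span of the embedded summands is the range of the projection\<close>

context ind_sum
begin

text \<open>For \<open>p <= 2\<close> the \<open>L_2\<close> norm dominates. For
  \<open>p > 2\<close> a bounded \<open>f\<close> lies in every \<open>L_r\<close>, and
  interpolation applies.\<close>

lemma ipart_tendsto_iproj_Lp:
  assumes p: "1 < p" and f: "f \<in> borel_measurable N" "\<And>z. \<bar>f z\<bar> \<le> K" and e: "0 < e"
  shows "\<exists>n. Ip N p (\<lambda>z. iproj f z - ipart n f z) < e"
proof -
  have fL: "f \<in> Lp N r" if "0 \<le> r" for r using Lp_bounded[OF f that] .
  have f2: "f \<in> Lp N 2" by (rule fL) simp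
  define a where "a n = (\<integral>z. (iproj f z - ipart n f z)\<^sup>2 \<partial>N)" for n
  have a: "a \<longlonglongrightarrow> 0" unfolding a_def by (rule iproj(2)[OF f2])
  have a0: "0 \<le> a n" for n by (simp add: a_def)
  have D2: "(\<lambda>z. iproj f z - ipart n f z) \<in> Lp N 2" for n
    using Lp_diff(1)[OF _ iproj(1)[OF f2] part_L2[OF f2]] by simp
  have "(\<lambda>n. Ip N p (\<lambda>z. iproj f z - ipart n f z)) \<longlonglongrightarrow> 0"
  proof (cases "p \<le> 2")
    case True
    show ?thesis
    proof (rule Lim_null_comparison)
      show "\<forall>\<^sub>F n in sequentially. norm (Ip N p (\<lambda>z. iproj f z - ipart n f z)) \<le> a n powr (p / 2)"
        using Ip_le_L2[OF _ True D2] p Ip_nonneg by (intro always_eventually allI) (auto simp: a_def)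
      have "(\<lambda>n. a n powr (p / 2)) \<longlonglongrightarrow> 0 powr (p / 2)"
        using p a0 by (intro tendsto_powr2 a) auto
      then show "(\<lambda>n. a n powr (p / 2)) \<longlonglongrightarrow> 0" by simp
    qed
  next
    case False
    define r where "r = 2 * p - 2"
    have r: "2 < r" "0 < r" using False by (auto simp: r_def)
    \<comment> \<open>The partial sums are themselves approximable by trees, so their
      \<open>L_r\<close> bound has the same constant for every \<open>n\<close>.\<close>
    note B1 = appr_bound[OF r(1) appr_proj fL iproj(1)[OF f2]]
    note B2 = appr_bound[OF r(1) appr_part fL part_L2[OF f2]]
    define K where "K = 2 powr r * (Cp r powr r * Ip N r f + Cp r powr r * Ip N r f)"
    have D: "(\<lambda>z. iproj f z - ipart n f z) \<in> Lp N r" "Ip N r (\<lambda>z. iproj f z - ipart n f z) \<le> K" for n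
    proof -
      have L: "iproj f \<in> Lp N r" "ipart n f \<in> Lp N r" using B1(1) B2(1) r by auto
      show "(\<lambda>z. iproj f z - ipart n f z) \<in> Lp N r" by (rule Lp_diff(1)[OF r(2) L])
      have "Ip N r (\<lambda>z. iproj f z - ipart n f z) \<le> 2 powr r * (Ip N r (iproj f) + Ip N r (ipart n f))"
        by (rule Lp_diff(2)[OF r(2) L])
      also have "\<dots> \<le> K" unfolding K_def using B1(2) B2(2) r by (intro mult_left_mono add_mono) auto
      finally show "Ip N r (\<lambda>z. iproj f z - ipart n f z) \<le> K" .
    qed
    show ?thesis
    proof (rule Lim_null_comparison)
      show "\<forall>\<^sub>F n in sequentially. norm (Ip N p (\<lambda>z. iproj f z - ipart n f z)) \<le> sqrt (a n) * sqrt K"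
      proof (intro always_eventually allI)
        fix n
        have "Ip N p (\<lambda>z. iproj f z - ipart n f z) \<le> sqrt (a n) * sqrt (Ip N r (\<lambda>z. iproj f z - ipart n f z))"
          unfolding a_def r_def using False D(1)[of n] by (intro Ip_interpolate D2) (auto simp: r_def)
        also have "\<dots> \<le> sqrt (a n) * sqrt K" using D(2)[of n] a0 by (intro mult_left_mono) auto
        finally show "norm (Ip N p (\<lambda>z. iproj f z - ipart n f z)) \<le> sqrt (a n) * sqrt K"
          using Ip_nonneg[of N "\<lambda>z. iproj f z - ipart n f z" p] by simp
      qed
      have "(\<lambda>n. sqrt (a n) * sqrt K) \<longlonglongrightarrow> sqrt 0 * sqrt K" by (intro tendsto_intros a)
      then show "(\<lambda>n. sqrt (a n) * sqrt K) \<longlonglongrightarrow> 0" by simp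
    qed
  qed
  then have "\<forall>\<^sub>F n in sequentially. Ip N p (\<lambda>z. iproj f z - ipart n f z) < e"
    using e by (intro order_tendstoD(2)) auto
  then show ?thesis by (auto simp: eventually_sequentially)
qed

definition summand :: "real \<Rightarrow> nat \<Rightarrow> ('a \<Rightarrow> real) set" where
  "summand p y = Lp_closure (M y) p (P y ` (Lp (M y) 2 \<inter> Lp (M y) p))"

definition embedded :: "real \<Rightarrow> ((nat \<Rightarrow> 'a) \<Rightarrow> real) set" where
  "embedded p = (\<Union>y\<in>I. {b \<in> Lp N p. \<exists>g\<in>summand p y. AE z in N. b z = g (z y)})"

lemma P_in_embedded:
  assumes p: "1 < p" and y: "y \<in> I" and h: "h \<in> Lp (M y) 2" "h \<in> Lp (M y) p"
  shows "(\<lambda>z. P y h (z y)) \<in> embedded p"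
proof -
  have pos: "0 < p" using p by simp
  note b = orth_proj_appr_bound[OF M[OF y] p P[OF y] Pa[OF y]]
  have "P y ` (Lp (M y) 2 \<inter> Lp (M y) p) \<subseteq> summand p y"
    unfolding summand_def using b by (intro subset_Lp_closure[OF pos]) auto
  then have "P y h \<in> summand p y" using h by auto
  moreover have "(\<lambda>z. P y h (z y)) \<in> Lp N p" using b[OF h] by (intro Lp_coord(1)[OF y]) auto
  ultimately show ?thesis unfolding embedded_def using y by auto
qed

text \<open>\<open>embedded p\<close> is closed under almost sure equality, so it contains the
  constant itself and not only \<open>P y\<close> of it. This supplies the mean in
  \<open>part_in_span\<close>.\<close>

lemma const_in_embedded:
  assumes p: "1 < p" and y: "y \<in> I"
  shows "(\<lambda>_. 1) \<in> embedded p"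
proof -
  interpret My: prob_space "M y" by (rule M[OF y])
  have one: "(\<lambda>_. 1) \<in> Lp (M y) 2" "(\<lambda>_. 1) \<in> Lp (M y) p" "(\<lambda>_. 1) \<in> Lp N p" using p by auto
  have "(\<lambda>z. P y (\<lambda>_. 1) (z y)) \<in> embedded p" by (rule P_in_embedded[OF p y one(1,2)])
  then obtain j g where j: "j \<in> I" "g \<in> summand p j" "AE z in N. P y (\<lambda>_. 1) (z y) = g (z j)"
    by (auto simp: embedded_def)
  have "AE z in N. P y (\<lambda>_. 1) (z y) = 1" by (rule AE_coord[OF y P1[OF y]])
  with j(3) have "AE z in N. 1 = g (z j)" by eventually_elim simp
  then show ?thesis unfolding embedded_def using j one by auto
qed

text \<open>Boundedness of \<open>f\<close> passes to its conditional expectations and puts them in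
  \<open>L_2\<close> and \<open>L_p\<close> at once, as membership in the summands requires.\<close>

lemma part_in_span:
  assumes p: "1 < p" and y: "y \<in> I" and f: "f \<in> borel_measurable N" "\<And>z. \<bar>f z\<bar> \<le> K"
  shows "ipart n f \<in> lin_span (embedded p)"
proof -
  have f2: "f \<in> Lp N 2" by (rule Lp_bounded[OF f]) auto
  have K0: "0 \<le> K" using f(2)[of undefined] by linarith
  have sec: "sec i f \<in> Lp (M i) r" if i: "i \<in> I" and r: "0 \<le> r" for i r
  proof -
    interpret Mi: prob_space "M i" by (rule M[OF i])
    show ?thesis
    proof (rule Mi.Lp_bounded[where K=K, OF _ _ r])
      show "sec i f \<in> borel_measurable (M i)" by (rule LpD(1)[OF sec_L2[OF i f2]])
      fix w
      have "\<bar>sec i f w\<bar> \<le> (\<integral>z. \<bar>f (z(i := w))\<bar> \<partial>N)" unfolding sec_def by (rule integral_abs_bound)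
      also have "\<dots> \<le> (\<integral>z. K \<partial>N)"
        using f(2) K0 by (intro Bochner_Integration.integral_mono') auto
      finally show "\<bar>sec i f w\<bar> \<le> K" by (simp add: prob_space)
    qed
  qed
  have "(\<lambda>z. mean f + (\<Sum>i\<in>J. P i (sec i f) (z i) - mean f)) \<in> lin_span (embedded p)" if "finite J" "J \<subseteq> I" for J
    using that
  proof (induction J rule: finite_induct)
    case empty
    have "(\<lambda>z. mean f * 1 + 0 * 1) \<in> lin_span (embedded p)"
      by (intro lin_span_lincomb lin_span_base const_in_embedded[OF p y])
    then show ?case by simp
  next
    case (insert i J)
    have i: "i \<in> I" using insert by simp
    have "(\<lambda>z. P i (sec i f) (z i)) \<in> embedded p" using p by (intro P_in_embedded[OF p i] sec[OF i]) auto
    then have "(\<lambda>z. 1 * P i (sec i f) (z i) + (- mean f) * 1) \<in> lin_span (embedded p)"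
      by (intro lin_span_lincomb lin_span_base const_in_embedded[OF p y])
    from lin_span_lincomb[OF insert.IH this, of 1 1] insert show ?case by (simp add: algebra_simps)
  qed
  from this[of "I \<inter> {..<n}"] show ?thesis by (simp add: ipart_def[abs_def])
qed

text \<open>One inclusion holds since \<open>iproj\<close> acts on a function of one coordinate as
  the projection of that factor. For the other, \<open>f\<close> is truncated, the
  \<open>p\<close>-bound of \<open>iproj\<close> controls the change, and the partial sums of the
  truncation lie in the span.\<close>

lemma closure_span_embedded:
  assumes p: "1 < p" and I: "I \<noteq> {}"
  shows "Lp_closure N p (lin_span (embedded p)) = Lp_closure N p (iproj ` (Lp N 2 \<inter> Lp N p))"
    (is "_ = ?C")
proof
  have pos: "0 < p" using p by simp
  note b = orth_proj_appr_bound[OF prob_space_N p orth_proj_proj appr_proj]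
  have PL: "iproj ` (Lp N 2 \<inter> Lp N p) \<subseteq> Lp N p" using b by auto
  have eL: "embedded p \<subseteq> Lp N p" by (auto simp: embedded_def)
  have sL: "lin_span (embedded p) \<subseteq> Lp N p"
    by (rule lin_span_subset[OF eL]) (use pos in \<open>auto intro: Lp_lincomb\<close>)
  have lc: "(\<lambda>z. a * f z + c * g z) \<in> ?C" if "f \<in> ?C" "g \<in> ?C" for a c f g
    by (rule closure_range_lincomb[OF prob_space_N p orth_proj_proj appr_proj that])
  have emb: "embedded p \<subseteq> ?C"
  proof
    fix u assume "u \<in> embedded p"
    then obtain y g where u: "u \<in> Lp N p" and y: "y \<in> I" and g: "g \<in> summand p y" and ae: "AE z in N. u z = g (z y)"
      by (auto simp: embedded_def)
    have gL: "g \<in> Lp (M y) p" using g by (simp add: summand_def Lp_closure_iff[OF pos])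
    have "\<exists>h\<in>iproj ` (Lp N 2 \<inter> Lp N p). Ip N p (\<lambda>z. u z - h z) < e" if e: "0 < e" for e
    proof -
      obtain h where h: "h \<in> Lp (M y) 2" "h \<in> Lp (M y) p" "Ip (M y) p (\<lambda>w. g w - P y h w) < e"
        using g e by (auto simp: summand_def Lp_closure_iff[OF pos])
      have hN: "(\<lambda>z. h (z y)) \<in> Lp N 2" "(\<lambda>z. h (z y)) \<in> Lp N p" using Lp_coord(1)[OF y] h by auto
      have Ph: "P y h \<in> Lp (M y) p" using orth_proj_appr_bound[OF M[OF y] p P[OF y] Pa[OF y] h(1,2)] by simp
      have D: "(\<lambda>w. g w - P y h w) \<in> Lp (M y) p" by (rule Lp_diff(1)[OF pos gL Ph])
      have ae': "AE z in N. u z - iproj (\<lambda>z. h (z y)) z = g (z y) - P y h (z y)"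
        using ae proj_coord[OF y h(1)] by eventually_elim simp
      have "Ip N p (\<lambda>z. u z - iproj (\<lambda>z. h (z y)) z) = Ip N p (\<lambda>z. g (z y) - P y h (z y))"
        by (rule Ip_cong_AE[OF ae' LpD(1)[OF Lp_diff(1)[OF pos u]] LpD(1)[OF Lp_coord(1)[OF y D]]]) (use b[OF hN] in simp)
      also have "\<dots> < e" using Lp_coord(2)[OF y D] h(3) by simp
      finally show ?thesis using hN by blast
    qed
    then show "u \<in> ?C" using u by (simp add: Lp_closure_iff[OF pos])
  qed
  have ne: "(\<lambda>_. 1) \<in> ?C" using emb const_in_embedded[OF p] I by blast
  have zero: "(\<lambda>_. 0) \<in> ?C" using lc[OF ne ne, of 0 0] by simp
  have "lin_span (embedded p) \<subseteq> ?C" by (rule lin_span_subset[OF emb zero lc])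
  then show "Lp_closure N p (lin_span (embedded p)) \<subseteq> ?C" by (rule Lp_closure_subset[OF pos _ PL])
  obtain y where y: "y \<in> I" using I by blast
  show "?C \<subseteq> Lp_closure N p (lin_span (embedded p))"
  proof (rule Lp_closure_subset[OF pos _ sL])
    show "iproj ` (Lp N 2 \<inter> Lp N p) \<subseteq> Lp_closure N p (lin_span (embedded p))"
    proof
      fix u assume "u \<in> iproj ` (Lp N 2 \<inter> Lp N p)"
      then obtain f where f: "f \<in> Lp N 2" "f \<in> Lp N p" and u: "u = iproj f" by auto
      have uL: "u \<in> Lp N p" using b[OF f] u by simp
      have "\<exists>h\<in>lin_span (embedded p). Ip N p (\<lambda>z. u z - h z) < e" if e: "0 < e" for e
      proof -
        define c where "c = Cp (max p (p / (p - 1))) powr p"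
        have c: "0 \<le> c" by (simp add: c_def)
        \<comment> \<open>Truncation contributes \<open>c * \<delta>\<close>, the partial sum
          contributes \<open>\<delta>\<close>, and the crude triangle inequality multiplies by
          \<open>2 powr p\<close>.\<close>
        define \<delta> where "\<delta> = e / (2 powr p * (c + 1))"
        have \<delta>: "0 < \<delta>" using e c by (simp add: \<delta>_def)
        obtain g K where g: "g \<in> borel_measurable N" "\<And>z. \<bar>g z\<bar> \<le> K" "Ip N p (\<lambda>z. f z - g z) < \<delta>"
          using Lp_truncate[OF pos f(2) \<delta>] by auto
        have gL: "g \<in> Lp N 2" "g \<in> Lp N p" using Lp_bounded[OF g(1,2)] p by auto
        obtain n where n: "Ip N p (\<lambda>z. iproj g z - ipart n g z) < \<delta>"
          using ipart_tendsto_iproj_Lp[OF p g(1,2) \<delta>] by auto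
        define h where "h = ipart n g"
        have h: "h \<in> lin_span (embedded p)" unfolding h_def by (rule part_in_span[OF p y g(1,2)])
        have hL: "h \<in> Lp N p" using h sL by auto
        have fg: "(\<lambda>z. f z - g z) \<in> Lp N 2" "(\<lambda>z. f z - g z) \<in> Lp N p" 
          using Lp_diff(1)[of 2 f N g] Lp_diff(1)[of p f N g] f gL pos by auto
        have "AE z in N. iproj (\<lambda>v. 1 * f v + (-1) * g v) z = 1 * iproj f z + (-1) * iproj g z"
          by (rule orth_projD(3)[OF orth_proj_proj f(1) gL(1)])
        then have ae: "AE z in N. u z - iproj g z = iproj (\<lambda>z. f z - g z) z" unfolding u by eventually_elim simp
        have pg: "iproj g \<in> Lp N p" using b[OF gL] by simp
        have "Ip N p (\<lambda>z. u z - iproj g z) = Ip N p (iproj (\<lambda>z. f z - g z))"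
          by (rule Ip_cong_AE[OF ae LpD(1)[OF Lp_diff(1)[OF pos uL pg]]]) (use LpD(1)[OF iproj(1)[OF fg(1)]] in simp)
        also have "\<dots> \<le> c * Ip N p (\<lambda>z. f z - g z)" using b[OF fg] by (simp add: c_def)
        also have "\<dots> \<le> c * \<delta>" using g(3) c by (intro mult_left_mono) auto
        finally have 1: "Ip N p (\<lambda>z. u z - iproj g z) \<le> c * \<delta>" .
        have "Ip N p (\<lambda>z. u z - h z) \<le> 2 powr p * (Ip N p (\<lambda>z. u z - iproj g z) + Ip N p (\<lambda>z. iproj g z - h z))"
          by (rule Lp_triangle[OF pos uL pg hL])
        also have "\<dots> < 2 powr p * (c * \<delta> + \<delta>)" using 1 n by (intro mult_strict_left_mono add_le_less_mono) (auto simp: h_def)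
        also have "\<dots> = (2 powr p * (c + 1)) * \<delta>" by (simp add: algebra_simps)
        also have "\<dots> = e" using c by (simp add: \<delta>_def)
        finally show ?thesis using h by blast
      qed
      then show "u \<in> Lp_closure N p (lin_span (embedded p))" using uL by (simp add: Lp_closure_iff[OF pos])
    qed
  qed
qed

lemma good_independent:
  assumes p: "1 < p" and I: "I \<noteq> {}"
  shows "good p N (Lp_closure N p (lin_span (embedded p)))"
  unfolding good_def closure_span_embedded[OF p I]
  using prob_space_N orth_proj_proj proj_one appr_proj by blast

end

section \<open>The spaces \<open>R\<^sup>p\<^sub>\<alpha>\<close>\<close>

text \<open>Functions are pulled back along \<open>\<iota>\<close> and extended along
  \<open>inv \<iota>\<close>; the values off the range of \<open>\<iota>\<close> enter no
  integral.\<close>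

lemma Lp_closure_lin_span_embed:
  fixes \<iota> :: "'a \<Rightarrow> 'b"
  assumes i: "inj \<iota>" and p: "0 < p" and XY: "\<And>b. b \<in> Y \<longleftrightarrow> (\<lambda>w. b (\<iota> w)) \<in> X"
  shows "Lp_closure (embed_measure M \<iota>) p (lin_span Y) = {b. (\<lambda>w. b (\<iota> w)) \<in> Lp_closure M p (lin_span X)}"
proof -
  have ii: "inv \<iota> (\<iota> w) = w" for w using i by simp
  note E = Lp_embed[OF i] integral_embed[OF i]
  have "(\<exists>f\<in>lin_span Y. Ip (embed_measure M \<iota>) p (\<lambda>z. b z - f z) < e) \<longleftrightarrow>
    (\<exists>f\<in>lin_span X. Ip M p (\<lambda>w. b (\<iota> w) - f w) < e)" for b e
  proof safe
    fix f assume f: "f \<in> lin_span Y" and le: "Ip (embed_measure M \<iota>) p (\<lambda>z. b z - f z) < e"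
    from f obtain n :: nat and c g where g: "f = (\<lambda>w. \<Sum>i<n. c i * g i w)" "\<forall>i<n. g i \<in> Y" by (rule lin_spanE)
    have "(\<lambda>w. f (\<iota> w)) \<in> lin_span X"
      unfolding lin_span_def g(1)
      by (intro CollectI exI[of _ n] exI[of _ c] exI[of _ "\<lambda>i w. g i (\<iota> w)"]) (use g(2) XY in auto)
    then show "\<exists>f\<in>lin_span X. Ip M p (\<lambda>w. b (\<iota> w) - f w) < e"
      by (rule bexI[rotated]) (use le in \<open>simp only: E\<close>)
  next
    fix f assume f: "f \<in> lin_span X" and le: "Ip M p (\<lambda>w. b (\<iota> w) - f w) < e"
    from f obtain n :: nat and c g where g: "f = (\<lambda>w. \<Sum>i<n. c i * g i w)" "\<forall>i<n. g i \<in> X" by (rule lin_spanE)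
    have "(\<lambda>z. f (inv \<iota> z)) \<in> lin_span Y"
      unfolding lin_span_def g(1)
      by (intro CollectI exI[of _ n] exI[of _ c] exI[of _ "\<lambda>i z. g i (inv \<iota> z)"]) (use g(2) XY ii in auto)
    then show "\<exists>f\<in>lin_span Y. Ip (embed_measure M \<iota>) p (\<lambda>z. b z - f z) < e"
      by (rule bexI[rotated]) (use le in \<open>simp only: E ii\<close>)
  qed
  then show ?thesis unfolding set_eq_iff mem_Collect_eq Lp_closure_iff[OF p] E by blast
qed

text \<open>\<open>F\<close> is arbitrary and assumed good only below \<open>x\<close>, because
  well-founded recursion supplies a function cut off at the predecessors of
  \<open>x\<close>.\<close>

lemma good_R_step:
  assumes p: "1 < p" and F: "\<And>y. (y, x) \<in> r - Id \<Longrightarrow> good p (fst (F y)) (snd (F y))"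
  shows "good p (fst (R_step p r F x)) (snd (R_step p r F x))"
proof -
  define Pr where "Pr = {y. (y, x) \<in> r - Id}"
  have FP: "good p (fst (F y)) (snd (F y))" if "y \<in> Pr" for y using F that by (simp add: Pr_def)
  have pos: "0 < p" using p by simp
  consider (zero) "Pr = {}" | (suc) "Pr \<noteq> {}" "\<exists>y\<in>Pr. \<forall>z\<in>Pr. (z, y) \<in> r"
    | (lim) "Pr \<noteq> {}" "\<not> (\<exists>y\<in>Pr. \<forall>z\<in>Pr. (z, y) \<in> r)" by blast
  then show ?thesis
  proof cases
    case zero
    have i: "inj Leaf" by (auto intro: injI)
    let ?M = "embed_measure coin Leaf"
    have R: "R_step p r F x = (?M, {f \<in> Lp ?M p. \<exists>c. AE w in ?M. f w = c})"
      unfolding R_step_def Let_def Pr_def[symmetric] using zero by simp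
    have "{b. (\<lambda>w. b (Leaf w)) \<in> {f \<in> Lp coin p. \<exists>c. AE w in coin. f w = c}} = {f \<in> Lp ?M p. \<exists>c. AE w in ?M. f w = c}"
      by (simp add: Lp_embed[OF i] AE_embed_measure[OF i])
    with good_embed[OF i p good_constants[OF prob_space_coin p]] show ?thesis unfolding R fst_conv snd_conv by simp
  next
    case suc
    define y where "y = (SOME y. y \<in> Pr \<and> (\<forall>z\<in>Pr. (z, y) \<in> r))"
    have y: "y \<in> Pr" using suc(2) unfolding y_def by (rule bexE) (rule someI2, blast, blast)
    define \<iota> where "\<iota> = (\<lambda>(w, e). Node w e)"
    have i: "inj \<iota>" by (auto simp: \<iota>_def intro!: injI)
    let ?N = "fst (F y) \<Otimes>\<^sub>M coin"
    let ?M = "embed_measure ?N \<iota>"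
    let ?B = "snd (F y)"
    have R: "R_step p r F x = (?M, {b \<in> Lp ?M p. \<exists>b0\<in>?B. \<exists>b1\<in>?B.
                 AE z in ?N. b (Node (fst z) (snd z)) = (if snd z then b1 (fst z) else b0 (fst z))})"
      unfolding R_step_def Let_def Pr_def[symmetric] y_def[symmetric] \<iota>_def[symmetric] using suc by simp
    have "{b. (\<lambda>z. b (\<iota> z)) \<in> {b \<in> Lp ?N p. \<exists>b0\<in>?B. \<exists>b1\<in>?B. AE z in ?N. b z = (if snd z then b1 (fst z) else b0 (fst z))}}
      = {b \<in> Lp ?M p. \<exists>b0\<in>?B. \<exists>b1\<in>?B.
                 AE z in ?N. b (Node (fst z) (snd z)) = (if snd z then b1 (fst z) else b0 (fst z))}"
      unfolding Lp_embed[OF i] mem_Collect_eq by (simp add: \<iota>_def split_def)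
    with good_embed[OF i p good_disjoint[OF p FP[OF y]]] show ?thesis unfolding R fst_conv snd_conv by simp
  next
    case lim
    have "\<forall>y\<in>Pr. \<exists>P. orth_proj (fst (F y)) P \<and> (AE w in fst (F y). P (\<lambda>_. 1) w = 1) \<and> appr (fst (F y)) P \<and>
       snd (F y) = Lp_closure (fst (F y)) p (P ` (Lp (fst (F y)) 2 \<inter> Lp (fst (F y)) p))"
      using FP by (simp add: good_def)
    from bchoice[OF this] obtain P where Pspec: "\<forall>y\<in>Pr. orth_proj (fst (F y)) (P y) \<and> (AE w in fst (F y). P y (\<lambda>_. 1) w = 1) \<and>
       appr (fst (F y)) (P y) \<and> snd (F y) = Lp_closure (fst (F y)) p (P y ` (Lp (fst (F y)) 2 \<inter> Lp (fst (F y)) p))" ..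
    interpret ind_sum Pr "\<lambda>y. fst (F y)" P
    proof (rule ind_sum.intro)
      fix y assume y: "y \<in> Pr"
      show "prob_space (fst (F y))" using FP[OF y] by (simp add: good_def)
      note Py = Pspec[rule_format, OF y]
      show "orth_proj (fst (F y)) (P y)" by (rule Py[THEN conjunct1])
      show "AE w in fst (F y). P y (\<lambda>_. 1) w = 1" by (rule Py[THEN conjunct2, THEN conjunct1])
      show "appr (fst (F y)) (P y)" by (rule Py[THEN conjunct2, THEN conjunct2, THEN conjunct1])
    qed
    have i: "inj PT_Prod" by (auto intro: injI)
    let ?M = "embed_measure N PT_Prod"
    define Y where "Y = (\<Union>y\<in>Pr. {b \<in> Lp ?M p. \<exists>g\<in>snd (F y). AE z in ?M. b z = g (coord y z)})"
    have R: "R_step p r F x = (?M, Lp_closure ?M p (lin_span Y))"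
      unfolding R_step_def Let_def Pr_def[symmetric] Y_def if_not_P[OF lim(1)] if_not_P[OF lim(2)] ..
    have sm: "snd (F y) = summand p y" if "y \<in> Pr" for y 
      unfolding summand_def by (rule Pspec[rule_format, OF that, THEN conjunct2, THEN conjunct2, THEN conjunct2])
    have "b \<in> Y \<longleftrightarrow> (\<lambda>w. b (PT_Prod w)) \<in> embedded p" for b
      unfolding Y_def embedded_def by (auto simp: Lp_embed[OF i] AE_embed_measure[OF i] coord_def sm)
    from Lp_closure_lin_span_embed[OF i pos this]
    have "Lp_closure ?M p (lin_span Y) = {b. (\<lambda>w. b (PT_Prod w)) \<in> Lp_closure N p (lin_span (embedded p))}" .
    with good_embed[OF i p good_independent[OF p lim(1)]] show ?thesis unfolding R fst_conv snd_conv by simp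
  qed
qed

lemma good_R_space:
  assumes p: "1 < p" and r: "wf (r - Id)"
  shows "good p (fst (R_space p r x)) (snd (R_space p r x))"
  using r
proof (induction x rule: wf_induct_rule)
  case (less x)
  have "R_space p r x = R_step p r (cut (R_space p r) (r - Id) x) x"
    unfolding R_space_def by (rule wfrec[OF r])
  moreover have "good p (fst (cut (R_space p r) (r - Id) x y)) (snd (cut (R_space p r) (r - Id) x y))" if "(y, x) \<in> r - Id" for y
    unfolding cut_apply[OF that, of "R_space p r"] by (rule less[OF that])
  ultimately show ?case using good_R_step[OF p, of x r "cut (R_space p r) (r - Id) x"] by simp
qed

theorem mainTheorem4:
  fixes p :: real and r :: "nat rel" and x :: nat
  assumes "1 < p"
    and "Well_order r" and "x \<in> Field r"
  shows "let q = p / (p - 1); ps = max p q in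
         C_orth_complemented (fst (R_space p r x)) p ((ps - 1)^2 * (ps / 2) powr (3/2))
           (snd (R_space p r x))"
proof -
  have "wf (r - Id)" using assms(2) by (simp add: well_order_on_def)
  from good_imp_complemented[OF assms(1) good_R_space[OF assms(1) this]]
  show ?thesis by (simp add: Let_def Cp_def)
qed

end
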